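(* Let $D$ be a domain in $\mathbb R^n$, $n\ge2$, and let $f_j$, $j=1,2,\dots$, be homeomorphisms of $D$ into $\mathbb R^n$ of class $W^{1,1}_{\rm loc}(D)$ converging locally uniformly to a mapping $f:D\to\mathbb R^n$ which is differentiable a.e. in $D$. If $P_{f_j}(x)\le P(x)$ for all $j$ and a.e. $x\in D$, with some $P\in L^1_{\rm loc}(D)$, then $P_f(x)\le\limsup_{j\to\infty}P_{f_j}(x)$ for a.e. $x\in D$. Moreover, if $f$ is a homeomorphism, then $f\in W^{1,1}_{\rm loc}(D)$ and $\partial_if_j\to\partial_if$ weakly in $L^1_{\rm loc}(D)$ as $j\to\infty$ for all $i=1,\dots,n$.
   Context: For $x\in D$ with all first partials, $\|f'(x)\|=\sup_{|h|=1}|f'(x)h|$, $J_f(x)=\det f'(x)$; the outer dilatation is $K_f(x)=\|f'(x)\|^n/|J_f(x)|$ if $J_f(x)\ne0$, $K_f(x)=1$ if $f'(x)=0$, and $K_f(x)=\infty$ otherwise (including points without first partial derivatives). $P_f(x)=K_f(x)^{1/(n-1)}$. *)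

theory Defs
  imports "HOL-Analysis.Analysis" "HOL-Library.Liminf_Limsup"
begin

text \<open>Classical partial derivative along the i-th coordinate axis.\<close>
definition partial_dir :: "(real^'n \<Rightarrow> 'b::real_normed_vector) \<Rightarrow> 'n \<Rightarrow> real^'n \<Rightarrow> 'b" where
  "partial_dir f i x = vector_derivative (\<lambda>t. f (x + t *\<^sub>R axis i 1)) (at 0)"

definition has_all_partials :: "(real^'n \<Rightarrow> 'b::real_normed_vector) \<Rightarrow> real^'n \<Rightarrow> bool" where
  "has_all_partials f x \<longleftrightarrow> (\<forall>i. (\<lambda>t. f (x + t *\<^sub>R axis i 1)) differentiable (at 0))"

text \<open>Jacobian matrix f'(x): entry (k,i) is the i-th partial of the k-th component.\<close>
definition jac :: "(real^'n \<Rightarrow> real^'n) \<Rightarrow> real^'n \<Rightarrow> real^'n^'n" where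
  "jac f x = (\<chi> k i. partial_dir f i x $ k)"

text \<open>Outer dilatation K_f, with values in [0,\<infinity>].\<close>
definition K_dil :: "(real^'n \<Rightarrow> real^'n) \<Rightarrow> real^'n \<Rightarrow> ereal" where
  "K_dil f x =
     (if has_all_partials f x then
        (if det (jac f x) \<noteq> 0
         then ereal (onorm ((*v) (jac f x)) ^ CARD('n) / \<bar>det (jac f x)\<bar>)
         else if jac f x = 0 then 1 else \<infinity>)
      else \<infinity>)"

text \<open>P_f = K_f^(1/(n-1)), with the convention \<infinity>^a = \<infinity>.\<close>
definition P_dil :: "(real^'n \<Rightarrow> real^'n) \<Rightarrow> real^'n \<Rightarrow> ereal" where
  "P_dil f x = (case K_dil f x of
                  ereal r \<Rightarrow> ereal (r powr (1 / (real CARD('n) - 1)))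
                | PInfty \<Rightarrow> \<infinity>
                | MInfty \<Rightarrow> -\<infinity>)"

text \<open>Locally integrable on D (L^1_loc(D)).\<close>
definition loc_integrable :: "(real^'n) set \<Rightarrow> (real^'n \<Rightarrow> 'b::euclidean_space) \<Rightarrow> bool" where
  "loc_integrable D g \<longleftrightarrow> (\<forall>K. compact K \<and> K \<subseteq> D \<longrightarrow> g absolutely_integrable_on K)"

text \<open>C-infinity functions: all partial derivatives of all orders exist everywhere and are continuous.\<close>
definition smooth_fun :: "(real^'n \<Rightarrow> real) \<Rightarrow> bool" where
  "smooth_fun \<phi> \<longleftrightarrow>
     (\<forall>is::'n list. continuous_on UNIV (foldr (\<lambda>i g. partial_dir g i) is \<phi>) \<and>
                    (\<forall>x. has_all_partials (foldr (\<lambda>i g. partial_dir g i) is \<phi>) x))"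

text \<open>Test functions C_c^\<infinity>(D).\<close>
definition test_fun :: "(real^'n) set \<Rightarrow> (real^'n \<Rightarrow> real) \<Rightarrow> bool" where
  "test_fun D \<phi> \<longleftrightarrow> smooth_fun \<phi> \<and>
     (\<exists>K. compact K \<and> K \<subseteq> D \<and> (\<forall>x. x \<notin> K \<longrightarrow> \<phi> x = 0))"

text \<open>g is a weak i-th partial derivative of f on D.\<close>
definition weak_partial :: "(real^'n) set \<Rightarrow> (real^'n \<Rightarrow> real^'m) \<Rightarrow> 'n \<Rightarrow> (real^'n \<Rightarrow> real^'m) \<Rightarrow> bool" where
  "weak_partial D f i g \<longleftrightarrow> loc_integrable D g \<and>
     (\<forall>\<phi>. test_fun D \<phi> \<longrightarrow>
        integral D (\<lambda>x. partial_dir \<phi> i x *\<^sub>R f x) = - integral D (\<lambda>x. \<phi> x *\<^sub>R g x))"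

text \<open>Sobolev class W^{1,1}_loc(D).\<close>
definition W11_loc :: "(real^'n) set \<Rightarrow> (real^'n \<Rightarrow> real^'m) \<Rightarrow> bool" where
  "W11_loc D f \<longleftrightarrow> loc_integrable D f \<and> (\<forall>i. \<exists>g. weak_partial D f i g)"

text \<open>Weak convergence in L^1_loc(D): weak L^1(K) convergence on every compact K in D
  (tested against bounded measurable functions, i.e. L^\<infinity>(K) = L^1(K)^*).\<close>
definition weak_conv_L1loc :: "(real^'n) set \<Rightarrow> (nat \<Rightarrow> real^'n \<Rightarrow> real^'m) \<Rightarrow> (real^'n \<Rightarrow> real^'m) \<Rightarrow> bool" where
  "weak_conv_L1loc D g G \<longleftrightarrow>
     (\<forall>K h. compact K \<and> K \<subseteq> D \<and> h measurable_on K \<and> bounded (h ` K) \<longrightarrow>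
        (\<lambda>j. integral K (\<lambda>x. g j x \<bullet> h x)) \<longlonglongrightarrow> integral K (\<lambda>x. G x \<bullet> h x))"

end

theory Submission
  imports Defs
begin

text \<open>Write \<open>n\<close> for the dimension and \<open>P\<close> for the bound on the dilatations. Young's inequality turns the
  distortion inequality \<open>\<bar>f'\<bar>^n \<le> P^(n-1) \<bar>J\<bar>\<close> into \<open>\<bar>f'\<bar> \<le> (n-1)/n l P + \<bar>J\<bar> / (n l^(n-1))\<close> for every \<open>l > 0\<close>.
  A continuous injective map with weak derivatives is approximately differentiable almost everywhere, so the integral of
  \<open>\<bar>J\<bar>\<close> over a set is at most the volume of its image. These volumes stay bounded along a locally uniformly convergent
  sequence, and letting \<open>l\<close> grow makes the gradients locally equi-integrable. Equi-integrability passes the fundamental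
  theorem along translations to the limit, so the classical partial derivatives of the limit are weak ones, and it
  upgrades convergence against test functions to weak convergence in \<open>L^1\<close>.

  For the pointwise bound, apply the same inequality on a small cube with corner \<open>x\<close>, at which the limit \<open>f\<close> is
  differentiable and the upper limit \<open>q\<close> of the dilatations has a Lebesgue point. The increments of \<open>f_j\<close> control
  \<open>\<bar>f'(x) h\<bar>\<close> from below, the reverse Fatou lemma controls the integrals of the dilatations, and the images of
  the cube lie in a neighbourhood of an affine parallelepiped of volume proportional to \<open>\<bar>J_f(x)\<bar>\<close>. This yields
  \<open>\<bar>f'(x)\<bar> \<le> (n-1)/n l q(x) + \<bar>J_f(x)\<bar> / (n l^(n-1))\<close> for all \<open>l > 0\<close>; optimising \<open>l\<close> gives back the
  distortion inequality with \<open>q(x)\<close>.\<close>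

section \<open>Smooth bump functions\<close>

text \<open>A homeomorphism of class \<open>W11_loc\<close> need not be totally differentiable
  almost everywhere once the dimension exceeds two, so substitution cannot be applied to
  \<open>fs j\<close> directly. What a weak gradient does give is the fundamental theorem along each
  fixed translation, for almost every base point. It yields differentiability relative to countably
  many sets that fill the domain up to a null set, and there substitution works. The image of the
  leftover null set may have positive volume, so only an inequality survives, in the direction that
  is needed.

  \<open>P_dil\<close> is built from classical partial derivatives while the Sobolev hypotheses
  speak of weak ones. Since the dilatation is infinite where a partial derivative is missing, the
  bound by \<open>P\<close> supplies the classical derivatives almost everywhere; they are then
  identified with the weak ones.

  The parameter \<open>l\<close> makes the distortion inequality linear in the dilatation and the
  Jacobian. Linear terms can be integrated and pass to limits separately, and nothing is lost,
  because the inequality for all \<open>l\<close> is equivalent to the original one.\<close>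

definition expdec :: "nat \<Rightarrow> real \<Rightarrow> real" where
  "expdec k t = (if t > 0 then (1/t) ^ k * exp (- (1/t)) else 0)"

lemma expdec_tendsto_0: "(expdec k \<longlongrightarrow> 0) (at_right 0)"
proof -
  have "((\<lambda>x::real. x ^ k / exp x) \<longlongrightarrow> 0) at_top"
    by (rule tendsto_power_div_exp_0)
  then have "((\<lambda>t::real. (inverse t) ^ k / exp (inverse t)) \<longlongrightarrow> 0) (at_right 0)"
    by (rule filterlim_compose[OF _ filterlim_inverse_at_top_right])
  then show ?thesis
    by (rule Lim_transform_eventually)
       (auto simp: expdec_def eventually_at_right_field exp_minus field_simps intro: exI[of _ 1])
qed

text \<open>The powers of \<open>1/t\<close> are part of the definition because differentiation
  stays inside the span of the family they form. Flatness at 0 is proved for every \<open>k\<close>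
  at once, so the gluing at 0 needs no induction on the order of differentiation.\<close>

lemma expdec_has_derivative:
  "(expdec k has_real_derivative (expdec (k + 2) t - real k * expdec (k + 1) t)) (at t)"
proof (cases "t > 0")
  case True
  have "((\<lambda>t. (1/t) ^ k * exp (- (1/t))) has_real_derivative
      (expdec (k + 2) t - real k * expdec (k + 1) t)) (at t)"
  proof -
    have "((\<lambda>u::real. u ^ k * exp (- u)) has_real_derivative
        (real k * u ^ (k - 1) - u ^ k) * exp (- u)) (at u)" for u
      by (auto intro!: derivative_eq_intros simp: algebra_simps)
    moreover have "((\<lambda>t. 1 / t) has_real_derivative - ((1/t)^2)) (at t)"
      using True by (auto intro!: derivative_eq_intros simp: power2_eq_square)
    ultimately have "((\<lambda>t. (1/t) ^ k * exp (- (1/t))) has_real_derivative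
        (real k * (1/t) ^ (k - 1) - (1/t) ^ k) * exp (- (1/t)) * (- ((1/t)^2))) (at t)"
      by (rule DERIV_chain2)
    also have "(real k * (1/t) ^ (k - 1) - (1/t) ^ k) * exp (- (1/t)) * (- ((1/t)^2)) =
        expdec (k + 2) t - real k * expdec (k + 1) t"
      using True by (cases k)
        (simp_all add: expdec_def algebra_simps power_add power2_eq_square add_divide_distrib)
    finally show ?thesis .
  qed
  then show ?thesis
    by (rule has_field_derivative_transform_within_open[of _ _ _ "{0<..}"])
       (use True in \<open>auto simp: expdec_def\<close>)
next
  case False
  show ?thesis
  proof (cases "t < 0")
    case True
    have "((\<lambda>t. 0) has_real_derivative 0) (at t)" by simp
    then have "(expdec k has_real_derivative 0) (at t)"
      by (rule has_field_derivative_transform_within_open[of _ _ _ "{..<0}"])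
         (use True in \<open>auto simp: expdec_def\<close>)
    then show ?thesis using True by (simp add: expdec_def)
  next
    case False
    with \<open>\<not> t > 0\<close> have t: "t = 0" by simp
    \<comment> \<open>To the right of 0 the difference quotient is \<open>expdec (Suc k)\<close>; to
      the left it vanishes.\<close>
    have right: "((\<lambda>h. expdec k h / h) \<longlongrightarrow> 0) (at_right 0)"
      by (rule Lim_transform_eventually[OF expdec_tendsto_0[of "Suc k"]])
         (auto simp: expdec_def eventually_at_right_field intro: exI[of _ 1])
    have left: "((\<lambda>h. expdec k h / h) \<longlongrightarrow> 0) (at_left 0)"
      by (rule Lim_transform_eventually[OF tendsto_const])
         (auto simp: expdec_def eventually_at_left_field intro: exI[of _ "-1"])
    have "((\<lambda>h. expdec k h / h) \<longlongrightarrow> 0) (at 0)"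
      using left right by (simp add: filterlim_split_at)
    then show ?thesis
      by (simp add: t has_field_derivative_iff expdec_def)
  qed
qed

lemma expdec_0: "expdec 0 t = (if t > 0 then exp (- (1/t)) else 0)"
  by (simp add: expdec_def)

text \<open>\<open>smooth_fun\<close> asks for all iterated partial derivatives. A class closed
  under \<open>partial_dir\<close> reduces this to an induction on the list of directions.
  Coordinates occur only inside \<open>expdec\<close>, which keeps every member bounded although no
  support condition is imposed.\<close>

inductive smooth_gen :: "(real^'n \<Rightarrow> real) \<Rightarrow> bool" where
  const: "smooth_gen (\<lambda>x. c)"
| coord: "smooth_gen (\<lambda>x. expdec k (c * x $ i + d))"
| add: "smooth_gen \<phi> \<Longrightarrow> smooth_gen \<psi> \<Longrightarrow> smooth_gen (\<lambda>x. \<phi> x + \<psi> x)"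
| mult: "smooth_gen \<phi> \<Longrightarrow> smooth_gen \<psi> \<Longrightarrow> smooth_gen (\<lambda>x. \<phi> x * \<psi> x)"

lemma smooth_gen_prod:
  "finite I \<Longrightarrow> (\<And>i. i \<in> I \<Longrightarrow> smooth_gen (\<phi> i)) \<Longrightarrow> smooth_gen (\<lambda>x. \<Prod>i\<in>I. \<phi> i x)"
  by (induction I rule: finite_induct) (auto intro: smooth_gen.intros)

lemma smooth_gen_translate:
  "smooth_gen \<phi> \<Longrightarrow> smooth_gen (\<lambda>x. \<phi> (x - v))"
proof (induction rule: smooth_gen.induct)
  case (coord k c i d)
  have "smooth_gen (\<lambda>x. expdec k (c * x $ i + (d - c * v $ i)))"
    by (rule smooth_gen.coord)
  then show ?case by (simp add: algebra_simps)
qed (auto intro: smooth_gen.intros)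

text \<open>Total differentiability is recorded together with the partial derivatives because the
  chain rule is later applied along lines in arbitrary directions.\<close>

lemma smooth_gen_derivative:
  assumes "smooth_gen \<phi>"
  shows "\<exists>\<psi>. (\<forall>i. smooth_gen (\<psi> i)) \<and>
    (\<forall>x. (\<phi> has_derivative (\<lambda>h. \<Sum>i\<in>UNIV. h $ i * \<psi> i x)) (at x))"
  using assms
proof (induction rule: smooth_gen.induct)
  case (const c)
  show ?case
    by (rule exI[of _ "\<lambda>i x. 0"]) (auto intro: smooth_gen.intros)
next
  case (coord k c i d)
  let ?D = "\<lambda>x::real^'a. c * expdec (k + 2) (c * x $ i + d) +
      (- c * real k) * expdec (k + 1) (c * x $ i + d)"
  have "smooth_gen ?D"
    by (intro smooth_gen.intros)
  moreover have "((\<lambda>x. expdec k (c * x $ i + d)) has_derivative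
      (\<lambda>h. \<Sum>j\<in>UNIV. h $ j * (if j = i then ?D x else 0))) (at x)" for x
  proof -
    have "((\<lambda>x::real^'a. c * x $ i + d) has_derivative (\<lambda>h. c * h $ i)) (at x)"
      by (auto intro!: derivative_eq_intros bounded_linear.has_derivative[OF bounded_linear_vec_nth])
    from has_derivative_compose[OF this
        expdec_has_derivative[of k, unfolded has_field_derivative_def]]
    show ?thesis
      by (simp add: algebra_simps sum.delta if_distrib cong: if_cong)
  qed
  moreover have "smooth_gen (\<lambda>x. if j = i then ?D x else 0)" for j
    using \<open>smooth_gen ?D\<close> by (cases "j = i") (simp_all only: refl if_True if_False smooth_gen.const)
  ultimately show ?case
    by (intro exI[of _ "\<lambda>j x. if j = i then ?D x else 0"]) blast
next
  case (add \<phi>1 \<phi>2)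
  then obtain \<psi>1 \<psi>2 where
    "\<forall>i. smooth_gen (\<psi>1 i)" "\<forall>x. (\<phi>1 has_derivative (\<lambda>h. \<Sum>i\<in>UNIV. h $ i * \<psi>1 i x)) (at x)"
    "\<forall>i. smooth_gen (\<psi>2 i)" "\<forall>x. (\<phi>2 has_derivative (\<lambda>h. \<Sum>i\<in>UNIV. h $ i * \<psi>2 i x)) (at x)"
    by blast
  then show ?case
    by (intro exI[of _ "\<lambda>i x. \<psi>1 i x + \<psi>2 i x"])
       (auto intro!: smooth_gen.add derivative_eq_intros simp: algebra_simps sum.distrib)
next
  case (mult \<phi>1 \<phi>2)
  then obtain \<psi>1 \<psi>2 where *:
    "\<forall>i. smooth_gen (\<psi>1 i)" "\<forall>x. (\<phi>1 has_derivative (\<lambda>h. \<Sum>i\<in>UNIV. h $ i * \<psi>1 i x)) (at x)"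
    "\<forall>i. smooth_gen (\<psi>2 i)" "\<forall>x. (\<phi>2 has_derivative (\<lambda>h. \<Sum>i\<in>UNIV. h $ i * \<psi>2 i x)) (at x)"
    by blast
  then show ?case
    by (intro exI[of _ "\<lambda>i x. \<phi>1 x * \<psi>2 i x + \<psi>1 i x * \<phi>2 x"])
       (auto intro!: smooth_gen.intros mult derivative_eq_intros
          simp: algebra_simps sum.distrib sum_distrib_left)
qed

lemma has_derivative_imp_partial_dir:
  fixes f :: "real^'n \<Rightarrow> 'b::real_normed_vector"
  assumes "(f has_derivative f') (at x)"
  shows "((\<lambda>t. f (x + t *\<^sub>R axis i 1)) has_vector_derivative f' (axis i 1)) (at 0)"
    and "partial_dir f i x = f' (axis i 1)"
proof -
  have 1: "((\<lambda>t::real. x + t *\<^sub>R axis i 1) has_derivative (\<lambda>t. t *\<^sub>R axis i 1)) (at 0)"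
    by (auto intro!: derivative_eq_intros)
  have 2: "(f has_derivative f') (at (x + 0 *\<^sub>R axis i 1))"
    using assms by simp
  interpret f': bounded_linear f'
    using assms by (rule has_derivative_bounded_linear)
  show 3: "((\<lambda>t. f (x + t *\<^sub>R axis i 1)) has_vector_derivative f' (axis i 1)) (at 0)"
    using has_derivative_compose[OF 1 2] by (simp add: has_vector_derivative_def f'.scaleR)
  show "partial_dir f i x = f' (axis i 1)"
    unfolding partial_dir_def by (rule vector_derivative_at[OF 3])
qed

lemma has_derivative_imp_has_all_partials:
  fixes f :: "real^'n \<Rightarrow> 'b::real_normed_vector"
  assumes "(f has_derivative f') (at x)"
  shows "has_all_partials f x"
  unfolding has_all_partials_def
  using has_derivative_imp_partial_dir(1)[OF assms] by (blast intro: differentiableI_vector)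

lemma sum_axis_mult: "(\<Sum>j\<in>UNIV. axis i 1 $ j * \<psi> j) = (\<psi> i :: real)" for i :: "'n::finite"
  by (simp add: axis_def if_distrib[of "\<lambda>c. c * _"] cong: if_cong)

lemma smooth_gen_partial:
  assumes "smooth_gen \<phi>"
  shows "smooth_gen (partial_dir \<phi> i)"
    and "has_all_partials \<phi> x"
    and "(\<phi> has_derivative (\<lambda>h. \<Sum>i\<in>UNIV. h $ i * partial_dir \<phi> i x)) (at x)"
proof -
  obtain \<psi> where \<psi>: "\<And>i. smooth_gen (\<psi> i)"
    and d: "\<And>x. (\<phi> has_derivative (\<lambda>h. \<Sum>i\<in>UNIV. h $ i * \<psi> i x)) (at x)"
    using smooth_gen_derivative[OF assms] by blast
  have eq: "partial_dir \<phi> i = \<psi> i" for i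
    by (rule ext) (simp add: has_derivative_imp_partial_dir(2)[OF d] sum_axis_mult)
  show "smooth_gen (partial_dir \<phi> i)" by (simp add: eq \<psi>)
  show "has_all_partials \<phi> x" by (rule has_derivative_imp_has_all_partials[OF d])
  show "(\<phi> has_derivative (\<lambda>h. \<Sum>i\<in>UNIV. h $ i * partial_dir \<phi> i x)) (at x)"
    using d by (simp add: eq)
qed

lemma smooth_gen_continuous: "smooth_gen \<phi> \<Longrightarrow> continuous_on S \<phi>"
  by (meson smooth_gen_partial(3) has_derivative_continuous continuous_at_imp_continuous_on)

lemma smooth_gen_imp_smooth_fun:
  assumes "smooth_gen \<phi>"
  shows "smooth_fun \<phi>"
proof -
  have "smooth_gen (foldr (\<lambda>i g. partial_dir g i) is \<phi>)" for "is"
    by (induction "is") (auto simp: assms smooth_gen_partial(1))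
  then show ?thesis
    unfolding smooth_fun_def by (auto simp: smooth_gen_continuous smooth_gen_partial(2))
qed

text \<open>Each factor is \<open>exp (- (1/t))\<close> taken at a multiple of the distance to a
  face. The growing multiple \<open>Suc m\<close> drives it to 1 inside, so the bumps approximate
  the indicator of the open box while their supports stay in one \<open>cbox a b\<close>.\<close>

definition bump :: "real^'n \<Rightarrow> real^'n \<Rightarrow> nat \<Rightarrow> real^'n \<Rightarrow> real" where
  "bump a b m x = (\<Prod>i\<in>UNIV. expdec 0 (real (Suc m) * (x $ i - a $ i)) * expdec 0 (real (Suc m) * (b $ i - x $ i)))"

lemma smooth_gen_bump: "smooth_gen (bump a b m)"
proof -
  have "smooth_gen (\<lambda>x::real^'a. \<Prod>i\<in>UNIV. expdec 0 (real (Suc m) * x $ i + - (real (Suc m) * a $ i)) *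
      expdec 0 (- real (Suc m) * x $ i + real (Suc m) * b $ i))"
    by (intro smooth_gen_prod smooth_gen.mult smooth_gen.coord) auto
  then show ?thesis
    by (simp add: bump_def[abs_def] algebra_simps)
qed

lemma expdec_0_bounds: "0 \<le> expdec 0 t" "expdec 0 t \<le> 1"
  by (auto simp: expdec_0)

lemma bump_bounds: "0 \<le> bump a b m x" "bump a b m x \<le> 1"
  unfolding bump_def
  by (auto intro!: prod_nonneg prod_le_1 mult_nonneg_nonneg mult_le_one simp: expdec_0_bounds)

lemma bump_outside: "x \<notin> box a b \<Longrightarrow> bump a b m x = 0"
  by (auto simp: bump_def mem_box_cart expdec_0 prod_zero_iff zero_less_mult_iff)

lemma bump_tendsto_indicator: "(\<lambda>m. bump a b m x) \<longlonglongrightarrow> indicator (box a b) x"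
proof (cases "x \<in> box a b")
  case True
  have lim: "(\<lambda>m. expdec 0 (real (Suc m) * c)) \<longlonglongrightarrow> 1" if "c > 0" for c :: real
  proof -
    have "(\<lambda>m. exp (- ((1/c) * inverse (real (Suc m))))) \<longlonglongrightarrow> exp (- ((1/c) * 0))"
      by (intro tendsto_intros LIMSEQ_inverse_real_of_nat)
    then show ?thesis using that
      by (simp add: expdec_0 field_simps del: of_nat_Suc)
  qed
  have "(\<lambda>m. bump a b m x) \<longlonglongrightarrow> (\<Prod>i\<in>(UNIV::'a set). 1 * 1)"
    unfolding bump_def
    using True by (intro tendsto_prod tendsto_mult lim) (auto simp: mem_box_cart)
  then show ?thesis using True by simp
next
  case False
  then show ?thesis by (simp add: bump_outside)
qed

lemma test_fun_smooth_gen: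
  assumes "smooth_gen \<phi>" "compact K" "K \<subseteq> U" "\<And>x. x \<notin> K \<Longrightarrow> \<phi> x = 0"
  shows "test_fun U \<phi>"
  using assms smooth_gen_imp_smooth_fun unfolding test_fun_def by blast

lemma test_fun_bump: "cbox a b \<subseteq> U \<Longrightarrow> test_fun U (bump a b m)"
  by (rule test_fun_smooth_gen[OF smooth_gen_bump compact_cbox])
     (use box_subset_cbox bump_outside in blast)+

section \<open>Locally null sets and functions with vanishing averages\<close>

lemma AE_lebesgue_iff_negligible: "(AE x in lebesgue. Q x) \<longleftrightarrow> negligible {x. \<not> Q x}"
  by (simp add: completion.AE_iff_null_sets negligible_iff_null_sets)

text \<open>By second countability a locally null set is null. This reduces claims about
  \<open>D\<close> to small boxes or balls, on which the data are integrable.\<close>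

lemma AE_lebesgue_local:
  fixes D :: "'a::euclidean_space set"
  assumes "\<And>a. a \<in> D \<Longrightarrow> \<exists>V. open V \<and> a \<in> V \<and> (AE x in lebesgue. x \<in> V \<longrightarrow> Q x)"
  shows "AE x in lebesgue. x \<in> D \<longrightarrow> Q x"
proof -
  let ?S = "{x \<in> D. \<not> Q x}"
  have "negligible ?S"
    unfolding locally_negligible_alt[of ?S]
  proof
    fix a assume "a \<in> ?S"
    then obtain V where V: "open V" "a \<in> V" "AE x in lebesgue. x \<in> V \<longrightarrow> Q x"
      using assms by blast
    then have "negligible {x \<in> V. \<not> Q x}"
      by (simp add: AE_lebesgue_iff_negligible)
    then have "negligible (?S \<inter> V)"
      by (rule negligible_subset) auto
    with V \<open>a \<in> ?S\<close> show "\<exists>U. openin (top_of_set ?S) U \<and> a \<in> U \<and> negligible U"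
      by (intro exI[of _ "?S \<inter> V"]) auto
  qed
  then show ?thesis
    by (simp add: AE_lebesgue_iff_negligible)
qed

text \<open>Lebesgue differentiation: at almost every point the value is the limit of averages over
  small cubes having the point as a corner, and all these averages vanish.\<close>

lemma AE_zero_of_zero_box_integrals:
  fixes u :: "'a::euclidean_space \<Rightarrow> 'b::euclidean_space"
  assumes "open U"
    and int: "\<And>a b. cbox a b \<subseteq> U \<Longrightarrow> u absolutely_integrable_on cbox a b"
    and zero: "\<And>a b. cbox a b \<subseteq> U \<Longrightarrow> integral (cbox a b) u = 0"
  shows "AE x in lebesgue. x \<in> U \<longrightarrow> u x = 0"
proof (rule AE_lebesgue_local)
  fix p assume "p \<in> U"
  then obtain a b where ab: "p \<in> box a b" "cbox a b \<subseteq> U"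
    using \<open>open U\<close> by (metis open_contains_cbox)
  \<comment> \<open>The differentiation theorem asks for integrability on every box of the space, so
    \<open>u\<close> is cut off outside one box in \<open>U\<close>.\<close>
  define v where "v = (\<lambda>x. if x \<in> cbox a b then u x else 0)"
  have "v absolutely_integrable_on UNIV"
    using int[OF ab(2)] by (simp add: v_def absolutely_integrable_restrict_UNIV)
  then have "v integrable_on cbox c d" for c d
    by (meson absolutely_integrable_on_subcbox set_lebesgue_integral_eq_integral(1) subset_UNIV)
  then obtain N where N: "negligible N"
    and lim: "\<And>x e. x \<notin> N \<Longrightarrow> 0 < e \<Longrightarrow> \<exists>d>0. \<forall>h. 0 < h \<and> h < d \<longrightarrow>
      norm (integral (cbox x (x + h *\<^sub>R One)) v /\<^sub>R h ^ DIM('a) - v x) < e"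
    by (rule integrable_ccontinuous_explicit[of v]) (rule that, auto)
  have "u x = 0" if x: "x \<in> box a b" "x \<notin> N" for x
  proof (rule ccontr)
    assume "u x \<noteq> 0"
    then have "norm (v x) > 0"
      using x box_subset_cbox[of a b] by (auto simp: v_def)
    from lim[OF x(2) this] obtain d where d: "d > 0"
      "\<And>h. 0 < h \<Longrightarrow> h < d \<Longrightarrow>
        norm (integral (cbox x (x + h *\<^sub>R One)) v /\<^sub>R h ^ DIM('a) - v x) < norm (v x)"
      by blast
    obtain e where e: "e > 0" "ball x e \<subseteq> box a b"
      using open_contains_ball[of "box a b"] x(1) by auto
    \<comment> \<open>The points of a cube of side \<open>h\<close> are within
      \<open>h * DIM('a)\<close> of its corner, so this side keeps the cube inside the ball of
      radius \<open>e\<close>.\<close>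
    define h where "h = min (d/2) (e / (2 * DIM('a)))"
    have h: "0 < h" "h < d" "h * DIM('a) < e"
      using d e by (auto simp: h_def min_def field_simps split: if_splits)
    have "cbox x (x + h *\<^sub>R One) \<subseteq> ball x e"
    proof
      fix y assume y: "y \<in> cbox x (x + h *\<^sub>R One)"
      have "norm (y - x) \<le> (\<Sum>i\<in>Basis. \<bar>(y - x) \<bullet> i\<bar>)"
        by (rule norm_le_l1)
      also have "\<dots> \<le> (\<Sum>i\<in>(Basis::'a set). h)"
        using y by (intro sum_mono) (auto simp: mem_box inner_simps algebra_simps)
      also have "\<dots> < e" using h by (simp add: mult.commute)
      finally show "y \<in> ball x e" by (simp add: dist_norm norm_minus_commute)
    qed
    with e have sub: "cbox x (x + h *\<^sub>R One) \<subseteq> cbox a b"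
      using box_subset_cbox by blast
    then have "integral (cbox x (x + h *\<^sub>R One)) v = integral (cbox x (x + h *\<^sub>R One)) u"
      by (intro integral_cong) (auto simp: v_def)
    also have "\<dots> = 0"
      using sub ab(2) by (intro zero) auto
    finally show False
      using d(2)[OF h(1,2)] by simp
  qed
  then have "negligible {x \<in> box a b. u x \<noteq> 0}"
    by (intro negligible_subset[OF N]) auto
  then show "\<exists>V. open V \<and> p \<in> V \<and> (AE x in lebesgue. x \<in> V \<longrightarrow> u x = 0)"
    using ab(1) by (intro exI[of _ "box a b"]) (auto simp: AE_lebesgue_iff_negligible)
qed

lemma absolutely_integrable_on_bounded_scaleR:
  fixes u :: "'a::euclidean_space \<Rightarrow> 'b::euclidean_space"
  assumes "u absolutely_integrable_on S" "S \<in> sets lebesgue"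
    "\<phi> \<in> borel_measurable (lebesgue_on S)" "bounded (\<phi> ` S)"
  shows "(\<lambda>x. \<phi> x *\<^sub>R u x) absolutely_integrable_on S"
  by (rule absolutely_integrable_bounded_measurable_product[of scaleR, OF _ assms(3,2,4,1)])
     (auto simp: bilinear_def linear_iff algebra_simps)

text \<open>Dominated convergence. The limit sees only the open box, whose boundary is a null
  set.\<close>

lemma bump_integral_tendsto:
  fixes u :: "real^'n \<Rightarrow> 'b::euclidean_space"
  assumes "u absolutely_integrable_on cbox a b"
  shows "(\<lambda>m. integral (cbox a b) (\<lambda>x. bump a b m x *\<^sub>R u x)) \<longlonglongrightarrow> integral (cbox a b) u"
proof -
  have bnd: "\<bar>bump a b m x\<bar> \<le> 1" for m x
    using bump_bounds[of a b m x] by simp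
  have "(\<lambda>x. bump a b m x *\<^sub>R u x) absolutely_integrable_on cbox a b" for m
    by (rule absolutely_integrable_on_bounded_scaleR[OF assms])
       (auto intro!: continuous_imp_measurable_on_sets_lebesgue smooth_gen_continuous smooth_gen_bump
         boundedI[where B=1] bnd)
  then have "(\<lambda>x. bump a b m x *\<^sub>R u x) integrable_on cbox a b" for m
    by (rule set_lebesgue_integral_eq_integral(1))
  moreover have "(\<lambda>x. norm (u x)) integrable_on cbox a b"
    using assms by (simp add: absolutely_integrable_on_def)
  moreover have "norm (bump a b m x *\<^sub>R u x) \<le> norm (u x)" for m x
    using bnd by (simp add: mult_left_le_one_le)
  moreover have "(\<lambda>m. bump a b m x *\<^sub>R u x) \<longlonglongrightarrow> indicator (box a b) x *\<^sub>R u x" for x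
    by (intro tendsto_scaleR bump_tendsto_indicator tendsto_const)
  ultimately have "(\<lambda>m. integral (cbox a b) (\<lambda>x. bump a b m x *\<^sub>R u x)) \<longlonglongrightarrow>
      integral (cbox a b) (\<lambda>x. indicator (box a b) x *\<^sub>R u x)"
    by (rule dominated_convergence(2))
  also have "integral (cbox a b) (\<lambda>x. indicator (box a b) x *\<^sub>R u x) = integral (cbox a b) u"
    by (rule integral_spike[OF negligible_frontier_interval[of a b]]) (auto simp: frontier_def)
  finally show ?thesis .
qed

text \<open>The fundamental lemma of the calculus of variations, tested on bumps only: they tend to
  indicators of boxes, so all box integrals vanish.\<close>

lemma AE_zero_of_zero_bump_integrals:
  fixes u :: "real^'n \<Rightarrow> 'b::euclidean_space"
  assumes "open U"
    and int: "\<And>a b. cbox a b \<subseteq> U \<Longrightarrow> u absolutely_integrable_on cbox a b"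
    and zero: "\<And>a b m. cbox a b \<subseteq> U \<Longrightarrow> integral (cbox a b) (\<lambda>x. bump a b m x *\<^sub>R u x) = 0"
  shows "AE x in lebesgue. x \<in> U \<longrightarrow> u x = 0"
proof (rule AE_zero_of_zero_box_integrals[OF \<open>open U\<close> int])
  fix a b assume ab: "cbox a b \<subseteq> U"
  show "integral (cbox a b) u = 0"
    using bump_integral_tendsto[OF int[OF ab]] by (simp add: zero[OF ab] LIMSEQ_const_iff)
qed

section \<open>Translations and weak derivatives\<close>

lemma power_exp_minus_le_fact: "0 \<le> u \<Longrightarrow> u ^ k * exp (- u) \<le> fact k" for u :: real
proof -
  assume "0 \<le> u"
  have "u ^ k / fact k \<le> exp u"
    unfolding exp_def
    using \<open>0 \<le> u\<close> sum_le_suminf[OF summable_exp_generic[of u], of "{k}"]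
    by (simp add: divide_inverse mult.commute)
  then show ?thesis
    by (simp add: exp_minus field_simps)
qed

text \<open>With \<open>u = 1/t\<close> a generator is \<open>u ^ k * exp (- u)\<close>, hence
  bounded by \<open>fact k\<close>. Global bounds make products with integrable functions integrable
  without any look at supports.\<close>

lemma smooth_gen_bounded: "smooth_gen \<phi> \<Longrightarrow> \<exists>B. \<forall>x. \<bar>\<phi> x\<bar> \<le> B"
proof (induction rule: smooth_gen.induct)
  case (coord k c i d)
  show ?case
    using power_exp_minus_le_fact[of "1 / (c * _ + d)" k]
    by (intro exI[of _ "fact k"]) (auto simp: expdec_def)
next
  case (add \<phi> \<psi>)
  then obtain A B where "\<forall>x. \<bar>\<phi> x\<bar> \<le> A" "\<forall>x. \<bar>\<psi> x\<bar> \<le> B" by blast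
  then show ?case
    by (intro exI[of _ "A + B"]) (meson abs_triangle_ineq add_mono order_trans)
next
  case (mult \<phi> \<psi>)
  then obtain A B where "\<forall>x. \<bar>\<phi> x\<bar> \<le> A" "\<forall>x. \<bar>\<psi> x\<bar> \<le> B" by blast
  then show ?case
    by (intro exI[of _ "A * B"]) (auto simp: abs_mult intro!: mult_mono')
qed auto

lemma smooth_gen_borel: "smooth_gen \<phi> \<Longrightarrow> \<phi> \<in> borel_measurable borel"
  by (intro borel_measurable_continuous_onI smooth_gen_continuous)

lemma norm_matrix_vector_mult_le: "norm (A *v x) \<le> norm A * norm x" for A :: "real^'n^'m"
proof -
  have "norm (A *v x) = L2_set (\<lambda>i. A $ i \<bullet> x) UNIV"
    unfolding norm_vec_def
    by (simp add: matrix_vector_mult_def inner_vec_def L2_set_def)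
  also have "\<dots> \<le> L2_set (\<lambda>i. norm (A $ i) * norm x) UNIV"
    unfolding L2_set_def
    by (intro real_sqrt_le_mono sum_mono) (metis Cauchy_Schwarz_ineq2 abs_le_square_iff abs_mult abs_norm_cancel)
  also have "\<dots> = norm A * norm x"
    by (simp add: norm_vec_def[of A] L2_set_left_distrib)
  finally show ?thesis .
qed

lemma bounded_linear_matrix_mult_left: "bounded_linear (\<lambda>A::real^'n^'m. A *v x)"
  by (rule bounded_linear_intro[where K="norm x"])
     (auto simp: matrix_vector_mult_add_rdistrib scaleR_matrix_vector_assoc norm_matrix_vector_mult_le)

lemma matrix_mult_sum_scaleR: "A *v x = (\<Sum>i\<in>UNIV. x $ i *\<^sub>R column i A)" for A :: "real^'n^'m"
  by (simp add: matrix_mult_sum scalar_mult_eq_scaleR)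

lemma integrable_lborel_translate:
  fixes f :: "'a::euclidean_space \<Rightarrow> 'b::{banach,second_countable_topology}"
  shows "integrable lborel (\<lambda>x. f (x + c)) \<longleftrightarrow> integrable lborel f"
proof -
  have *: "integrable lborel f \<Longrightarrow> integrable lborel (\<lambda>x. f (x + c))"
    for f :: "'a \<Rightarrow> 'b" and c
    using integrable_distr[of "(+) c" lborel borel f]
    by (simp add: lborel_distr_plus add.commute cong: measurable_cong_sets)
  show ?thesis
    using *[of f c] *[of "\<lambda>x. f (x + c)" "- c"] by auto
qed

lemma integral_lborel_translate:
  fixes f :: "'a::euclidean_space \<Rightarrow> 'b::{banach,second_countable_topology}"
  shows "(LINT x|lborel. f (x + c)) = (LINT x|lborel. f x)"
proof (cases "integrable lborel f")
  case True
  then have "f \<in> borel_measurable borel" by auto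
  from integral_distr[of "(+) c" lborel borel f] this show ?thesis
    by (simp add: lborel_distr_plus add.commute)
next
  case False
  then show ?thesis
    by (simp add: not_integrable_integral_eq integrable_lborel_translate)
qed

lemma partial_dir_translate: "partial_dir (\<lambda>x. \<phi> (x - c)) i x = partial_dir \<phi> i (x - c)"
  by (simp add: partial_dir_def algebra_simps)

text \<open>The difference is written as an integral over \<open>s\<close> so that Fubini can
  exchange it with the integral over space.\<close>

lemma smooth_gen_translate_integral:
  assumes "smooth_gen \<phi>"
  shows "\<phi> (x - v) - \<phi> x =
    (LINT s|lborel. indicator {0..1} s *\<^sub>R - (\<Sum>i\<in>UNIV. v $ i * partial_dir \<phi> i (x - s *\<^sub>R v)))"
proof -
  let ?d = "\<lambda>s. - (\<Sum>i\<in>UNIV. v $ i * partial_dir \<phi> i (x - s *\<^sub>R v))"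
  have "((\<lambda>s. \<phi> (x - s *\<^sub>R v)) has_real_derivative ?d s) (at s)" for s
  proof -
    have "((\<lambda>s. x - s *\<^sub>R v) has_derivative (\<lambda>h. - (h *\<^sub>R v))) (at s)"
      by (auto intro!: derivative_eq_intros)
    from has_derivative_compose[OF this smooth_gen_partial(3)[OF assms]]
    have "((\<lambda>s. \<phi> (x - s *\<^sub>R v)) has_derivative
      (\<lambda>h. \<Sum>i\<in>UNIV. (- (h *\<^sub>R v)) $ i * partial_dir \<phi> i (x - s *\<^sub>R v))) (at s)" .
    also have "(\<lambda>h. \<Sum>i\<in>UNIV. (- (h *\<^sub>R v)) $ i * partial_dir \<phi> i (x - s *\<^sub>R v)) = (*) (?d s)"
      by (rule ext) (simp add: sum_negf sum_distrib_left mult_ac)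
    finally show ?thesis
      by (simp only: has_field_derivative_def)
  qed
  then have vd: "((\<lambda>s. \<phi> (x - s *\<^sub>R v)) has_vector_derivative ?d s) (at s within {0..1})" for s
    by (simp add: has_real_derivative_iff_has_vector_derivative has_vector_derivative_at_within)
  have "continuous_on {0..1} (\<lambda>s. partial_dir \<phi> i (x - s *\<^sub>R v))" for i
    by (rule continuous_on_compose2[OF smooth_gen_continuous[OF smooth_gen_partial(1)[OF assms], of UNIV]])
       (auto intro!: continuous_intros)
  then have cont: "continuous_on {0..1} ?d"
    by (intro continuous_intros)
  from integral_FTC_atLeastAtMost[OF _ vd cont] show ?thesis
    by simp
qed

lemma integrable_scaleR_bounded:
  fixes f :: "'a \<Rightarrow> 'b::{banach,second_countable_topology}"
  assumes "integrable M f" "\<phi> \<in> borel_measurable M" "\<And>x. \<bar>\<phi> x\<bar> \<le> (B::real)"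
  shows "integrable M (\<lambda>x. \<phi> x *\<^sub>R f x)"
proof (rule Bochner_Integration.integrable_bound)
  show "integrable M (\<lambda>x. B * norm (f x))" using assms by simp
  show "AE x in M. norm (\<phi> x *\<^sub>R f x) \<le> norm (B * norm (f x))"
    using assms(3) by (auto simp: abs_mult intro!: mult_right_mono order_trans[OF assms(3)] abs_ge_self)
qed (use assms in measurable)

lemma integrable_lborel_imp_absolutely_integrable_on:
  fixes f :: "'a::euclidean_space \<Rightarrow> 'b::euclidean_space"
  assumes "integrable lborel f" "S \<in> sets lebesgue"
  shows "f absolutely_integrable_on S"
proof -
  have "integrable lebesgue f"
    using assms(1) by (simp add: integrable_completion)
  then have "f absolutely_integrable_on UNIV"
    by (simp add: set_integrable_def)
  then show ?thesis
    by (rule set_integrable_subset) (use assms in auto)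
qed

text \<open>Testing against \<open>\<phi>\<close> moves the translation from \<open>f\<close> to
  \<open>\<phi>\<close>. The difference of the two translates of \<open>\<phi>\<close> is an
  integral over \<open>s\<close> of directional derivatives of shifted copies of
  \<open>\<phi>\<close>; for each \<open>s\<close> the weak equation applies, because the shifted
  support stays in \<open>U\<close>. Shifting back gives the right-hand side, and the fundamental
  lemma removes \<open>\<phi>\<close>. The exceptional null set depends on \<open>v\<close>.\<close>

lemma weak_gradient_translation:
  fixes f :: "real^'n \<Rightarrow> real^'m" and G :: "real^'n \<Rightarrow> real^'n^'m"
  assumes f: "integrable lborel f" and G: "integrable lborel G"
    and weak: "\<And>\<phi> i K. smooth_gen \<phi> \<Longrightarrow> compact K \<Longrightarrow> K \<subseteq> U \<Longrightarrow> (\<And>x. x \<notin> K \<Longrightarrow> \<phi> x = 0) \<Longrightarrow>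
       (LINT x|lborel. partial_dir \<phi> i x *\<^sub>R f x) = - (LINT x|lborel. \<phi> x *\<^sub>R column i (G x))"
    and V: "open V" "\<And>x s. x \<in> V \<Longrightarrow> 0 \<le> s \<Longrightarrow> s \<le> 1 \<Longrightarrow> x + s *\<^sub>R v \<in> U"
  shows "AE x in lborel. x \<in> V \<longrightarrow>
    integrable lborel (\<lambda>s. indicator {0..1} s *\<^sub>R G (x + s *\<^sub>R v)) \<and>
    f (x + v) - f x = (LINT s|lborel. indicator {0..1} s *\<^sub>R G (x + s *\<^sub>R v)) *v v"
proof -
  note [measurable] = borel_measurable_integrable[OF f] borel_measurable_integrable[OF G]
  let ?ind = "indicator {0..1::real} :: real \<Rightarrow> real"
  have nG: "(LINT x|lborel. norm (G (x + c))) = (LINT x|lborel. norm (G x))" for c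
    by (rule integral_lborel_translate[of "\<lambda>x. norm (G x)"])
  \<comment> \<open>The \<open>L^1\<close> norm of a translate does not depend on \<open>s\<close>,
    so joint integrability follows from that of \<open>G\<close>.\<close>
  have int2: "integrable (lborel \<Otimes>\<^sub>M lborel) (\<lambda>(s, x). ?ind s *\<^sub>R G (x + s *\<^sub>R v))"
  proof (rule lborel_pair.Fubini_integrable)
    show "integrable lborel (\<lambda>s. LINT x|lborel. norm (case (s, x) of (s, x) \<Rightarrow> ?ind s *\<^sub>R G (x + s *\<^sub>R v)))"
      by (simp add: nG)
    show "AE s in lborel. integrable lborel (\<lambda>x. case (s, x) of (s, x) \<Rightarrow> ?ind s *\<^sub>R G (x + s *\<^sub>R v))"
      using G by (simp add: integrable_lborel_translate)
  qed measurable
  define I where "I x = (LINT s|lborel. ?ind s *\<^sub>R G (x + s *\<^sub>R v))" for x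
  have I: "integrable lborel I"
    unfolding I_def using lborel_pair.integrable_snd[OF int2] by simp
  have AEint: "AE x in lborel. integrable lborel (\<lambda>s. ?ind s *\<^sub>R G (x + s *\<^sub>R v))"
    using lborel_pair.AE_integrable_snd[OF int2] by simp
  \<comment> \<open>The defect of the claimed identity. It is integrable, so it can be tested
    against smooth functions.\<close>
  define w where "w x = f (x + v) - f x - I x *v v" for x
  have Iv: "integrable lborel (\<lambda>x. I x *v v)"
    by (rule integrable_bounded_linear[OF bounded_linear_matrix_mult_left I])
  have fv: "integrable lborel (\<lambda>x. f (x + v))"
    using f by (simp add: integrable_lborel_translate)
  have w: "integrable lborel w"
    unfolding w_def[abs_def] using f fv Iv by auto
  have zero: "(LINT x|lborel. \<phi> x *\<^sub>R w x) = 0"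
    if \<phi>: "smooth_gen \<phi>" and K: "compact K" "K \<subseteq> V" "\<And>x. x \<notin> K \<Longrightarrow> \<phi> x = 0" for \<phi> K
  proof -
    obtain B where B: "\<And>x. \<bar>\<phi> x\<bar> \<le> B" using smooth_gen_bounded[OF \<phi>] by blast
    note [measurable] = smooth_gen_borel[OF \<phi>] smooth_gen_borel[OF smooth_gen_partial(1)[OF \<phi>]]
    define d where "d s x = - (\<Sum>i\<in>UNIV. v $ i * partial_dir \<phi> i (x - s *\<^sub>R v))" for s x
    have [measurable]: "(\<lambda>p. d (fst p) (snd p)) \<in> borel_measurable (lborel \<Otimes>\<^sub>M lborel)"
      unfolding d_def by measurable
    have [measurable]: "(\<lambda>x. d s x) \<in> borel_measurable borel" for s
      unfolding d_def by measurable
    have "\<forall>i. \<exists>C. \<forall>x. \<bar>partial_dir \<phi> i x\<bar> \<le> C"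
      using smooth_gen_bounded[OF smooth_gen_partial(1)[OF \<phi>]] by blast
    then obtain C where C: "\<And>i x. \<bar>partial_dir \<phi> i x\<bar> \<le> C i" by metis
    have dC: "\<bar>d s x\<bar> \<le> (\<Sum>i\<in>UNIV. \<bar>v $ i\<bar> * C i)" for s x
      unfolding d_def abs_minus_cancel
      by (rule order_trans[OF sum_abs]) (auto intro!: sum_mono mult_left_mono C simp: abs_mult)
    have d_int: "integrable (lborel \<Otimes>\<^sub>M lborel) (\<lambda>(s, x). (?ind s * d s x) *\<^sub>R f x)"
    proof (rule lborel_pair.Fubini_integrable)
      have le: "(LINT x|lborel. norm ((?ind s * d s x) *\<^sub>R f x)) \<le>
          ?ind s * (\<Sum>i\<in>UNIV. \<bar>v $ i\<bar> * C i) * (LINT x|lborel. norm (f x))" for s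
      proof -
        have "(LINT x|lborel. norm ((?ind s * d s x) *\<^sub>R f x)) \<le>
          (LINT x|lborel. ?ind s * (\<Sum>i\<in>UNIV. \<bar>v $ i\<bar> * C i) * norm (f x))"
        proof (rule integral_mono)
          show "integrable lborel (\<lambda>x. norm ((?ind s * d s x) *\<^sub>R f x))"
            by (intro integrable_norm integrable_scaleR_bounded[OF f, where B="\<Sum>i\<in>UNIV. \<bar>v $ i\<bar> * C i"])
               (auto simp: abs_mult dC indicator_def order_trans[OF abs_ge_zero dC])
        qed (use f in \<open>auto simp: abs_mult dC indicator_def intro!: mult_right_mono\<close>)
        then show ?thesis by simp
      qed
      show "integrable lborel (\<lambda>s. LINT x|lborel. norm (case (s, x) of (s, x) \<Rightarrow> (?ind s * d s x) *\<^sub>R f x))"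
      proof (rule Bochner_Integration.integrable_bound)
        show "integrable lborel (\<lambda>s. ?ind s * ((\<Sum>i\<in>UNIV. \<bar>v $ i\<bar> * C i) * (LINT x|lborel. norm (f x))))"
          by simp
        show "AE s in lborel. norm (LINT x|lborel. norm (case (s, x) of (s, x) \<Rightarrow> (?ind s * d s x) *\<^sub>R f x)) \<le>
           norm (?ind s * ((\<Sum>i\<in>UNIV. \<bar>v $ i\<bar> * C i) * (LINT x|lborel. norm (f x))))"
          using order_trans[OF le abs_ge_self] by (auto simp: mult.assoc integral_nonneg_AE)
      qed measurable
      show "AE s in lborel. integrable lborel (\<lambda>x. case (s, x) of (s, x) \<Rightarrow> (?ind s * d s x) *\<^sub>R f x)"
        by (auto intro!: integrable_scaleR_bounded[OF f, where B="\<Sum>i\<in>UNIV. \<bar>v $ i\<bar> * C i"]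
             simp: abs_mult dC indicator_def order_trans[OF abs_ge_zero dC])
    qed measurable
    have G\<phi>_int: "integrable (lborel \<Otimes>\<^sub>M lborel) (\<lambda>(s, x). \<phi> x *\<^sub>R (?ind s *\<^sub>R (G (x + s *\<^sub>R v) *v v)))"
    proof -
      have "integrable (lborel \<Otimes>\<^sub>M lborel) (\<lambda>p. \<phi> (snd p) *\<^sub>R ((case p of (s, x) \<Rightarrow> ?ind s *\<^sub>R G (x + s *\<^sub>R v)) *v v))"
        by (rule integrable_scaleR_bounded[OF
              integrable_bounded_linear[OF bounded_linear_matrix_mult_left int2], where B=B]) (auto simp: B)
      then show ?thesis
        by (simp add: case_prod_unfold scaleR_matrix_vector_assoc)
    qed
    \<comment> \<open>The weak equation for the test function shifted by
      \<open>s *\<^sub>R v\<close>, summed over the coordinate directions with the weights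
      \<open>v $ i\<close>.\<close>
    have inner: "(LINT x|lborel. d s x *\<^sub>R f x) = (LINT x|lborel. \<phi> x *\<^sub>R (G (x + s *\<^sub>R v) *v v))"
      if s: "0 \<le> s" "s \<le> 1" for s
    proof -
      let ?\<psi> = "\<lambda>x. \<phi> (x - s *\<^sub>R v)"
      have \<psi>: "smooth_gen ?\<psi>" by (rule smooth_gen_translate[OF \<phi>])
      have K': "compact ((+) (s *\<^sub>R v) ` K)" "(+) (s *\<^sub>R v) ` K \<subseteq> U"
      proof -
        show "compact ((+) (s *\<^sub>R v) ` K)" by (rule compact_translation[OF K(1)])
        show "(+) (s *\<^sub>R v) ` K \<subseteq> U" using K(2) V(2)[OF _ s] by (auto simp: add.commute)
      qed
      have out: "?\<psi> x = 0" if "x \<notin> (+) (s *\<^sub>R v) ` K" for x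
        using that by (intro K(3)) (auto simp: image_iff algebra_simps)
      have "(LINT x|lborel. d s x *\<^sub>R f x) =
          (LINT x|lborel. (\<Sum>i\<in>UNIV. (- v $ i) *\<^sub>R (partial_dir ?\<psi> i x *\<^sub>R f x)))"
        by (simp add: d_def partial_dir_translate scaleR_sum_left sum_negf)
      also have "\<dots> = (\<Sum>i\<in>UNIV. (- v $ i) *\<^sub>R (LINT x|lborel. partial_dir ?\<psi> i x *\<^sub>R f x))"
      proof -
        have "integrable lborel (\<lambda>x. partial_dir ?\<psi> i x *\<^sub>R f x)" for i
          by (rule integrable_scaleR_bounded[OF f, where B="C i"]) (auto simp: partial_dir_translate C)
        then show ?thesis
          by (subst Bochner_Integration.integral_sum) (auto simp del: scaleR_scaleR scaleR_minus_left)
      qed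
      also have "\<dots> = (\<Sum>i\<in>UNIV. v $ i *\<^sub>R (LINT x|lborel. ?\<psi> x *\<^sub>R column i (G x)))"
        by (simp add: weak[OF \<psi> K' out])
      also have "\<dots> = (LINT x|lborel. (\<Sum>i\<in>UNIV. v $ i *\<^sub>R (?\<psi> x *\<^sub>R column i (G x))))"
      proof -
        have "bounded_linear (\<lambda>A::real^'n^'m. column i A)" for i
          using bounded_linear_matrix_mult_left[of "axis i 1"] by (simp add: matrix_vector_mult_basis)
        then have "integrable lborel (\<lambda>x. column i (G x))" for i
          by (rule integrable_bounded_linear[OF _ G])
        then have "integrable lborel (\<lambda>x. ?\<psi> x *\<^sub>R column i (G x))" for i
          by (rule integrable_scaleR_bounded[where B=B]) (auto simp: B)
        then show ?thesis
          by (subst Bochner_Integration.integral_sum) (auto simp del: scaleR_scaleR)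
      qed
      also have "\<dots> = (LINT x|lborel. \<phi> (x - s *\<^sub>R v) *\<^sub>R (G x *v v))"
        by (simp add: matrix_mult_sum_scaleR scaleR_sum_right mult.commute)
      also have "\<dots> = (LINT x|lborel. \<phi> x *\<^sub>R (G (x + s *\<^sub>R v) *v v))"
        using integral_lborel_translate[of "\<lambda>x. \<phi> (x - s *\<^sub>R v) *\<^sub>R (G x *v v)" "s *\<^sub>R v"] by simp
      finally show ?thesis .
    qed
    have \<phi>f: "integrable lborel (\<lambda>x. \<phi> (x - c) *\<^sub>R f x)" for c
      by (rule integrable_scaleR_bounded[OF f, where B=B]) (auto simp: B)
    have \<phi>fv: "integrable lborel (\<lambda>x. \<phi> x *\<^sub>R f (x + v))"
      by (rule integrable_scaleR_bounded[OF fv, where B=B]) (auto simp: B)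
    have \<phi>I: "integrable lborel (\<lambda>x. \<phi> x *\<^sub>R (I x *v v))"
      by (rule integrable_scaleR_bounded[OF Iv, where B=B]) (auto simp: B)
    have "(LINT x|lborel. \<phi> x *\<^sub>R f (x + v)) = (LINT x|lborel. \<phi> (x - v) *\<^sub>R f x)"
      using integral_lborel_translate[of "\<lambda>x. \<phi> (x - v) *\<^sub>R f x" v] by simp
    then have "(LINT x|lborel. \<phi> x *\<^sub>R f (x + v)) - (LINT x|lborel. \<phi> x *\<^sub>R f x) =
        (LINT x|lborel. (\<phi> (x - v) - \<phi> x) *\<^sub>R f x)"
      using \<phi>f[of v] \<phi>f[of 0] by (simp add: scaleR_left_diff_distrib)
    also have "\<dots> = (LINT x|lborel. (LINT s|lborel. (?ind s * d s x) *\<^sub>R f x))"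
    proof (rule Bochner_Integration.integral_cong[OF refl])
      fix x
      have "integrable lborel (\<lambda>s. ?ind s * d s x)"
      proof (rule Bochner_Integration.integrable_bound)
        show "integrable lborel (\<lambda>s. ?ind s * (\<Sum>i\<in>UNIV. \<bar>v $ i\<bar> * C i))" by simp
        show "AE s in lborel. norm (?ind s * d s x) \<le> norm (?ind s * (\<Sum>i\<in>UNIV. \<bar>v $ i\<bar> * C i))"
          using order_trans[OF dC abs_ge_self] by (auto simp: abs_mult indicator_def)
      qed (simp add: d_def)
      then show "(\<phi> (x - v) - \<phi> x) *\<^sub>R f x = (LINT s|lborel. (?ind s * d s x) *\<^sub>R f x)"
        by (simp add: smooth_gen_translate_integral[OF \<phi>] d_def)
    qed
    also have "\<dots> = (LINT s|lborel. (LINT x|lborel. (?ind s * d s x) *\<^sub>R f x))"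
      by (rule lborel_pair.Fubini_integral[OF d_int])
    also have "\<dots> = (LINT s|lborel. (LINT x|lborel. \<phi> x *\<^sub>R (?ind s *\<^sub>R (G (x + s *\<^sub>R v) *v v))))"
    proof (rule Bochner_Integration.integral_cong[OF refl])
      fix s :: real
      show "(LINT x|lborel. (?ind s * d s x) *\<^sub>R f x) =
          (LINT x|lborel. \<phi> x *\<^sub>R (?ind s *\<^sub>R (G (x + s *\<^sub>R v) *v v)))"
        using inner[of s] by (simp add: indicator_def)
    qed
    also have "\<dots> = (LINT x|lborel. (LINT s|lborel. \<phi> x *\<^sub>R (?ind s *\<^sub>R (G (x + s *\<^sub>R v) *v v))))"
      by (rule lborel_pair.Fubini_integral[OF G\<phi>_int, symmetric])
    also have "\<dots> = (LINT x|lborel. \<phi> x *\<^sub>R (I x *v v))"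
    proof (rule integral_cong_AE)
      show "AE x in lborel. (LINT s|lborel. \<phi> x *\<^sub>R (?ind s *\<^sub>R (G (x + s *\<^sub>R v) *v v))) =
        \<phi> x *\<^sub>R (I x *v v)"
        using AEint
      proof eventually_elim
        case (elim x)
        then have "I x *v v = (LINT s|lborel. (?ind s *\<^sub>R G (x + s *\<^sub>R v)) *v v)"
          unfolding I_def by (rule integral_bounded_linear[OF bounded_linear_matrix_mult_left, symmetric])
        then show ?case
          by (simp add: scaleR_matrix_vector_assoc[symmetric] del: scaleR_scaleR)
      qed
    qed (use lborel_pair.integrable_snd[OF G\<phi>_int] \<phi>I in auto)
    finally show ?thesis
      unfolding w_def using \<phi>f[of 0] \<phi>fv \<phi>I by (simp add: scaleR_right_diff_distrib)
  qed
  have "AE x in lebesgue. x \<in> V \<longrightarrow> w x = 0"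
  proof (rule AE_zero_of_zero_bump_integrals[OF V(1)])
    show "w absolutely_integrable_on cbox a b" for a b
      by (rule integrable_lborel_imp_absolutely_integrable_on[OF w]) simp
    fix a b m assume ab: "cbox a b \<subseteq> V"
    have "integrable lborel (\<lambda>x. bump a b m x *\<^sub>R w x)"
      by (rule integrable_scaleR_bounded[OF w, where B=1])
         (use bump_bounds[of a b m] in \<open>auto intro!: smooth_gen_borel smooth_gen_bump\<close>)
    from integral_lborel[OF this] have "integral UNIV (\<lambda>x. bump a b m x *\<^sub>R w x) = 0"
      using zero[OF smooth_gen_bump compact_cbox ab] bump_outside box_subset_cbox by (metis subsetD)
    moreover have "(\<lambda>x. if x \<in> cbox a b then bump a b m x *\<^sub>R w x else 0) = (\<lambda>x. bump a b m x *\<^sub>R w x)"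
      using bump_outside[of _ a b m] box_subset_cbox[of a b] by (auto simp: fun_eq_iff)
    ultimately have "integral UNIV (\<lambda>x. if x \<in> cbox a b then bump a b m x *\<^sub>R w x else 0) = 0"
      by simp
    then show "integral (cbox a b) (\<lambda>x. bump a b m x *\<^sub>R w x) = 0"
      unfolding integral_restrict_UNIV .
  qed
  then have "AE x in lborel. x \<in> V \<longrightarrow> w x = 0"
    unfolding AE_completion_iff .
  with AEint show ?thesis
    by eventually_elim (simp add: w_def I_def)
qed

section \<open>Lebesgue points and Egorov's theorem\<close>

lemma nn_integral_lborel_translate:
  fixes F :: "'a::euclidean_space \<Rightarrow> ennreal"
  assumes [measurable]: "F \<in> borel_measurable borel"
  shows "(\<integral>\<^sup>+w. F (c + w) \<partial>lborel) = (\<integral>\<^sup>+w. F w \<partial>lborel)"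
  using nn_integral_distr[of "(+) c" lborel borel F] by (simp add: lborel_distr_plus)

lemma nn_integral_lborel_scale:
  fixes F :: "'a::euclidean_space \<Rightarrow> ennreal"
  assumes [measurable]: "F \<in> borel_measurable borel" and "c > 0"
  shows "(\<integral>\<^sup>+w. F w \<partial>lborel) = ennreal (c ^ DIM('a)) * (\<integral>\<^sup>+w. F (c *\<^sub>R w) \<partial>lborel)"
  using \<open>c > 0\<close>
  by (subst lborel_affine[of c "0::'a"])
     (auto simp: nn_integral_density nn_integral_distr nn_integral_cmult)

text \<open>The corner rather than the centre is at the origin: these are the cubes of the
  differentiation theorem, and scaling by a factor in \<open>{0..1}\<close> maps each of them into
  itself.\<close>

abbreviation cube :: "real \<Rightarrow> 'a::euclidean_space set" where
  "cube r \<equiv> cbox 0 (r *\<^sub>R One)"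

lemma mem_cube: "w \<in> cube r \<longleftrightarrow> (\<forall>i\<in>Basis. 0 \<le> w \<bullet> i \<and> w \<bullet> i \<le> r)"
  by (simp add: mem_box)

lemma norm_cube_le: "w \<in> cube r \<Longrightarrow> norm w \<le> real DIM('a) * r" for w :: "'a::euclidean_space"
proof -
  assume w: "w \<in> cube r"
  have "norm w \<le> (\<Sum>i\<in>Basis. \<bar>w \<bullet> i\<bar>)" by (rule norm_le_l1)
  also have "\<dots> \<le> (\<Sum>i\<in>(Basis::'a set). r)" using w by (intro sum_mono) (auto simp: mem_cube)
  finally show ?thesis by simp
qed

lemma emeasure_cube: "0 \<le> r \<Longrightarrow> emeasure lborel (cbox p (p + r *\<^sub>R One) :: 'a::euclidean_space set) = ennreal (r ^ DIM('a))"
  by (auto simp: emeasure_lborel_cbox_eq inner_simps inner_sum_left_Basis)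

text \<open>Differentiation of integrals is applied to \<open>norm (g x - q)\<close> for
  \<open>q\<close> in a countable dense set, which leaves a single null set. Approximating
  \<open>g x\<close> within \<open>e / 3\<close> by such a \<open>q\<close>, the triangle inequality
  then bounds the mean oscillation around \<open>g x\<close> itself.\<close>

lemma AE_lebesgue_point:
  fixes g :: "'a::euclidean_space \<Rightarrow> 'b::euclidean_space"
  assumes g: "integrable lborel g"
  shows "AE x in lborel. \<forall>e>0. \<exists>d>0. \<forall>r. 0 < r \<and> r < d \<longrightarrow>
    (\<integral>\<^sup>+w. indicator (cube r) w * ennreal (norm (g (x + w) - g x)) \<partial>lborel) \<le> ennreal (e * r ^ DIM('a))"
proof -
  note [measurable] = borel_measurable_integrable[OF g]
  obtain C :: "'b set" where C: "countable C" "\<And>X. open X \<Longrightarrow> X \<noteq> {} \<Longrightarrow> \<exists>q\<in>C. q \<in> X"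
    by (rule countable_dense_setE) blast
  have int: "(\<lambda>x. norm (g x - q)) absolutely_integrable_on cbox a b" for q a b
  proof -
    have "g absolutely_integrable_on cbox a b"
      by (rule integrable_lborel_imp_absolutely_integrable_on[OF g]) simp
    then have "(\<lambda>x. g x - q) absolutely_integrable_on cbox a b"
      by (intro set_integral_diff(1)) auto
    then show ?thesis by (rule absolutely_integrable_norm[unfolded o_def])
  qed
  have "\<exists>N. negligible N \<and> (\<forall>x e. x \<notin> N \<longrightarrow> 0 < e \<longrightarrow> (\<exists>d>0. \<forall>h. 0 < h \<and> h < d \<longrightarrow>
      norm (integral (cbox x (x + h *\<^sub>R One)) (\<lambda>x. norm (g x - q)) /\<^sub>R h ^ DIM('a) - norm (g x - q)) < e))" for q
    by (rule integrable_ccontinuous_explicit[of "\<lambda>x. norm (g x - q)"])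
       (auto intro: set_lebesgue_integral_eq_integral(1) int)
  then obtain N where N: "\<And>q. negligible (N q)"
    and lim: "\<And>q x e. x \<notin> N q \<Longrightarrow> 0 < e \<Longrightarrow> \<exists>d>0. \<forall>h. 0 < h \<and> h < d \<longrightarrow>
      norm (integral (cbox x (x + h *\<^sub>R One)) (\<lambda>x. norm (g x - q)) /\<^sub>R h ^ DIM('a) - norm (g x - q)) < e"
    by metis
  have "negligible (\<Union>q\<in>C. N q)"
    using C(1) N by (intro negligible_countable_Union) auto
  then have "AE x in lebesgue. x \<notin> (\<Union>q\<in>C. N q)"
    unfolding AE_lebesgue_iff_negligible by (rule negligible_subset) auto
  then have "AE x in lborel. x \<notin> (\<Union>q\<in>C. N q)"
    unfolding AE_completion_iff .
  then show ?thesis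
  proof eventually_elim
    case (elim x)
    show ?case
    proof (intro allI impI)
      fix e :: real assume "e > 0"
      obtain q where q: "q \<in> C" "dist (g x) q < e / 3"
        using C(2)[of "ball (g x) (e / 3)"] \<open>e > 0\<close> by auto
      obtain d where d: "d > 0" "\<And>h. 0 < h \<Longrightarrow> h < d \<Longrightarrow>
          norm (integral (cbox x (x + h *\<^sub>R One)) (\<lambda>x. norm (g x - q)) /\<^sub>R h ^ DIM('a) - norm (g x - q)) < e / 3"
        using lim[of x q "e/3"] elim q(1) \<open>e > 0\<close> by auto
      show "\<exists>d>0. \<forall>r. 0 < r \<and> r < d \<longrightarrow>
        (\<integral>\<^sup>+w. indicator (cube r) w * ennreal (norm (g (x + w) - g x)) \<partial>lborel) \<le> ennreal (e * r ^ DIM('a))"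
      proof (intro exI conjI allI impI)
        show "d > 0" by fact
        fix r assume "0 < r \<and> r < d"
        then have r: "0 < r" "r < d" by auto
        let ?J = "integral (cbox x (x + r *\<^sub>R One)) (\<lambda>x. norm (g x - q))"
        have "?J /\<^sub>R r ^ DIM('a) = ?J / r ^ DIM('a)"
          by (simp only: real_scaleR_def divide_inverse mult.commute)
        then have "?J / r ^ DIM('a) < 2 * e / 3"
          using d(2)[OF r] q(2) unfolding dist_norm real_norm_def by linarith
        then have J: "?J \<le> 2 * e / 3 * r ^ DIM('a)"
          using r by (subst (asm) pos_divide_less_eq) auto
        have "(\<integral>\<^sup>+w. indicator (cube r) w * ennreal (norm (g (x + w) - g x)) \<partial>lborel) \<le>
           (\<integral>\<^sup>+w. indicator (cube r) w * ennreal (norm (g (x + w) - q)) + indicator (cube r) w * ennreal (e / 3) \<partial>lborel)"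
        proof (rule nn_integral_mono)
          fix w
          have "norm (g (x + w) - g x) \<le> norm (g (x + w) - q) + norm (g x - q)"
            by norm
          then have "norm (g (x + w) - g x) \<le> norm (g (x + w) - q) + e / 3"
            using q(2) unfolding dist_norm by linarith
          then have "ennreal (norm (g (x + w) - g x)) \<le> ennreal (norm (g (x + w) - q) + e / 3)"
            by (rule ennreal_leI)
          also have "\<dots> = ennreal (norm (g (x + w) - q)) + ennreal (e / 3)"
            using \<open>e > 0\<close> by simp
          finally have "ennreal (norm (g (x + w) - g x)) \<le> ennreal (norm (g (x + w) - q)) + ennreal (e / 3)" .
          then show "indicator (cube r) w * ennreal (norm (g (x + w) - g x)) \<le>
              indicator (cube r) w * ennreal (norm (g (x + w) - q)) + indicator (cube r) w * ennreal (e / 3)"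
            by (simp split: split_indicator)
        qed
        also have "\<dots> = (\<integral>\<^sup>+w. indicator (cube r) w * ennreal (norm (g (x + w) - q)) \<partial>lborel) + ennreal (e / 3) * ennreal (r ^ DIM('a))"
        proof -
          have "(\<integral>\<^sup>+w. ennreal (e / 3) * indicator (cube r) (w::'a) \<partial>lborel) = ennreal (e / 3) * ennreal (r ^ DIM('a))"
            using r emeasure_cube[of r "0::'a"] by (subst nn_integral_cmult_indicator) auto
          then show ?thesis
            by (subst nn_integral_add) (auto simp: mult.commute[of "indicator (cube r) _" "ennreal (e / 3)"])
        qed
        also have "(\<integral>\<^sup>+w. indicator (cube r) w * ennreal (norm (g (x + w) - q)) \<partial>lborel) =
            (\<integral>\<^sup>+w. indicator (cbox x (x + r *\<^sub>R One)) (x + w) * ennreal (norm (g (x + w) - q)) \<partial>lborel)"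
          by (intro nn_integral_cong) (auto simp: mem_box inner_simps split: split_indicator)
        also have "\<dots> = (\<integral>\<^sup>+w. indicator (cbox x (x + r *\<^sub>R One)) w * ennreal (norm (g w - q)) \<partial>lborel)"
          by (rule nn_integral_lborel_translate) measurable
        also have "\<dots> = ennreal ?J"
          using nn_integral_has_integral_lebesgue'[OF _ integrable_integral[OF
              set_lebesgue_integral_eq_integral(1)[OF int[where q=q and a=x and b="x + r *\<^sub>R One"]]]]
          by (simp add: mult.commute)
        also have "ennreal ?J + ennreal (e / 3) * ennreal (r ^ DIM('a)) \<le> ennreal (e * r ^ DIM('a))"
        proof -
          have "ennreal ?J + ennreal (e / 3) * ennreal (r ^ DIM('a)) = ennreal (?J + e / 3 * r ^ DIM('a))"
            using \<open>e > 0\<close> r by (subst ennreal_plus) (auto simp: ennreal_mult'[symmetric] intro!: integral_nonneg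
              set_lebesgue_integral_eq_integral(1) int)
          also have "\<dots> \<le> ennreal (e * r ^ DIM('a))"
            using J by (intro ennreal_leI) (simp add: algebra_simps)
          finally show ?thesis .
        qed
        finally show "(\<integral>\<^sup>+w. indicator (cube r) w * ennreal (norm (g (x + w) - g x)) \<partial>lborel) \<le> ennreal (e * r ^ DIM('a))" .
      qed
    qed
  qed
qed

text \<open>Phrased for errors that tend to 0, and with countably many sets exhausting
  \<open>A\<close> up to a null set instead of one set of almost full measure. The sets
  \<open>B n i\<close> of points with a late large error decrease in \<open>n\<close> to a null set,
  so \<open>n i k\<close> can be chosen to make their measures sum over \<open>i\<close> to at most
  \<open>1 / Suc k\<close>.\<close>

lemma egorov:
  fixes e :: "nat \<Rightarrow> 'a \<Rightarrow> ennreal"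
  assumes A: "A \<in> sets M" "emeasure M A < \<infinity>"
    and [measurable]: "\<And>n. e n \<in> borel_measurable M"
    and lim: "AE x in M. x \<in> A \<longrightarrow> (\<forall>i. \<forall>\<^sub>F n in sequentially. e n x < ennreal (1 / Suc i))"
  shows "\<exists>T :: nat \<Rightarrow> 'a set. (\<forall>k. T k \<in> sets M \<and> T k \<subseteq> A) \<and>
    (\<forall>k i. \<exists>N. \<forall>n\<ge>N. \<forall>x\<in>T k. e n x < ennreal (1 / Suc i)) \<and>
    A - (\<Union>k. T k) \<in> null_sets M"
proof -
  note [measurable] = A(1)
  define B where "B n i = {x \<in> space M. x \<in> A \<and> (\<exists>m\<ge>n. \<not> e m x < ennreal (1 / Suc i))}" for n i
  have [measurable]: "B n i \<in> sets M" for n i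
    unfolding B_def by measurable
  have small: "\<exists>n. emeasure M (B n i) < ennreal c" if "c > 0" for i c
  proof -
    have "(\<lambda>n. emeasure M (B n i)) \<longlonglongrightarrow> emeasure M (\<Inter>n. B n i)"
    proof (rule Lim_emeasure_decseq)
      show "decseq (\<lambda>n. B n i)"
        by (auto simp: decseq_def B_def intro: order_trans)
      have "emeasure M (B n i) \<le> emeasure M A" for n
        by (rule emeasure_mono) (auto simp: B_def)
      then show "emeasure M (B n i) \<noteq> \<infinity>" for n
        using A(2) by (metis infinity_ennreal_def less_le_not_le top_greatest)
    qed auto
    moreover have "(\<Inter>n. B n i) \<in> null_sets M"
    proof (subst AE_iff_null_sets)
      show "AE x in M. x \<notin> (\<Inter>n. B n i)"
        using lim
      proof eventually_elim
        case (elim x)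
        show ?case
        proof (cases "x \<in> A")
          case True
          with elim have "\<forall>\<^sub>F n in sequentially. e n x < ennreal (1 / Suc i)" by simp
          then show ?thesis by (auto simp: B_def eventually_sequentially)
        qed (auto simp: B_def)
      qed
    qed measurable
    then have "emeasure M (\<Inter>n. B n i) = 0" by blast
    ultimately have "\<forall>\<^sub>F n in sequentially. emeasure M (B n i) < ennreal c"
      using that by (intro order_tendstoD(2)) auto
    then show ?thesis by (auto simp: eventually_sequentially)
  qed
  have "\<exists>n. emeasure M (B n i) < ennreal ((1/2) ^ Suc i / Suc k)" for i k
    by (rule small) simp
  then obtain n where n: "\<And>i k. emeasure M (B (n i k) i) < ennreal ((1/2) ^ Suc i / Suc k)"
    by metis
  define T where "T k = A - (\<Union>i. B (n i k) i)" for k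
  have [measurable]: "T k \<in> sets M" for k unfolding T_def by measurable
  have le: "emeasure M (A - T k) \<le> ennreal (1 / Suc k)" for k
  proof -
    have "emeasure M (A - T k) \<le> emeasure M (\<Union>i. B (n i k) i)"
      by (rule emeasure_mono) (auto simp: T_def)
    also have "\<dots> \<le> (\<Sum>i. emeasure M (B (n i k) i))"
      by (rule emeasure_subadditive_countably) auto
    also have "\<dots> \<le> (\<Sum>i. ennreal ((1/2) ^ Suc i / Suc k))"
      by (intro suminf_le less_imp_le n) auto
    also have "\<dots> = ennreal (1 / Suc k)"
      using sums_divide[OF power_half_series, of "real (Suc k)"]
      by (intro suminf_ennreal_eq) auto
    finally show ?thesis .
  qed
  show ?thesis
  proof (intro exI[of _ T] conjI allI)
    show "T k \<in> sets M" "T k \<subseteq> A" for k by (auto simp: T_def)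
    show "\<exists>N. \<forall>m\<ge>N. \<forall>x\<in>T k. e m x < ennreal (1 / Suc i)" for k i
      using sets.sets_into_space[OF A(1)]
      by (intro exI[of _ "n i k"]) (auto simp: T_def B_def)
    show "A - (\<Union>k. T k) \<in> null_sets M"
    proof (rule null_setsI)
      have "emeasure M (A - (\<Union>k. T k)) \<le> ennreal (1 / Suc k)" for k
        by (rule order_trans[OF emeasure_mono le[of k]]) auto
      moreover have "(\<lambda>k. ennreal (1 / Suc k)) \<longlonglongrightarrow> ennreal 0"
        using LIMSEQ_inverse_real_of_nat by (intro tendsto_ennrealI) (simp add: inverse_eq_divide)
      ultimately have "emeasure M (A - (\<Union>k. T k)) \<le> ennreal 0"
        by (intro LIMSEQ_le_const) auto
      then show "emeasure M (A - (\<Union>k. T k)) = 0" by simp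
    qed measurable
  qed
qed

text \<open>Egorov's theorem controls a sequence of scales, here the powers of 1/2. A small distance
  is rounded up to such a scale at the cost of a factor below 2.\<close>

lemma ex_half_power_between:
  fixes d :: real
  assumes "0 < d" "d \<le> (1/2) ^ N"
  shows "\<exists>m\<ge>N. d \<le> (1/2) ^ m \<and> (1/2) ^ m < 2 * d"
proof -
  have ex: "\<exists>m. (1/2 :: real) ^ m < d"
    using assms(1) by (intro real_arch_pow_inv) auto
  define k where "k = (LEAST m. (1/2 :: real) ^ m < d)"
  have k: "(1/2 :: real) ^ k < d"
    unfolding k_def using ex by (rule LeastI_ex)
  have "N < k"
  proof (rule ccontr)
    assume "\<not> N < k"
    then have "(1/2 :: real) ^ N \<le> (1/2) ^ k"
      by (intro power_decreasing) auto
    with k assms(2) show False by simp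
  qed
  then obtain m where m: "k = Suc m" by (cases k) auto
  have "\<not> (1/2 :: real) ^ m < d"
    using not_less_Least[of m "\<lambda>m. (1/2 :: real) ^ m < d"] by (simp add: m k_def[symmetric])
  with k m \<open>N < k\<close> show ?thesis
    by (intro exI[of _ m]) auto
qed

lemma One_nth_cart: "(One :: real^'n) $ i = 1"
  by (simp add: cart_eq_inner_axis inner_sum_left_Basis axis_in_Basis_iff)

text \<open>For almost every base point the mean of the first-order remainder over a cube of side
  \<open>r\<close> is controlled by \<open>r\<close> times mean oscillations of \<open>G\<close> at
  scales up to \<open>r\<close>, which are small at Lebesgue points. This says nothing about single
  increments. Egorov's theorem makes the rate uniform on sets \<open>T k\<close>; two nearby points
  of the same \<open>T k\<close> then share a cube of intermediate points, and averaging over it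
  compares their two expansions.\<close>

lemma weak_gradient_approx_differentiable:
  fixes f :: "real^'n \<Rightarrow> real^'m" and G :: "real^'n \<Rightarrow> real^'n^'m"
  assumes f [measurable]: "f \<in> borel_measurable borel" and G: "integrable lborel G"
    and V: "open V" "emeasure lborel V < \<infinity>" and "R > 0"
    and star: "\<And>v. norm v < R \<Longrightarrow> AE x in lborel. x \<in> V \<longrightarrow>
      integrable lborel (\<lambda>s. indicator {0..1} s *\<^sub>R G (x + s *\<^sub>R v)) \<and>
      f (x + v) - f x = (LINT s|lborel. indicator {0..1} s *\<^sub>R G (x + s *\<^sub>R v)) *v v"
  obtains T :: "nat \<Rightarrow> (real^'n) set" where "\<And>k. T k \<in> sets borel" "\<And>k. T k \<subseteq> V"
    "negligible (V - (\<Union>k. T k))"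
    "\<And>k x. x \<in> T k \<Longrightarrow> (f has_derivative (*v) (G x)) (at x within T k)"
proof -
  note [measurable] = borel_measurable_integrable[OF G]
  let ?n = "CARD('n)"
  define rem where "rem x v = norm (f (x + v) - f x - G x *v v)" for x v
  define osc where "osc x w = norm (G (x + w) - G x)" for x w
  have mv [measurable]: "(\<lambda>p. A p *v b p) \<in> borel_measurable M"
    if [measurable]: "A \<in> borel_measurable M" "b \<in> borel_measurable M"
    for A :: "'z \<Rightarrow> real^'n^'m" and b M
  proof -
    have "continuous_on UNIV (\<lambda>p::(real^'n^'m) \<times> (real^'n). fst p *v snd p)"
      unfolding matrix_mult_sum_scaleR column_def
      by (intro continuous_intros)
    from borel_measurable_continuous_on[OF this, of "\<lambda>p. (A p, b p)" M] show ?thesis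
      by (simp add: borel_prod[symmetric])
  qed
  have [measurable]: "rem x \<in> borel_measurable borel" "osc x \<in> borel_measurable borel" for x
    unfolding rem_def osc_def by measurable
  let ?Q = "\<lambda>x v. x \<in> V \<longrightarrow> norm v < R \<longrightarrow>
    ennreal (rem x v) \<le> ennreal (norm v) * (\<integral>\<^sup>+s. indicator {0..1} s * ennreal (osc x (s *\<^sub>R v)) \<partial>lborel)"
  have ineq: "AE x in lborel. ?Q x v" for v
  proof (cases "norm v < R")
    case True
    show ?thesis using star[OF True]
    proof eventually_elim
      case (elim x)
      show ?case
      proof (intro impI)
        assume "x \<in> V"
        with elim have int: "integrable lborel (\<lambda>s. indicator {0..1} s *\<^sub>R G (x + s *\<^sub>R v))"
          and eq: "f (x + v) - f x = (LINT s|lborel. indicator {0..1} s *\<^sub>R G (x + s *\<^sub>R v)) *v v" by auto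
        have int': "integrable lborel (\<lambda>s::real. indicator {0..1} s *\<^sub>R G x)" by simp
        let ?A = "LINT s|lborel. indicator {0..1} s *\<^sub>R (G (x + s *\<^sub>R v) - G x)"
        have int2: "integrable lborel (\<lambda>s. indicator {0..1} s *\<^sub>R (G (x + s *\<^sub>R v) - G x))"
          using Bochner_Integration.integrable_diff[OF int int'] by (simp add: scaleR_diff_right)
        have "?A = (LINT s|lborel. indicator {0..1} s *\<^sub>R G (x + s *\<^sub>R v)) - G x"
          using Bochner_Integration.integral_diff[OF int int'] by (simp add: scaleR_diff_right)
        then have "rem x v = norm (?A *v v)"
          by (simp add: rem_def eq matrix_vector_mult_diff_rdistrib)
        also have "\<dots> \<le> norm ?A * norm v" by (rule norm_matrix_vector_mult_le)
        finally have "ennreal (rem x v) \<le> ennreal (norm v) * ennreal (norm ?A)"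
          by (simp add: ennreal_mult'[symmetric] mult.commute ennreal_leI)
        also have "ennreal (norm ?A) \<le> (\<integral>\<^sup>+s. norm (indicator {0..1} s *\<^sub>R (G (x + s *\<^sub>R v) - G x)) \<partial>lborel)"
          by (rule integral_norm_bound_ennreal[OF int2])
        also have "\<dots> = (\<integral>\<^sup>+s. indicator {0..1} s * ennreal (osc x (s *\<^sub>R v)) \<partial>lborel)"
          by (intro nn_integral_cong) (auto simp: osc_def split: split_indicator)
        finally show "ennreal (rem x v) \<le> ennreal (norm v) * (\<integral>\<^sup>+s. indicator {0..1} s * ennreal (osc x (s *\<^sub>R v)) \<partial>lborel)"
          by (simp add: mult_left_mono)
      qed
    qed
  qed auto
  \<comment> \<open>The null set of base points depends on \<open>v\<close>. Fubini exchanges the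
    quantifiers and leaves one null set, outside of which a base point is good for almost every
    \<open>v\<close>.\<close>
  have ineq': "AE x in lborel. AE v in lborel. ?Q x v"
  proof (subst lborel_pair.AE_commute)
    have [measurable]: "V \<in> sets borel" using V(1) by auto
    have "Measurable.pred (lborel \<Otimes>\<^sub>M lborel) (\<lambda>p. ?Q (fst p) (snd p))"
      unfolding rem_def osc_def by measurable
    then show "{p \<in> space (lborel \<Otimes>\<^sub>M lborel). ?Q (fst p) (snd p)} \<in> sets (lborel \<Otimes>\<^sub>M lborel)"
      by (simp add: pred_def)
    show "AE v in lborel. AE x in lborel. ?Q x v"
      using ineq by simp
  qed
  define E where "E r x = (\<integral>\<^sup>+v. indicator (cube r) v * ennreal (rem x v) \<partial>lborel)" for r x
  define M where "M r x = (\<integral>\<^sup>+w. indicator (cube r) w * ennreal (osc x w) \<partial>lborel)" for r x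
  have [measurable]: "E r \<in> borel_measurable borel" "M r \<in> borel_measurable borel" for r
    unfolding E_def M_def rem_def osc_def by measurable
  have points: "AE x in lborel. x \<in> V \<longrightarrow> (\<forall>e>0. \<exists>d>0. \<forall>r. 0 < r \<and> r < d \<longrightarrow>
      M r x \<le> ennreal (e * r ^ ?n) \<and> E r x \<le> ennreal (real ?n * r * (e * r ^ ?n)))"
    using ineq' AE_lebesgue_point[OF G]
  proof eventually_elim
    case (elim x)
    show ?case
    proof (intro impI allI)
      fix e :: real assume "x \<in> V" "e > 0"
      obtain d where d: "d > 0" "\<And>r. 0 < r \<Longrightarrow> r < d \<Longrightarrow> M r x \<le> ennreal (e * r ^ ?n)"
        using elim(2) \<open>e > 0\<close> unfolding M_def osc_def by fastforce
      \<comment> \<open>On \<open>cube r\<close> the norm is at most \<open>?n * r\<close>, and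
        \<open>star\<close> is available only for vectors shorter than \<open>R\<close>.\<close>
      define d' where "d' = min d (R / real ?n)"
      have d': "d' > 0" "d' \<le> d" "real ?n * d' \<le> R"
        using d(1) \<open>R > 0\<close> by (auto simp: d'_def min_def field_simps)
      have "E r x \<le> ennreal (real ?n * r * (e * r ^ ?n))" if r: "0 < r" "r < d'" for r
      proof -
        let ?I = "\<lambda>v. (\<integral>\<^sup>+s. indicator {0..1} s * ennreal (osc x (s *\<^sub>R v)) \<partial>lborel)"
        have "E r x \<le> (\<integral>\<^sup>+v. ennreal (real ?n * r) * (indicator (cube r) v * ?I v) \<partial>lborel)"
          unfolding E_def
        proof (rule nn_integral_mono_AE)
          show "AE v in lborel. indicator (cube r) v * ennreal (rem x v) \<le>
            ennreal (real ?n * r) * (indicator (cube r) v * ?I v)"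
            using elim(1)
          proof eventually_elim
            case (elim v)
            show ?case
            proof (cases "v \<in> cube r")
              case True
              then have nv: "norm v \<le> real ?n * r" using norm_cube_le[of v r] by simp
              also have "\<dots> < R" using r d'(3) by (smt (verit) mult_strict_left_mono of_nat_0_less_iff zero_less_card_finite)
              finally have "ennreal (rem x v) \<le> ennreal (norm v) * ?I v"
                using elim \<open>x \<in> V\<close> by blast
              also have "\<dots> \<le> ennreal (real ?n * r) * ?I v"
                by (intro mult_right_mono ennreal_leI nv) auto
              finally show ?thesis using True by simp
            qed simp
          qed
        qed
        also have "\<dots> = ennreal (real ?n * r) * (\<integral>\<^sup>+v. indicator (cube r) v * ?I v \<partial>lborel)"
          unfolding osc_def by (rule nn_integral_cmult) measurable
        also have "(\<integral>\<^sup>+v. indicator (cube r) v * ?I v \<partial>lborel) =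
           (\<integral>\<^sup>+v. (\<integral>\<^sup>+s. indicator (cube r) v * (indicator {0..1} s * ennreal (osc x (s *\<^sub>R v))) \<partial>lborel) \<partial>lborel)"
          by (intro nn_integral_cong nn_integral_cmult[symmetric]) measurable
        also have "\<dots> = (\<integral>\<^sup>+s. (\<integral>\<^sup>+v. indicator (cube r) v * (indicator {0..1} s * ennreal (osc x (s *\<^sub>R v))) \<partial>lborel) \<partial>lborel)"
          unfolding osc_def by (rule lborel_pair.Fubini'[symmetric]) measurable
        \<comment> \<open>Substituting \<open>w = s *\<^sub>R v\<close> turns the inner integral
          into \<open>M (s * r) x\<close> divided by \<open>s ^ ?n\<close>, and the Lebesgue point
          bound at scale \<open>s * r\<close> carries the same power of \<open>s\<close>. The value
          \<open>s = 0\<close> is a null set.\<close>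
        also have "\<dots> \<le> (\<integral>\<^sup>+s. indicator {0..1::real} s * ennreal (e * r ^ ?n) \<partial>lborel)"
        proof (rule nn_integral_mono_AE)
          have "AE s in lborel. s \<noteq> (0::real)" by (rule AE_lborel_singleton)
          then show "AE s in lborel. (\<integral>\<^sup>+v. indicator (cube r) v * (indicator {0..1} s * ennreal (osc x (s *\<^sub>R v))) \<partial>lborel)
            \<le> indicator {0..1::real} s * ennreal (e * r ^ ?n)"
          proof eventually_elim
            case (elim s)
            show ?case
            proof (cases "s \<in> {0..1}")
              case True
              with elim have s: "0 < s" "s \<le> 1" by auto
              let ?J = "(\<integral>\<^sup>+v. indicator (cube r) v * ennreal (osc x (s *\<^sub>R v)) \<partial>lborel)"
              have "ennreal (s ^ ?n) * ?J =
                ennreal (s ^ ?n) * (\<integral>\<^sup>+v. indicator (cube (s * r)) (s *\<^sub>R v) * ennreal (osc x (s *\<^sub>R v)) \<partial>lborel)"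
              proof -
                have "s *\<^sub>R v \<in> cube (s * r) \<longleftrightarrow> v \<in> cube r" for v :: "real^'n"
                  using s by (simp add: mem_cube zero_le_mult_iff)
                then have "indicator (cube (s * r)) (s *\<^sub>R v) = (indicator (cube r) v :: ennreal)" for v :: "real^'n"
                  by (simp only: indicator_def)
                then show ?thesis by simp
              qed
              also have "\<dots> = M (s * r) x"
                unfolding M_def using s(1)
                by (subst nn_integral_lborel_scale[OF _ s(1), of "\<lambda>w. indicator (cube (s * r)) w * ennreal (osc x w)"]) auto
              also have "\<dots> \<le> ennreal (e * (s * r) ^ ?n)"
                using s r d'(2) by (intro d(2)) (auto intro: le_less_trans[OF mult_left_le_one_le])
              also have "\<dots> = ennreal (s ^ ?n) * ennreal (e * r ^ ?n)"
                using s r \<open>e > 0\<close> by (subst ennreal_mult[symmetric]) (auto simp: power_mult_distrib mult_ac)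
              finally have "?J \<le> ennreal (e * r ^ ?n)"
                using s by (subst (asm) ennreal_mult_le_mult_iff) auto
              then show ?thesis using True by simp
            qed simp
          qed
        qed
        also have "\<dots> = ennreal (e * r ^ ?n)"
          by (simp add: nn_integral_multc)
        finally show ?thesis
          using r \<open>e > 0\<close> by (simp add: ennreal_mult'[symmetric] mult_left_mono)
      qed
      with d d' show "\<exists>d>0. \<forall>r. 0 < r \<and> r < d \<longrightarrow>
          M r x \<le> ennreal (e * r ^ ?n) \<and> E r x \<le> ennreal (real ?n * r * (e * r ^ ?n))"
        by (intro exI[of _ d']) auto
    qed
  qed
  \<comment> \<open>The two mean errors at a dyadic scale \<open>r\<close>, each divided by its
    natural order: \<open>r ^ Suc ?n\<close> for the increments and \<open>r ^ ?n\<close> for the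
    gradient.\<close>
  define e where "e m x = ennreal (1 / ((1/2) ^ m) ^ Suc ?n) * E ((1/2) ^ m) x + ennreal (1 / ((1/2) ^ m) ^ ?n) * M ((1/2) ^ m) x"
    for m :: nat and x
  have [measurable]: "e m \<in> borel_measurable lborel" for m
    unfolding e_def by measurable
  have lim: "AE x in lborel. x \<in> V \<longrightarrow> (\<forall>i. \<forall>\<^sub>F m in sequentially. e m x < ennreal (1 / Suc i))"
    using points
  proof eventually_elim
    case (elim x)
    show ?case
    proof (intro impI allI)
      fix i assume "x \<in> V"
      \<comment> \<open>Errors at level \<open>c\<close> add up to \<open>(?n + 1) * c\<close>,
        which is half of \<open>1 / Suc i\<close>; the half makes the inequality strict.\<close>
      define c where "c = 1 / (real (Suc i) * (2 * (real ?n + 1)))"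
      have "c > 0" by (simp add: c_def)
      with elim \<open>x \<in> V\<close> obtain d where d: "d > 0" "\<And>r. 0 < r \<Longrightarrow> r < d \<Longrightarrow> M r x \<le> ennreal (c * r ^ ?n)"
        "\<And>r. 0 < r \<Longrightarrow> r < d \<Longrightarrow> E r x \<le> ennreal (real ?n * r * (c * r ^ ?n))" by blast
      have "(\<lambda>m. (1/2::real) ^ m) \<longlonglongrightarrow> 0" by (intro LIMSEQ_power_zero) auto
      then have "\<forall>\<^sub>F m in sequentially. (1/2::real) ^ m < d"
        using d(1) by (rule order_tendstoD(2))
      then show "\<forall>\<^sub>F m in sequentially. e m x < ennreal (1 / Suc i)"
      proof eventually_elim
        case (elim m)
        define r :: real where "r = (1/2) ^ m"
        have r: "0 < r" "r < d" using elim by (auto simp: r_def)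
        have "e m x \<le> ennreal (1 / r ^ Suc ?n) * ennreal (real ?n * r * (c * r ^ ?n)) + ennreal (1 / r ^ ?n) * ennreal (c * r ^ ?n)"
          unfolding e_def r_def[symmetric]
          by (intro add_mono mult_left_mono d r) auto
        also have "\<dots> = ennreal (real ?n * c + c)"
          using r \<open>c > 0\<close> by (simp add: ennreal_mult'[symmetric] field_simps)
        also have "\<dots> < ennreal (1 / Suc i)"
        proof (rule ennreal_lessI)
          have "real ?n * c + c = (real ?n + 1) * c" by (simp add: algebra_simps)
          also have "\<dots> = 1 / (2 * real (Suc i))" unfolding c_def by (simp add: divide_simps) (simp add: algebra_simps)
          also have "\<dots> < 1 / Suc i" by (simp add: field_simps)
          finally show "real ?n * c + c < 1 / Suc i" .
        qed simp
        finally show ?case .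
      qed
    qed
  qed
  have "V \<in> sets lborel" "\<And>m. e m \<in> borel_measurable lborel" using V(1) by auto
  from egorov[OF this(1) V(2) this(2) lim] obtain T :: "nat \<Rightarrow> (real^'n) set" where
    T': "(\<forall>k. T k \<in> sets lborel \<and> T k \<subseteq> V) \<and>
      (\<forall>k i. \<exists>N. \<forall>n\<ge>N. \<forall>x\<in>T k. e n x < ennreal (1 / Suc i)) \<and>
      V - (\<Union>k. T k) \<in> null_sets lborel" ..
  then have T: "T k \<in> sets lborel" "T k \<subseteq> V" and null: "V - (\<Union>k. T k) \<in> null_sets lborel" for k
    by blast+
  have unif: "\<exists>N. \<forall>n\<ge>N. \<forall>x\<in>T k. e n x < ennreal (1 / Suc i)" for k i
    using T' by blast
  have pair: "ennreal (norm (f y - f x - G x *v (y - x))) * ennreal ((r/2) ^ ?n) \<le>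
      E r x + E r y + ennreal (real ?n * r) * (M r x + M r y)" if r: "0 < r" "norm (y - x) \<le> r / 2" for x y r
  proof -
    let ?a = "norm (f y - f x - G x *v (y - x))"
    \<comment> \<open>The componentwise maximum is the corner of a cube of side \<open>r / 2\<close>
      that lies in the corner cubes of side \<open>r\<close> at both \<open>x\<close> and
      \<open>y\<close>.\<close>
    define p :: "real^'n" where "p = (\<chi> i. max (x $ i) (y $ i))"
    let ?C = "cbox p (p + (r/2) *\<^sub>R One)"
    have comp: "\<bar>y $ i - x $ i\<bar> \<le> r / 2" for i
      using component_le_norm_cart[of "y - x" i] r(2) by simp
    have C: "z - x \<in> cube r" "z - y \<in> cube r" if "z \<in> ?C" for z
    proof -
      have pz: "p $ i \<le> z $ i \<and> z $ i \<le> p $ i + r / 2" for i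
        using that by (simp add: mem_box_cart One_nth_cart del: sum_component)
      have "0 \<le> (z - x) $ i \<and> (z - x) $ i \<le> r \<and> 0 \<le> (z - y) $ i \<and> (z - y) $ i \<le> r" for i
      proof -
        have "x $ i \<le> z $ i" "y $ i \<le> z $ i" "z $ i \<le> max (x $ i) (y $ i) + r / 2"
          using pz[of i] by (simp_all add: p_def)
        moreover have "y $ i - x $ i \<le> r / 2" "x $ i - y $ i \<le> r / 2"
          using comp[of i] by linarith+
        ultimately show ?thesis by (cases "x $ i \<le> y $ i") auto
      qed
      then show "z - x \<in> cube r" "z - y \<in> cube r"
        by (simp_all add: mem_box_cart One_nth_cart del: sum_component)
    qed
    have "ennreal ?a * ennreal ((r/2) ^ ?n) = (\<integral>\<^sup>+z. ennreal ?a * indicator ?C z \<partial>lborel)"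
      using r by (subst nn_integral_cmult_indicator) (auto simp: emeasure_cube)
    also have "\<dots> \<le> (\<integral>\<^sup>+z. (indicator (cube r) (- x + z) * ennreal (rem x (- x + z)) + indicator (cube r) (- y + z) * ennreal (rem y (- y + z))) +
       ennreal (real ?n * r) * (indicator (cube r) (- x + z) * ennreal (osc x (- x + z)) + indicator (cube r) (- y + z) * ennreal (osc y (- y + z))) \<partial>lborel)"
    proof (rule nn_integral_mono)
      fix z
      show "ennreal ?a * indicator ?C z \<le> (indicator (cube r) (- x + z) * ennreal (rem x (- x + z)) + indicator (cube r) (- y + z) * ennreal (rem y (- y + z))) +
       ennreal (real ?n * r) * (indicator (cube r) (- x + z) * ennreal (osc x (- x + z)) + indicator (cube r) (- y + z) * ennreal (osc y (- y + z)))"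
      proof (cases "z \<in> ?C")
        case True
        \<comment> \<open>Both expansions end at the common point \<open>z\<close>. The mismatch of
          the two gradients, compared through \<open>G z\<close>, costs only the oscillations at
          \<open>x\<close> and at \<open>y\<close>.\<close>
        have eq: "f y - f x - G x *v (y - x) = (f z - f x - G x *v (z - x)) - (f z - f y - G y *v (z - y))
            + (G x - G y) *v (z - y)"
          by (simp add: matrix_vector_mult_diff_rdistrib matrix_vector_mult_diff_distrib)
        have "norm (a - b + c) \<le> norm a + norm b + norm c" for a b c :: "real^'m"
          by norm
        from this[of "f z - f x - G x *v (z - x)" "f z - f y - G y *v (z - y)" "(G x - G y) *v (z - y)"]
        have "?a \<le> rem x (z - x) + rem y (z - y) + norm ((G x - G y) *v (z - y))"
          unfolding eq[symmetric] by (simp add: rem_def)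
        also have "norm ((G x - G y) *v (z - y)) \<le> norm (G x - G y) * norm (z - y)"
          by (rule norm_matrix_vector_mult_le)
        also have "\<dots> \<le> (osc x (z - x) + osc y (z - y)) * (real ?n * r)"
        proof (rule mult_mono)
          show "norm (G x - G y) \<le> osc x (z - x) + osc y (z - y)"
            unfolding osc_def by (simp, norm)
          show "norm (z - y) \<le> real ?n * r"
            using norm_cube_le[OF C(2)[OF True]] by simp
        qed (auto simp: osc_def)
        finally have "?a \<le> (rem x (z - x) + rem y (z - y)) + real ?n * r * (osc x (z - x) + osc y (z - y))"
          by (simp add: mult.commute)
        then have "ennreal ?a \<le> ennreal ((rem x (z - x) + rem y (z - y)) + real ?n * r * (osc x (z - x) + osc y (z - y)))"
          by (rule ennreal_leI)
        also have "\<dots> = (ennreal (rem x (z - x)) + ennreal (rem y (z - y))) + ennreal (real ?n * r) * (ennreal (osc x (z - x)) + ennreal (osc y (z - y)))"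
          using r by (simp add: rem_def osc_def ennreal_mult')
        finally show ?thesis using True C[OF True] by simp
      qed simp
    qed
    also have "\<dots> = (\<integral>\<^sup>+z. indicator (cube r) (- x + z) * ennreal (rem x (- x + z)) \<partial>lborel) + (\<integral>\<^sup>+z. indicator (cube r) (- y + z) * ennreal (rem y (- y + z)) \<partial>lborel)
       + ennreal (real ?n * r) * ((\<integral>\<^sup>+z. indicator (cube r) (- x + z) * ennreal (osc x (- x + z)) \<partial>lborel) + (\<integral>\<^sup>+z. indicator (cube r) (- y + z) * ennreal (osc y (- y + z)) \<partial>lborel))"
      by (simp add: nn_integral_add nn_integral_cmult)
    also have "\<dots> = E r x + E r y + ennreal (real ?n * r) * (M r x + M r y)"
      unfolding E_def M_def
      by (subst (1 2 3 4) nn_integral_lborel_translate[of "\<lambda>z. indicator (cube r) z * ennreal (_ z)"]) auto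
    finally show ?thesis .
  qed
  have deriv: "(f has_derivative (*v) (G x)) (at x within T k)" if x: "x \<in> T k" for k x
    unfolding has_derivative_within_alt
  proof (intro conjI allI impI)
    show "bounded_linear ((*v) (G x))" by simp
    fix c :: real assume "c > 0"
    \<comment> \<open>\<open>2 ^ ?n\<close> comes from the cube of half the side,
      \<open>2 * (?n + 1)\<close> from the errors at \<open>x\<close> and \<open>y\<close>, and 4
      from \<open>r < 4 * norm (y - x)\<close>.\<close>
    define K where "K = 2 ^ ?n * (8 * (real ?n + 1))"
    have "K > 0" by (simp add: K_def add_pos_pos)
    obtain i where i: "K / c < real (Suc i)"
      using reals_Archimedean2 by (metis less_trans of_nat_less_iff lessI)
    obtain N where N: "\<And>m x. m \<ge> N \<Longrightarrow> x \<in> T k \<Longrightarrow> e m x < ennreal (1 / Suc i)"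
      using unif by metis
    show "\<exists>d>0. \<forall>y\<in>T k. norm (y - x) < d \<longrightarrow> norm (f y - f x - G x *v (y - x)) \<le> c * norm (y - x)"
    proof (intro exI[of _ "(1/2) ^ N / 2"] conjI ballI impI)
      fix y assume y: "y \<in> T k" "norm (y - x) < (1/2) ^ N / 2"
      show "norm (f y - f x - G x *v (y - x)) \<le> c * norm (y - x)"
      proof (cases "y = x")
        case False
        then obtain m where m: "m \<ge> N" "2 * norm (y - x) \<le> (1/2) ^ m" "(1/2) ^ m < 2 * (2 * norm (y - x))"
          using ex_half_power_between[of "2 * norm (y - x)" N] y(2) by auto
        define r :: real where "r = (1/2) ^ m"
        have r: "r > 0" "norm (y - x) \<le> r / 2" "r < 4 * norm (y - x)"
          using m by (auto simp: r_def)
        have bounds: "E r u \<le> ennreal (r ^ Suc ?n / Suc i)" "M r u \<le> ennreal (r ^ ?n / Suc i)"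
          if "u \<in> T k" for u
        proof -
          have le: "ennreal (1 / r ^ Suc ?n) * E r u + ennreal (1 / r ^ ?n) * M r u \<le> ennreal (1 / Suc i)"
            using less_imp_le[OF N[OF m(1) that]] by (simp add: e_def r_def)
          have "ennreal (1 / r ^ Suc ?n) * E r u \<le> ennreal (1 / Suc i)"
            by (rule order_trans[OF _ le]) simp
          then have "ennreal (r ^ Suc ?n) * (ennreal (1 / r ^ Suc ?n) * E r u) \<le> ennreal (r ^ Suc ?n) * ennreal (1 / Suc i)"
            by (rule mult_left_mono) simp
          then show "E r u \<le> ennreal (r ^ Suc ?n / Suc i)"
            using r(1) by (simp add: mult.assoc[symmetric] ennreal_mult'[symmetric])
          have "ennreal (1 / r ^ ?n) * M r u \<le> ennreal (1 / Suc i)"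
            by (rule order_trans[OF _ le]) simp
          then have "ennreal (r ^ ?n) * (ennreal (1 / r ^ ?n) * M r u) \<le> ennreal (r ^ ?n) * ennreal (1 / Suc i)"
            by (rule mult_left_mono) simp
          then show "M r u \<le> ennreal (r ^ ?n / Suc i)"
            using r(1) by (simp add: mult.assoc[symmetric] ennreal_mult'[symmetric])
        qed
        let ?a = "norm (f y - f x - G x *v (y - x))"
        have "ennreal (?a * (r/2) ^ ?n) = ennreal ?a * ennreal ((r/2) ^ ?n)"
          using r by (simp add: ennreal_mult')
        also have "\<dots> \<le> E r x + E r y + ennreal (real ?n * r) * (M r x + M r y)"
          by (rule pair[OF r(1,2)])
        also have "\<dots> \<le> ennreal (r ^ Suc ?n / Suc i) + ennreal (r ^ Suc ?n / Suc i) +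
            ennreal (real ?n * r) * (ennreal (r ^ ?n / Suc i) + ennreal (r ^ ?n / Suc i))"
          by (intro add_mono mult_left_mono bounds x y(1)) auto
        also have "\<dots> = ennreal (2 * (real ?n + 1) * r ^ Suc ?n / Suc i)"
        proof -
          have "2 * (real ?n + 1) * r ^ Suc ?n / Suc i = (r ^ Suc ?n / Suc i + r ^ Suc ?n / Suc i) + (real ?n * r) * (r ^ ?n / Suc i + r ^ ?n / Suc i)"
            by (simp add: add_divide_distrib algebra_simps)
          moreover have "ennreal u + ennreal u + ennreal v * (ennreal w + ennreal w) = ennreal (u + u + v * (w + w))"
            if "0 \<le> u" "0 \<le> v" "0 \<le> w" for u v w
            using that by (simp only: ennreal_plus ennreal_mult add_nonneg_nonneg mult_nonneg_nonneg)
          ultimately show ?thesis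
            using r(1) by (simp only: of_nat_0_le_iff zero_le_power less_imp_le divide_nonneg_nonneg mult_nonneg_nonneg)
        qed
        finally have "?a * (r/2) ^ ?n \<le> 2 * (real ?n + 1) * r ^ Suc ?n / Suc i"
          using r(1) by (subst (asm) ennreal_le_iff) auto
        then have "?a * r ^ ?n \<le> (2 ^ ?n * (2 * (real ?n + 1)) * r / Suc i) * r ^ ?n"
          by (simp add: power_divide field_simps)
        then have "?a \<le> 2 ^ ?n * (2 * (real ?n + 1)) * r / Suc i"
          using r(1) by (subst (asm) mult_le_cancel_right) auto
        also have "\<dots> \<le> 2 ^ ?n * (2 * (real ?n + 1)) * (4 * norm (y - x)) / Suc i"
          using r(3) by (intro divide_right_mono mult_left_mono) auto
        also have "\<dots> = K / Suc i * norm (y - x)"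
          by (simp add: K_def)
        also have "\<dots> \<le> c * norm (y - x)"
        proof (rule mult_right_mono)
          show "K / Suc i \<le> c" using i \<open>c > 0\<close> by (simp add: field_simps)
        qed simp
        finally show ?thesis .
      qed simp
    qed simp
  qed
  show thesis
  proof (rule that[of T])
    have "V - (\<Union>k. T k) \<in> null_sets lebesgue"
      using null by (rule null_sets_completionI)
    then show "negligible (V - (\<Union>k. T k))"
      by (simp add: negligible_iff_null_sets)
  qed (use T deriv in auto)
qed

section \<open>The area inequality\<close>

typedef 'n wo = "UNIV :: 'n set" morphisms of_wo to_wo by simp

lemma of_wo_simps [simp]: "of_wo (to_wo x) = x" "to_wo (of_wo y) = y"
  by (simp_all add: to_wo_inverse of_wo_inverse)

lemma bij_of_wo: "bij of_wo"
  by (rule bij_betw_byWitness[where f'=to_wo]) auto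

instance wo :: (finite) finite
proof
  have "(UNIV :: 'a wo set) = to_wo ` UNIV"
    by (metis UNIV_eq_I of_wo_simps(2) rangeI)
  then show "finite (UNIV :: 'a wo set)" by (metis finite finite_imageI)
qed

text \<open>Substitution is applied below to vectors with a well-ordered index type. A finite type
  has no canonical order, so its copy is ordered through an arbitrary injection into the
  naturals.\<close>

definition wo_rank :: "'n::finite wo \<Rightarrow> nat" where
  "wo_rank x = (SOME g. inj g) (of_wo x)"

lemma inj_wo_rank: "inj (wo_rank :: 'n::finite wo \<Rightarrow> nat)"
proof -
  obtain g :: "'n \<Rightarrow> nat" where "inj g"
    using finite_imp_inj_to_nat_seg[of "UNIV :: 'n set"] by auto
  then have "inj (SOME g. inj (g :: 'n \<Rightarrow> nat))" by (rule someI[of inj])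
  moreover have "inj (of_wo :: 'n wo \<Rightarrow> 'n)"
    using bij_of_wo by (rule bij_is_inj)
  ultimately have "inj ((SOME g. inj (g :: 'n \<Rightarrow> nat)) \<circ> of_wo)"
    by (rule inj_compose)
  moreover have "wo_rank = (SOME g. inj (g :: 'n \<Rightarrow> nat)) \<circ> of_wo"
    by (simp add: fun_eq_iff wo_rank_def)
  ultimately show ?thesis by simp
qed

instantiation wo :: (finite) wellorder
begin

definition less_eq_wo :: "'a wo \<Rightarrow> 'a wo \<Rightarrow> bool" where
  "less_eq_wo x y \<longleftrightarrow> wo_rank x \<le> wo_rank y"

definition less_wo :: "'a wo \<Rightarrow> 'a wo \<Rightarrow> bool" where
  "less_wo x y \<longleftrightarrow> wo_rank x < wo_rank y"

instance
proof
  fix x y :: "'a wo"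
  show "x \<le> y \<Longrightarrow> y \<le> x \<Longrightarrow> x = y"
    using inj_wo_rank by (auto simp: less_eq_wo_def inj_def)
  fix P :: "'a wo \<Rightarrow> bool" and a :: "'a wo"
  assume step: "\<And>x. (\<And>y. y < x \<Longrightarrow> P y) \<Longrightarrow> P x"
  show "P a"
    by (rule measure_induct_rule[of wo_rank P a]) (rule step, simp add: less_wo_def)
qed (auto simp: less_eq_wo_def less_wo_def)

end

definition reindex_wo :: "real^'n \<Rightarrow> real^('n::finite wo)" where
  "reindex_wo x = (\<chi> i. x $ of_wo i)"

definition unindex_wo :: "real^('n::finite wo) \<Rightarrow> real^'n" where
  "unindex_wo y = (\<chi> i. y $ to_wo i)"

lemma reindex_unindex [simp]: "reindex_wo (unindex_wo y) = y" "unindex_wo (reindex_wo x) = x"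
  by (simp_all add: reindex_wo_def unindex_wo_def vec_eq_iff)

lemma linear_reindex: "linear reindex_wo" "linear unindex_wo"
  by (auto simp: linear_iff reindex_wo_def unindex_wo_def vec_eq_iff)

lemma bounded_linear_reindex: "bounded_linear reindex_wo" "bounded_linear unindex_wo"
  using linear_reindex by (simp_all add: linear_conv_bounded_linear)

lemma reindex_image: "reindex_wo ` A = unindex_wo -` A"
  by (auto simp: image_iff) (metis reindex_unindex(1))

lemma borel_measurable_unindex: "unindex_wo \<in> borel_measurable borel"
  by (intro borel_measurable_continuous_onI linear_continuous_on bounded_linear_reindex)

lemma prod_Basis_cart: "(\<Prod>b\<in>Basis. x \<bullet> b) = (\<Prod>i\<in>UNIV. x $ i)" for x :: "real^'n"
proof -
  have eq: "(Basis :: (real^'n) set) = range (\<lambda>i. axis i 1)"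
    by (auto simp: Basis_vec_def)
  have "inj (\<lambda>i::'n. axis i (1::real))"
    by (auto simp: inj_def axis_eq_axis)
  then show ?thesis
    unfolding eq by (subst prod.reindex) (auto simp: inner_axis)
qed

text \<open>Relabelling coordinates permutes the side lengths of a box, and Lebesgue measure is
  determined by the volumes of boxes.\<close>

lemma distr_unindex: "distr lborel borel unindex_wo = (lborel :: (real^'n) measure)"
proof (rule lborel_eqI[symmetric])
  fix l u :: "real^'n" assume le: "\<And>b. b \<in> Basis \<Longrightarrow> l \<bullet> b \<le> u \<bullet> b"
  then have le': "l $ i \<le> u $ i" for i
    by (simp add: cart_eq_inner_axis axis_in_Basis_iff)
  have "unindex_wo -` box l u = box (reindex_wo l) (reindex_wo u)"
    by (auto simp: mem_box_cart reindex_wo_def unindex_wo_def) (metis of_wo_simps)+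
  then have "emeasure (distr lborel borel unindex_wo) (box l u) = emeasure lborel (box (reindex_wo l) (reindex_wo u))"
    by (simp add: emeasure_distr borel_measurable_unindex)
  also have "\<dots> = (\<Prod>b\<in>Basis. (reindex_wo u - reindex_wo l) \<bullet> b)"
    using le' by (subst emeasure_lborel_box) (auto simp: Basis_vec_def inner_axis reindex_wo_def)
  also have "(\<Prod>b\<in>Basis. (reindex_wo u - reindex_wo l) \<bullet> b) = (\<Prod>i\<in>UNIV. (u - l) $ of_wo i)"
    unfolding prod_Basis_cart by (simp add: reindex_wo_def)
  also have "\<dots> = (\<Prod>b\<in>Basis. (u - l) \<bullet> b)"
    unfolding prod_Basis_cart using bij_of_wo by (rule prod.reindex_bij_betw)
  finally show "emeasure (distr lborel borel unindex_wo) (box l u) = (\<Prod>b\<in>Basis. (u - l) \<bullet> b)" .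
qed simp

text \<open>A Lebesgue set is a Borel set together with a part of a Borel null set; the relabelling
  preserves the measure of the first piece and the nullity of the second.\<close>

lemma reindex_lebesgue:
  fixes A :: "(real^'n) set"
  assumes "A \<in> sets lebesgue"
  shows "reindex_wo ` A \<in> sets lebesgue"
    and "emeasure lebesgue (reindex_wo ` A) = emeasure lebesgue A"
proof -
  have vim: "unindex_wo -` B \<in> sets lborel" "emeasure lborel (unindex_wo -` B) = emeasure lborel B"
    if "B \<in> sets lborel" for B :: "(real^'n) set"
  proof -
    show "unindex_wo -` B \<in> sets lborel"
      using measurable_sets[OF borel_measurable_unindex, of B] that by simp
    show "emeasure lborel (unindex_wo -` B) = emeasure lborel B"
    proof -
      have "emeasure (distr lborel borel unindex_wo) B = emeasure lborel (unindex_wo -` B \<inter> space lborel)"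
        by (rule emeasure_distr) (use that borel_measurable_unindex in auto)
      then show ?thesis by (simp add: distr_unindex)
    qed
  qed
  obtain B N N' where A: "A = B \<union> N" "N \<subseteq> N'" "N' \<in> null_sets lborel" "B \<in> sets lborel"
    by (rule sets_completionE[OF assms])
  have N': "unindex_wo -` N' \<in> null_sets lborel"
    using vim[of N'] A(3) by (auto simp: null_sets_def)
  have img: "reindex_wo ` A = unindex_wo -` B \<union> unindex_wo -` N"
    by (simp add: reindex_image A(1) vimage_Un)
  have "unindex_wo -` N \<subseteq> unindex_wo -` N'" using A(2) by auto
  with N' have N0: "unindex_wo -` N \<in> null_sets lebesgue"
    by (meson null_sets_completion_subset null_sets_completionI)
  have N1: "N \<in> null_sets lebesgue"
    using A(2,3) by (meson null_sets_completion_subset null_sets_completionI)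
  show "reindex_wo ` A \<in> sets lebesgue"
    unfolding img using vim(1)[OF A(4)] N0 by (intro sets.Un) (auto intro: sets_completionI_sets)
  have "emeasure lebesgue (reindex_wo ` A) = emeasure lebesgue (unindex_wo -` B)"
    unfolding img by (rule emeasure_Un_null_set) (use vim(1)[OF A(4)] N0 in \<open>auto intro: sets_completionI_sets\<close>)
  also have "\<dots> = emeasure lebesgue B"
    using vim[OF A(4)] A(4) by simp
  also have "\<dots> = emeasure lebesgue A"
    unfolding A(1) by (rule emeasure_Un_null_set[symmetric]) (use A(4) N1 in \<open>auto intro: sets_completionI_sets\<close>)
  finally show "emeasure lebesgue (reindex_wo ` A) = emeasure lebesgue A" .
qed

text \<open>Conjugation by a bijection turns transpositions into transpositions, so a factorisation
  of \<open>p\<close> carries over with the same length.\<close>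

lemma sign_reindex:
  fixes p :: "'n::finite \<Rightarrow> 'n"
  assumes "p permutes UNIV"
  shows "sign (to_wo \<circ> p \<circ> of_wo) = sign p"
proof -
  have seq: "swapidseq m p \<Longrightarrow> swapidseq m (to_wo \<circ> p \<circ> of_wo)" for m and p :: "'n \<Rightarrow> 'n"
  proof (induction rule: swapidseq.induct)
    case id
    have "to_wo \<circ> id \<circ> of_wo = (id :: 'n wo \<Rightarrow> 'n wo)" by (auto simp: fun_eq_iff)
    then show ?case by (metis swapidseq.id)
  next
    case (comp_Suc m p a b)
    have "to_wo \<circ> (Transposition.transpose a b \<circ> p) \<circ> of_wo = Transposition.transpose (to_wo a) (to_wo b) \<circ> (to_wo \<circ> p \<circ> of_wo)"
      by (auto simp: fun_eq_iff Transposition.transpose_def) (metis of_wo_simps(1))+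
    moreover have "to_wo a \<noteq> to_wo b"
      using comp_Suc.hyps by (metis of_wo_simps(1))
    ultimately show ?case
      using comp_Suc.IH by (metis swapidseq.comp_Suc)
  qed
  have "permutation p" using assms by (simp add: permutation_permutes) blast
  then obtain m where m: "swapidseq m p" by (auto simp: permutation_def)
  have "evenperm p = even m" using m by (rule evenperm_unique) simp
  moreover have "evenperm (to_wo \<circ> p \<circ> of_wo) = even m"
    using seq[OF m] by (rule evenperm_unique) simp
  ultimately show ?thesis by (simp add: sign_def)
qed

text \<open>Conjugation by the relabelling is a bijection between the index sets of the two Leibniz
  sums and preserves every summand.\<close>

lemma det_reindex:
  fixes A :: "real^'n^'n"
  shows "det (\<chi> i j. A $ of_wo i $ of_wo j :: real^('n wo)^('n wo)) = det A"
proof -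
  let ?h = "\<lambda>p :: 'n \<Rightarrow> 'n. to_wo \<circ> p \<circ> of_wo"
  have "bij_betw ?h {p. p permutes UNIV} {p. p permutes (UNIV :: 'n wo set)}"
  proof (rule bij_betw_byWitness[where f'="\<lambda>q. of_wo \<circ> q \<circ> to_wo"])
    have bt: "bij (to_wo :: 'n \<Rightarrow> 'n wo)"
      by (rule bij_betw_byWitness[where f'=of_wo]) auto
    have pb: "p permutes UNIV \<longleftrightarrow> bij p" for p :: "'z \<Rightarrow> 'z"
      by (auto intro: bij_imp_permutes permutes_bij)
    show "?h ` {p. p permutes UNIV} \<subseteq> {p. p permutes UNIV}"
      using bij_of_wo bt by (auto simp: pb intro!: bij_comp)
    show "(\<lambda>q. of_wo \<circ> q \<circ> to_wo) ` {p. p permutes UNIV} \<subseteq> {p. p permutes (UNIV :: 'n set)}"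
      using bij_of_wo bt by (auto simp: pb intro!: bij_comp)
  qed (auto simp: fun_eq_iff)
  then have "det (\<chi> i j. A $ of_wo i $ of_wo j :: real^('n wo)^('n wo)) =
      (\<Sum>p | p permutes UNIV. of_int (sign (?h p)) * (\<Prod>i\<in>UNIV. A $ of_wo i $ of_wo (?h p i)))"
    unfolding det_def by (subst sum.reindex_bij_betw[symmetric]) auto
  also have "\<dots> = (\<Sum>p | p permutes UNIV. of_int (sign p) * (\<Prod>i\<in>UNIV. A $ i $ p i))"
  proof (rule sum.cong[OF refl])
    fix p :: "'n \<Rightarrow> 'n" assume "p \<in> {p. p permutes UNIV}"
    then have "sign (?h p) = sign p" by (simp add: sign_reindex)
    moreover have "(\<Prod>i\<in>UNIV. A $ of_wo i $ of_wo (?h p i)) = (\<Prod>i\<in>UNIV. A $ i $ p i)"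
      using prod.reindex_bij_betw[OF bij_of_wo, of "\<lambda>i. A $ i $ p i"] by simp
    ultimately show "of_int (sign (?h p)) * (\<Prod>i\<in>UNIV. A $ of_wo i $ of_wo (?h p i)) =
      of_int (sign p) * (\<Prod>i\<in>UNIV. A $ i $ p i)" by simp
  qed
  finally show ?thesis by (simp add: det_def)
qed

lemma borel_measurable_det [measurable (raw)]:
  fixes A :: "'a \<Rightarrow> real^'n^'n"
  assumes "A \<in> borel_measurable M"
  shows "(\<lambda>x. det (A x)) \<in> borel_measurable M"
proof -
  have "continuous_on UNIV (\<lambda>B :: real^'n^'n. det B)"
    unfolding det_def by (intro continuous_intros)
  from measurable_compose[OF assms borel_measurable_continuous_onI[OF this]] show ?thesis .
qed

text \<open>The change of variables theorem of the library needs a well-ordered index type.\<close>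

lemma measure_image_has_derivative:
  fixes f :: "real^'n \<Rightarrow> real^'n" and A :: "real^'n \<Rightarrow> real^'n^'n"
  assumes S: "S \<in> sets borel" and A: "A \<in> borel_measurable borel"
    and der: "\<And>x. x \<in> S \<Longrightarrow> (f has_derivative (*v) (A x)) (at x within S)"
    and inj: "inj_on f S" and bdd: "bounded (f ` S)"
  shows "f ` S \<in> sets lebesgue"
    and "(\<integral>\<^sup>+x. ennreal \<bar>det (A x)\<bar> * indicator S x \<partial>lborel) = emeasure lebesgue (f ` S)"
proof -
  have S': "S \<in> sets lebesgue" using S by auto
  show fS: "f ` S \<in> sets lebesgue"
    using der S' by (intro differentiable_image_in_sets_lebesgue)
      (auto simp: differentiable_on_def differentiable_def)
  let ?S = "reindex_wo ` S"
  let ?g = "reindex_wo \<circ> f \<circ> unindex_wo"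
  let ?B = "\<lambda>y. (\<chi> i j. A (unindex_wo y) $ of_wo i $ of_wo j) :: real^('n wo)^('n wo)"
  have img: "?g ` ?S = reindex_wo ` (f ` S)"
    by (simp add: image_comp o_def)
  have B: "reindex_wo (A (unindex_wo y) *v unindex_wo h) = ?B y *v h" for y h
  proof -
    have "(\<Sum>j\<in>UNIV. A (unindex_wo y) $ of_wo i $ j * h $ to_wo j) =
       (\<Sum>j\<in>UNIV. A (unindex_wo y) $ of_wo i $ of_wo j * h $ j)" for i
      using sum.reindex_bij_betw[OF bij_of_wo, of "\<lambda>j. A (unindex_wo y) $ of_wo i $ j * h $ to_wo j"] by simp
    then show ?thesis
      by (simp add: vec_eq_iff matrix_vector_mult_def reindex_wo_def unindex_wo_def)
  qed
  have der': "(?g has_derivative (*v) (?B y)) (at y within ?S)" if "y \<in> ?S" for y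
  proof -
    from that have "unindex_wo y \<in> S" by auto
    have im: "unindex_wo ` ?S = S" by (simp add: image_comp o_def)
    have 1: "(unindex_wo has_derivative unindex_wo) (at y within ?S)"
      by (rule bounded_linear_imp_has_derivative[OF bounded_linear_reindex(2)])
    have 2: "(f has_derivative (*v) (A (unindex_wo y))) (at (unindex_wo y) within unindex_wo ` ?S)"
      unfolding im by (rule der) fact
    have 3: "(reindex_wo has_derivative reindex_wo) (at z within R)" for z :: "real^'n" and R
      by (rule bounded_linear_imp_has_derivative[OF bounded_linear_reindex(1)])
    show ?thesis
      using diff_chain_within[OF diff_chain_within[OF 1 2] 3]
      by (simp add: o_def B)
  qed
  have inj': "inj_on ?g ?S"
    using inj by (auto simp: inj_on_def) (metis reindex_unindex(2))+
  have sets': "?S \<in> sets lebesgue" by (rule reindex_lebesgue(1)[OF S'])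
  \<comment> \<open>A bounded image has finite measure, which lets the gauge-integral form of
    substitution be read as an equation of nonnegative integrals.\<close>
  have fin: "f ` S \<in> lmeasurable"
    using fS bdd by (rule bounded_set_imp_lmeasurable[rotated])
  have em: "emeasure lebesgue (?g ` ?S) = emeasure lebesgue (f ` S)"
    unfolding img by (rule reindex_lebesgue(2)[OF fS])
  have "?g ` ?S \<in> lmeasurable"
    unfolding img using reindex_lebesgue[OF fS] fin by (auto simp: fmeasurable_def)
  then have "((\<lambda>y. \<bar>det (matrix ((*v) (?B y)))\<bar>) has_integral measure lebesgue (?g ` ?S)) ?S"
    using has_measure_differentiable_image[OF sets' der' inj'] by blast
  then have "((\<lambda>y. \<bar>det (A (unindex_wo y))\<bar>) has_integral measure lebesgue (f ` S)) ?S"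
    using em by (simp add: det_reindex measure_def)
  then have res: "(\<integral>\<^sup>+y. ennreal \<bar>det (A (unindex_wo y))\<bar> * indicator ?S y \<partial>lborel) = emeasure lebesgue (f ` S)"
    using fin by (subst nn_integral_has_integral_lebesgue') (auto simp: emeasure_eq_measure2)
  note [measurable] = borel_measurable_det[OF A] S borel_measurable_unindex
  have "(\<integral>\<^sup>+x. ennreal \<bar>det (A x)\<bar> * indicator S x \<partial>lborel) =
      (\<integral>\<^sup>+x. ennreal \<bar>det (A x)\<bar> * indicator S x \<partial>distr lborel borel unindex_wo)"
    by (simp add: distr_unindex)
  also have "\<dots> = (\<integral>\<^sup>+y. ennreal \<bar>det (A (unindex_wo y))\<bar> * indicator S (unindex_wo y) \<partial>lborel)"
    by (rule nn_integral_distr) measurable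
  also have "\<dots> = (\<integral>\<^sup>+y. ennreal \<bar>det (A (unindex_wo y))\<bar> * indicator ?S y \<partial>lborel)"
    by (simp add: reindex_image indicator_def)
  finally show "(\<integral>\<^sup>+x. ennreal \<bar>det (A x)\<bar> * indicator S x \<partial>lborel) = emeasure lebesgue (f ` S)"
    using res by simp
qed


lemma area_inequality:
  fixes f :: "real^'n \<Rightarrow> real^'n" and A :: "real^'n \<Rightarrow> real^'n^'n" and T :: "nat \<Rightarrow> (real^'n) set"
  assumes K: "compact K" "continuous_on K f" "inj_on f K"
    and A [measurable]: "A \<in> borel_measurable borel"
    and T: "\<And>k. T k \<in> sets borel" "negligible (K - (\<Union>k. T k))"
    and der: "\<And>k x. x \<in> T k \<Longrightarrow> (f has_derivative (*v) (A x)) (at x within T k)"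
  shows "(\<integral>\<^sup>+x. ennreal \<bar>det (A x)\<bar> * indicator K x \<partial>lborel) \<le> emeasure lborel (f ` K)"
proof -
  \<comment> \<open>The pieces are made disjoint so that overlaps of the sets \<open>T k\<close> are
    not counted twice.\<close>
  define S where "S = disjointed (\<lambda>k. T k \<inter> K)"
  have Kb [measurable]: "K \<in> sets borel" using K(1) by (simp add: borel_compact)
  have S_sub: "S k \<subseteq> T k \<inter> K" for k unfolding S_def by (rule disjointed_subset)
  have Sb [measurable]: "S k \<in> sets borel" for k
    using sets.range_disjointed_sets[of "\<lambda>k. T k \<inter> K" borel] T(1) Kb unfolding S_def by blast
  have disj: "disjoint_family S" unfolding S_def by (rule disjoint_family_disjointed)
  have US: "(\<Union>k. S k) = (\<Union>k. T k) \<inter> K" unfolding S_def by (subst UN_disjointed_eq) auto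
  have fK: "compact (f ` K)" using K by (simp add: compact_continuous_image)
  have img: "f ` S k \<in> sets lebesgue"
    "(\<integral>\<^sup>+x. ennreal \<bar>det (A x)\<bar> * indicator (S k) x \<partial>lborel) = emeasure lebesgue (f ` S k)" for k
  proof -
    have d: "(f has_derivative (*v) (A x)) (at x within S k)" if "x \<in> S k" for x
      using der[of x k] that S_sub[of k] by (meson has_derivative_subset inf.boundedE subsetD)
    have i: "inj_on f (S k)" using K(3) S_sub[of k] by (meson inj_on_subset inf.boundedE)
    have "f ` S k \<subseteq> f ` K" using S_sub[of k] by auto
    then have b: "bounded (f ` S k)" using fK by (meson bounded_subset compact_imp_bounded)
    show "f ` S k \<in> sets lebesgue"
      "(\<integral>\<^sup>+x. ennreal \<bar>det (A x)\<bar> * indicator (S k) x \<partial>lborel) = emeasure lebesgue (f ` S k)"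
      using measure_image_has_derivative[OF Sb A d i b] by auto
  qed
  have "AE x in lebesgue. x \<in> K \<longrightarrow> x \<in> (\<Union>k. S k)"
    unfolding AE_lebesgue_iff_negligible US by (rule negligible_subset[OF T(2)]) auto
  then have "AE x in lborel. x \<in> K \<longrightarrow> x \<in> (\<Union>k. S k)"
    unfolding AE_completion_iff .
  then have "(\<integral>\<^sup>+x. ennreal \<bar>det (A x)\<bar> * indicator K x \<partial>lborel) =
      (\<integral>\<^sup>+x. ennreal \<bar>det (A x)\<bar> * indicator (\<Union>k. S k) x \<partial>lborel)"
  proof (intro nn_integral_cong_AE, eventually_elim)
    case (elim x)
    then have "x \<in> K \<longleftrightarrow> x \<in> (\<Union>k. S k)" using S_sub by auto
    then show ?case by (simp add: indicator_def)
  qed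
  also have "\<dots> = (\<Sum>k. \<integral>\<^sup>+x. ennreal \<bar>det (A x)\<bar> * indicator (S k) x \<partial>lborel)"
    by (rule nn_integral_disjoint_family) (use disj in auto)
  also have "\<dots> = (\<Sum>k. emeasure lebesgue (f ` S k))"
    by (simp add: img(2))
  also have "\<dots> = emeasure lebesgue (\<Union>k. f ` S k)"
  proof (rule suminf_emeasure)
    show "disjoint_family (\<lambda>k. f ` S k)"
      using disj S_sub K(3) unfolding disjoint_family_on_def
      by (metis (no_types, lifting) image_empty inf.boundedE inj_on_image_Int UNIV_I)
  qed (use img(1) in auto)
  also have "\<dots> \<le> emeasure lebesgue (f ` K)"
    using S_sub fK by (intro emeasure_mono) (auto intro: sets_completionI_sets simp: borel_compact)
  also have "\<dots> = emeasure lborel (f ` K)"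
    using fK by (simp add: borel_compact)
  finally show ?thesis .
qed

text \<open>Points of \<open>V\<close> may be moved by less than \<open>r\<close> without leaving
  \<open>U\<close>, where supports of test functions still lie in \<open>D\<close>. The compact set
  \<open>K'\<close> serves to cut the data off to globally integrable functions.\<close>

lemma compact_nested_neighbourhoods:
  fixes K :: "'a::euclidean_space set"
  assumes "compact K" "open D" "K \<subseteq> D"
  obtains r V U K' where "r > 0" "open V" "K \<subseteq> V" "bounded V" "open U" "U \<subseteq> K'" "compact K'" "K' \<subseteq> D"
    "\<And>x v. x \<in> V \<Longrightarrow> norm v < r \<Longrightarrow> x + v \<in> U"
proof -
  obtain e where e: "e > 0" "(\<Union>x\<in>K. cball x e) \<subseteq> D"
    using compact_subset_open_imp_cball_epsilon_subset[OF assms(1-3)] by blast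
  let ?V = "\<Union>x\<in>K. ball x (e/2)" and ?U = "\<Union>x\<in>K. ball x e"
  let ?K' = "{x + y | x y. x \<in> K \<and> y \<in> cball 0 e}"
  have K': "?K' = (\<Union>x\<in>K. cball x e)"
    by (auto simp: dist_norm) (metis add_diff_cancel_left' diff_add_cancel norm_minus_commute add.commute)+
  show thesis
  proof (rule that[of "e/2" ?V ?U ?K'])
    show "compact ?K'" by (rule compact_sums[OF \<open>compact K\<close> compact_cball])
    show "?U \<subseteq> ?K'" "?K' \<subseteq> D" unfolding K' using e(2) by auto
    have "?V \<subseteq> ?K'" unfolding K' using \<open>e > 0\<close> by auto
    then show "bounded ?V" using compact_imp_bounded[OF \<open>compact ?K'\<close>] bounded_subset by blast
    fix x v :: 'a assume "x \<in> ?V" "norm v < e/2"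
    then obtain y where "y \<in> K" "dist y x < e/2" by auto
    then have "dist y (x + v) < e"
      using \<open>norm v < e/2\<close> dist_triangle[of y "x + v" x] by (simp add: dist_norm norm_minus_commute)
    with \<open>y \<in> K\<close> show "x + v \<in> ?U" by auto
  qed (use e in auto)
qed

text \<open>The Fubini arguments run over products of \<open>lborel\<close>, so a gradient that is
  only Lebesgue measurable is first replaced by a Borel function equal to it almost
  everywhere.\<close>

lemma completion_ex_borel_measurable_vec:
  fixes g :: "'a \<Rightarrow> 'b::euclidean_space"
  assumes "g \<in> borel_measurable (completion M)"
  shows "\<exists>g'\<in>borel_measurable M. (AE x in M. g x = g' x)"
proof -
  have "\<exists>h\<in>borel_measurable M. (AE x in M. g x \<bullet> b = h x)" for b
    using assms by (intro completion_ex_borel_measurable_real) auto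
  then obtain h where h: "\<And>b. h b \<in> borel_measurable M" "\<And>b. AE x in M. g x \<bullet> b = h b x" by metis
  have "AE x in M. \<forall>b\<in>Basis. g x \<bullet> b = h b x"
    using h(2) by (intro AE_finite_allI) auto
  then have "AE x in M. g x = (\<Sum>b\<in>Basis. h b x *\<^sub>R b)"
    by eventually_elim (metis (no_types, lifting) euclidean_representation sum.cong)
  moreover have "(\<lambda>x. \<Sum>b\<in>Basis. h b x *\<^sub>R b) \<in> borel_measurable M"
    using h(1) by measurable
  ultimately show ?thesis by (rule bexI)
qed

definition grad :: "('n \<Rightarrow> real^'n \<Rightarrow> real^'m) \<Rightarrow> real^'n \<Rightarrow> real^'n^'m" where
  "grad g x = (\<chi> k i. g i x $ k)"

lemma column_grad [simp]: "column i (grad g x) = g i x"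
  by (simp add: column_def grad_def vec_eq_iff)

lemma integrable_indicator_grad:
  fixes g :: "'n \<Rightarrow> real^'n \<Rightarrow> real^'m"
  assumes "\<And>i. g i absolutely_integrable_on K"
  shows "integrable lebesgue (\<lambda>x. indicator K x *\<^sub>R grad g x)"
proof -
  have gi: "integrable lebesgue (\<lambda>x. indicator K x *\<^sub>R g i x)" for i
    using assms by (simp add: set_integrable_def)
  have eq: "indicator K x *\<^sub>R grad g x = (\<Sum>i\<in>UNIV. \<Sum>k\<in>UNIV. ((indicator K x *\<^sub>R g i x) $ k) *\<^sub>R axis k (axis i 1))" for x
    by (simp add: vec_eq_iff grad_def axis_def if_distrib[of "\<lambda>u. u $ _"] if_distrib[of "\<lambda>u. _ * u"] sum.delta' cong: if_cong)
  show ?thesis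
    unfolding eq
    by (intro Bochner_Integration.integrable_sum integrable_scaleR_left
         integrable_bounded_linear[OF bounded_linear_vec_nth gi])
qed

lemma smooth_gen_partial_outside:
  assumes "closed K" "\<And>x. x \<notin> K \<Longrightarrow> \<phi> x = 0" "x \<notin> K"
  shows "partial_dir \<phi> i x = 0"
proof -
  have "(\<phi> has_derivative (\<lambda>h. 0)) (at x)"
  proof (rule has_derivative_transform_within_open[of "\<lambda>x. 0" _ x UNIV "- K"])
    show "open (- K)" using assms(1) by auto
  qed (use assms in auto)
  then show ?thesis by (simp add: has_derivative_imp_partial_dir(2))
qed

lemma integral_eq_of_support:
  fixes h1 h2 :: "'a::euclidean_space \<Rightarrow> 'b::euclidean_space"
  assumes "\<And>x. x \<notin> K \<Longrightarrow> h1 x = 0" "\<And>x. x \<notin> K \<Longrightarrow> h2 x = 0" "\<And>x. x \<in> K \<Longrightarrow> h1 x = h2 x" "K \<subseteq> D"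
  shows "integral D h1 = integral UNIV h2"
proof -
  have "integral D h1 = integral UNIV (\<lambda>x. if x \<in> D then h1 x else 0)"
    by (simp add: integral_restrict_UNIV)
  also have "(\<lambda>x. if x \<in> D then h1 x else 0) = h2"
  proof
    show "(if x \<in> D then h1 x else 0) = h2 x" for x
      using assms by (cases "x \<in> K") auto
  qed
  finally show ?thesis .
qed

text \<open>Cutting \<open>f\<close> and its gradient off outside \<open>K'\<close> gives integrable
  functions on the whole space. The weak equation survives for test functions supported in
  \<open>U\<close>, and the translation identity on \<open>V\<close> uses no others.\<close>

lemma weak_partial_translation:
  fixes f :: "real^'n \<Rightarrow> real^'m"
  assumes f: "continuous_on D f" and weak: "\<And>i. weak_partial D f i (g i)"
    and V: "open V" and U: "U \<subseteq> K'" "compact K'" "K' \<subseteq> D"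
    and VU: "\<And>x v. x \<in> V \<Longrightarrow> norm v < r \<Longrightarrow> x + v \<in> U"
  obtains f' G where "integrable lborel f'" "integrable lborel G"
    "\<And>x. x \<in> K' \<Longrightarrow> f' x = f x" "AE x in lebesgue. x \<in> K' \<longrightarrow> G x = grad g x"
    "\<And>v. norm v < r \<Longrightarrow> AE x in lborel. x \<in> V \<longrightarrow>
      integrable lborel (\<lambda>s. indicator {0..1} s *\<^sub>R G (x + s *\<^sub>R v)) \<and>
      f' (x + v) - f' x = (LINT s|lborel. indicator {0..1} s *\<^sub>R G (x + s *\<^sub>R v)) *v v"
proof -
  have K'b [measurable]: "K' \<in> sets borel" using U(2) by (simp add: borel_compact)
  define f' where "f' x = indicator K' x *\<^sub>R f x" for x
  have f': "integrable lborel f'"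
    unfolding f'_def using U(2) continuous_on_subset[OF f U(3)] by (rule borel_integrable_compact)
  have gi: "g i absolutely_integrable_on K'" for i
    using weak[of i] U(2,3) by (simp add: weak_partial_def loc_integrable_def)
  have G1: "integrable lebesgue (\<lambda>x. indicator K' x *\<^sub>R grad g x)"
    by (rule integrable_indicator_grad[OF gi])
  note G0 = borel_measurable_integrable[OF G1] G1
  obtain G where Gm: "G \<in> borel_measurable lborel" and GAE: "AE x in lborel. indicator K' x *\<^sub>R grad g x = G x"
    using completion_ex_borel_measurable_vec[OF G0(1)] by auto
  have GAE': "AE x in lebesgue. indicator K' x *\<^sub>R grad g x = G x"
    using GAE by (rule AE_completion)
  have "integrable lebesgue G"
    by (rule integrable_cong_AE_imp[OF G0(2)]) (use Gm GAE' in \<open>auto intro: measurable_completion\<close>)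
  then have G: "integrable lborel G"
    using Gm by (simp add: integrable_completion)
  have AEG: "AE x in lebesgue. x \<in> K' \<longrightarrow> G x = grad g x"
    using GAE' by eventually_elim auto
  have wk: "(LINT x|lborel. partial_dir \<phi> i x *\<^sub>R f' x) = - (LINT x|lborel. \<phi> x *\<^sub>R column i (G x))"
    if \<phi>: "smooth_gen \<phi>" and K: "compact K" "K \<subseteq> U" "\<And>x. x \<notin> K \<Longrightarrow> \<phi> x = 0" for \<phi> i K
  proof -
    have tf: "test_fun D \<phi>"
      using test_fun_smooth_gen[OF \<phi> K(1) _ K(3), of D] K(2) U by auto
    have part0: "partial_dir \<phi> i x = 0" if "x \<notin> K" for x
      using that K(3) compact_imp_closed[OF K(1)] by (intro smooth_gen_partial_outside[of K]) auto
    obtain B where B: "\<And>x. \<bar>\<phi> x\<bar> \<le> B" using smooth_gen_bounded[OF \<phi>] by blast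
    obtain B' where B': "\<And>x. \<bar>partial_dir \<phi> i x\<bar> \<le> B'"
      using smooth_gen_bounded[OF smooth_gen_partial(1)[OF \<phi>]] by blast
    have "integrable lborel (\<lambda>x. partial_dir \<phi> i x *\<^sub>R f' x)"
      using smooth_gen_borel[OF smooth_gen_partial(1)[OF \<phi>]] B'
      by (intro integrable_scaleR_bounded[OF f']) auto
    from integral_lborel[OF this]
    have "(LINT x|lborel. partial_dir \<phi> i x *\<^sub>R f' x) = integral UNIV (\<lambda>x. partial_dir \<phi> i x *\<^sub>R f' x)" by simp
    also have "\<dots> = integral D (\<lambda>x. partial_dir \<phi> i x *\<^sub>R f x)"
      using K(2) U by (intro integral_eq_of_support[symmetric, of K]) (auto simp: part0 f'_def)
    also have "\<dots> = - integral D (\<lambda>x. \<phi> x *\<^sub>R g i x)"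
      using weak[of i] tf by (simp add: weak_partial_def)
    also have "integral D (\<lambda>x. \<phi> x *\<^sub>R g i x) = integral UNIV (\<lambda>x. \<phi> x *\<^sub>R g i x)"
      using K(2) U by (intro integral_eq_of_support[of K]) (auto simp: K(3))
    also have "\<dots> = integral UNIV (\<lambda>x. \<phi> x *\<^sub>R column i (G x))"
    proof (rule integral_spike)
      show "negligible {x. \<not> (x \<in> K' \<longrightarrow> G x = grad g x)}"
        using AEG by (simp only: AE_lebesgue_iff_negligible)
      fix x assume "x \<in> UNIV - {x. \<not> (x \<in> K' \<longrightarrow> G x = grad g x)}"
      then show "\<phi> x *\<^sub>R column i (G x) = \<phi> x *\<^sub>R g i x"
        using K(2,3) U by (cases "x \<in> K") auto
    qed
    also have "\<dots> = (LINT x|lborel. \<phi> x *\<^sub>R column i (G x))"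
    proof (rule integral_lborel, rule integrable_scaleR_bounded[of _ _ _ B])
      have "bounded_linear (\<lambda>A::real^'n^'m. column i A)"
        using bounded_linear_matrix_mult_left[of "axis i 1"] by (simp add: matrix_vector_mult_basis)
      then show "integrable lborel (\<lambda>x. column i (G x))"
        by (rule integrable_bounded_linear[OF _ G])
    qed (use smooth_gen_borel[OF \<phi>] B in auto)
    finally show ?thesis .
  qed
  have star: "AE x in lborel. x \<in> V \<longrightarrow>
      integrable lborel (\<lambda>s. indicator {0..1} s *\<^sub>R G (x + s *\<^sub>R v)) \<and>
      f' (x + v) - f' x = (LINT s|lborel. indicator {0..1} s *\<^sub>R G (x + s *\<^sub>R v)) *v v"
    if "norm v < r" for v
  proof (rule weak_gradient_translation[where U=U, OF f' G wk V])
    fix x s assume "x \<in> V" "0 \<le> s" "s \<le> (1::real)"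
    then show "x + s *\<^sub>R v \<in> U"
      using that by (intro VU) (auto intro: le_less_trans[OF mult_left_le_one_le])
  qed
  show thesis
    by (rule that[OF f' G _ AEG star]) (auto simp: f'_def)
qed


lemma borel_measurable_matrix_vector_mult [measurable (raw)]:
  fixes A :: "'a \<Rightarrow> real^'n^'m"
  assumes [measurable]: "A \<in> borel_measurable M" "b \<in> borel_measurable M"
  shows "(\<lambda>p. A p *v b p) \<in> borel_measurable M"
proof -
  have "continuous_on UNIV (\<lambda>p::(real^'n^'m) \<times> (real^'n). fst p *v snd p)"
    unfolding matrix_mult_sum_scaleR column_def by (intro continuous_intros)
  from borel_measurable_continuous_on[OF this, of "\<lambda>p. (A p, b p)" M] show ?thesis
    by (simp add: borel_prod[symmetric])
qed

text \<open>The norm is taken inside the integral over \<open>s\<close>, and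
  \<open>y = x + s *\<^sub>R v\<close> is substituted. The indicator then selects a translate of
  \<open>B\<close>, a set of the same measure, which makes the bound compatible with
  equi-integrability.\<close>

lemma translation_increment_bound:
  fixes f :: "real^'n \<Rightarrow> real^'m" and G :: "real^'n \<Rightarrow> real^'n^'m"
  assumes f: "integrable lborel f" and G: "integrable lborel G"
    and star: "AE x in lborel. x \<in> V \<longrightarrow>
      integrable lborel (\<lambda>s. indicator {0..1} s *\<^sub>R G (x + s *\<^sub>R v)) \<and>
      f (x + v) - f x = (LINT s|lborel. indicator {0..1} s *\<^sub>R G (x + s *\<^sub>R v)) *v v"
    and B [measurable]: "B \<in> sets borel" and "B \<subseteq> V"
  shows "(\<integral>\<^sup>+x. indicator B x * ennreal (norm (f (x + v) - f x)) \<partial>lborel) \<le>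
    (\<integral>\<^sup>+s. indicator {0..1::real} s * (\<integral>\<^sup>+y. indicator B (y - s *\<^sub>R v) * ennreal (norm (G y *v v)) \<partial>lborel) \<partial>lborel)"
proof -
  note [measurable] = borel_measurable_integrable[OF f] borel_measurable_integrable[OF G]
  have "(\<integral>\<^sup>+x. indicator B x * ennreal (norm (f (x + v) - f x)) \<partial>lborel) \<le>
    (\<integral>\<^sup>+x. (\<integral>\<^sup>+s. indicator B x * (indicator {0..1} s * ennreal (norm (G (x + s *\<^sub>R v) *v v))) \<partial>lborel) \<partial>lborel)"
  proof (rule nn_integral_mono_AE)
    show "AE x in lborel. indicator B x * ennreal (norm (f (x + v) - f x)) \<le>
      (\<integral>\<^sup>+s. indicator B x * (indicator {0..1} s * ennreal (norm (G (x + s *\<^sub>R v) *v v))) \<partial>lborel)"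
      using star
    proof eventually_elim
      case (elim x)
      show ?case
      proof (cases "x \<in> B")
        case True
        with elim \<open>B \<subseteq> V\<close> have int: "integrable lborel (\<lambda>s. indicator {0..1} s *\<^sub>R G (x + s *\<^sub>R v))"
          and eq: "f (x + v) - f x = (LINT s|lborel. indicator {0..1} s *\<^sub>R G (x + s *\<^sub>R v)) *v v" by auto
        have "f (x + v) - f x = (LINT s|lborel. (indicator {0..1} s *\<^sub>R G (x + s *\<^sub>R v)) *v v)"
          unfolding eq by (rule integral_bounded_linear[OF bounded_linear_matrix_mult_left int, symmetric])
        then have "ennreal (norm (f (x + v) - f x)) \<le>
            (\<integral>\<^sup>+s. ennreal (norm ((indicator {0..1} s *\<^sub>R G (x + s *\<^sub>R v)) *v v)) \<partial>lborel)"
          using integral_norm_bound_ennreal[OF integrable_bounded_linear[OF bounded_linear_matrix_mult_left int]] by simp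
        also have "\<dots> = (\<integral>\<^sup>+s. indicator {0..1} s * ennreal (norm (G (x + s *\<^sub>R v) *v v)) \<partial>lborel)"
          by (intro nn_integral_cong) (auto split: split_indicator)
        finally show ?thesis using True by simp
      qed simp
    qed
  qed
  also have "\<dots> = (\<integral>\<^sup>+s. (\<integral>\<^sup>+x. indicator B x * (indicator {0..1} s * ennreal (norm (G (x + s *\<^sub>R v) *v v))) \<partial>lborel) \<partial>lborel)"
    by (rule lborel_pair.Fubini'[symmetric]) measurable
  also have "\<dots> = (\<integral>\<^sup>+s. indicator {0..1::real} s * (\<integral>\<^sup>+y. indicator B (y - s *\<^sub>R v) * ennreal (norm (G y *v v)) \<partial>lborel) \<partial>lborel)"
  proof (rule nn_integral_cong)
    fix s :: real
    have "(\<integral>\<^sup>+x. indicator B x * (indicator {0..1} s * ennreal (norm (G (x + s *\<^sub>R v) *v v))) \<partial>lborel) =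
        (\<integral>\<^sup>+x. indicator {0..1} s * (indicator B x * ennreal (norm (G (x + s *\<^sub>R v) *v v))) \<partial>lborel)"
      by (simp add: mult_ac)
    also have "\<dots> = indicator {0..1} s * (\<integral>\<^sup>+x. indicator B x * ennreal (norm (G (x + s *\<^sub>R v) *v v)) \<partial>lborel)"
      by (rule nn_integral_cmult) measurable
    also have "(\<integral>\<^sup>+x. indicator B x * ennreal (norm (G (x + s *\<^sub>R v) *v v)) \<partial>lborel) =
       (\<integral>\<^sup>+y. indicator B (y - s *\<^sub>R v) * ennreal (norm (G y *v v)) \<partial>lborel)"
      using nn_integral_lborel_translate[of "\<lambda>y. indicator B (y - s *\<^sub>R v) * ennreal (norm (G y *v v))" "s *\<^sub>R v"]
      by (simp add: add.commute)
    finally show "(\<integral>\<^sup>+x. indicator B x * (indicator {0..1} s * ennreal (norm (G (x + s *\<^sub>R v) *v v))) \<partial>lborel) =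
      indicator {0..1::real} s * (\<integral>\<^sup>+y. indicator B (y - s *\<^sub>R v) * ennreal (norm (G y *v v)) \<partial>lborel)" .
  qed
  finally show ?thesis .
qed

text \<open>Approximate differentiability supplies the pieces for \<open>area_inequality\<close>.
  The integral is over \<open>lebesgue\<close> because a weak derivative need not be Borel
  measurable.\<close>

lemma weak_partial_area_inequality:
  fixes f :: "real^'n \<Rightarrow> real^'n"
  assumes D: "open D" and f: "continuous_on D f" "inj_on f D" and weak: "\<And>i. weak_partial D f i (g i)"
    and K: "compact K" "K \<subseteq> D"
  shows "(\<integral>\<^sup>+x. ennreal \<bar>det (grad g x)\<bar> * indicator K x \<partial>lebesgue) \<le> emeasure lborel (f ` K)"
proof -
  obtain r V U K' where rV: "r > 0" "open V" "K \<subseteq> V" "bounded V" and U: "open U" "U \<subseteq> K'" "compact K'" "K' \<subseteq> D"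
    and VU: "\<And>x v. x \<in> V \<Longrightarrow> norm v < r \<Longrightarrow> x + v \<in> U"
    using compact_nested_neighbourhoods[OF K(1) D K(2)] by metis
  obtain f' G where f': "integrable lborel f'" and G: "integrable lborel G"
    and eq: "\<And>x. x \<in> K' \<Longrightarrow> f' x = f x" and AEG: "AE x in lebesgue. x \<in> K' \<longrightarrow> G x = grad g x"
    and star: "\<And>v. norm v < r \<Longrightarrow> AE x in lborel. x \<in> V \<longrightarrow>
      integrable lborel (\<lambda>s. indicator {0..1} s *\<^sub>R G (x + s *\<^sub>R v)) \<and>
      f' (x + v) - f' x = (LINT s|lborel. indicator {0..1} s *\<^sub>R G (x + s *\<^sub>R v)) *v v"
    by (rule weak_partial_translation[OF f(1) weak rV(2) U(2-4) VU]) blast+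
  have fin: "emeasure lborel V < \<infinity>"
    using rV(4) by (rule emeasure_bounded_finite)
  have f'm: "f' \<in> borel_measurable borel"
    using borel_measurable_integrable[OF f'] by simp
  obtain T :: "nat \<Rightarrow> (real^'n) set" where T: "\<And>k. T k \<in> sets borel" "\<And>k. T k \<subseteq> V"
    "negligible (V - (\<Union>k. T k))"
    and der: "\<And>k x. x \<in> T k \<Longrightarrow> (f' has_derivative (*v) (G x)) (at x within T k)"
    by (rule weak_gradient_approx_differentiable[OF f'm G rV(2) fin rV(1) star]) blast+
  have "K \<subseteq> U" using VU[of _ 0] rV(1,3) by auto
  then have KK': "K \<subseteq> K'" using U by auto
  have "(\<integral>\<^sup>+x. ennreal \<bar>det (grad g x)\<bar> * indicator K x \<partial>lebesgue) =
      (\<integral>\<^sup>+x. ennreal \<bar>det (G x)\<bar> * indicator K x \<partial>lebesgue)"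
    using AEG
  proof (intro nn_integral_cong_AE, eventually_elim)
    case (elim x)
    then show ?case using KK' by (cases "x \<in> K") auto
  qed
  also have "\<dots> = (\<integral>\<^sup>+x. ennreal \<bar>det (G x)\<bar> * indicator K x \<partial>lborel)"
    by (rule nn_integral_completion)
  also have "\<dots> \<le> emeasure lborel (f' ` K)"
  proof (rule area_inequality[OF K(1) _ _ _ T(1) _ der])
    show "continuous_on K f'"
      using continuous_on_subset[OF f(1) K(2)] eq KK' by (metis (no_types, lifting) continuous_on_cong subsetD)
    show "inj_on f' K"
      using inj_on_subset[OF f(2) K(2)] eq KK' by (metis (no_types, lifting) inj_on_cong subsetD)
    show "negligible (K - (\<Union>k. T k))"
      by (rule negligible_subset[OF T(3)]) (use rV in auto)
    show "G \<in> borel_measurable borel" using borel_measurable_integrable[OF G] by simp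
  qed
  also have "f' ` K = f ` K" using eq KK' by (intro image_cong) auto
  finally show ?thesis .
qed

section \<open>Vitali convergence and limits of weak derivatives\<close>

text \<open>\<open>h\<close> is cut at a height \<open>N\<close> for which the excess has integral
  below \<open>e / 2\<close>; the bounded part contributes at most \<open>N\<close> times the
  measure of \<open>B\<close>.\<close>

lemma nn_integral_absolute_continuity:
  fixes h :: "'a \<Rightarrow> ennreal"
  assumes [measurable]: "h \<in> borel_measurable M" and fin: "(\<integral>\<^sup>+x. h x \<partial>M) < \<infinity>" and "e > 0"
  shows "\<exists>d>0. \<forall>B\<in>sets M. emeasure M B < ennreal d \<longrightarrow> (\<integral>\<^sup>+x. indicator B x * h x \<partial>M) \<le> ennreal e"
proof -
  define u where "u N x = h x - min (h x) (of_nat N)" for N :: nat and x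
  have [measurable]: "u N \<in> borel_measurable M" for N
    unfolding u_def by measurable
  have "(\<lambda>N. \<integral>\<^sup>+x. u N x \<partial>M) \<longlonglongrightarrow> (\<integral>\<^sup>+x. 0 \<partial>M)"
  proof (rule nn_integral_dominated_convergence[where w=h])
    show "AE x in M. u N x \<le> h x" for N by (auto simp: u_def)
    have "AE x in M. h x \<noteq> \<infinity>"
      using fin by (intro nn_integral_PInf_AE) auto
    then show "AE x in M. (\<lambda>N. u N x) \<longlonglongrightarrow> 0"
    proof eventually_elim
      case (elim x)
      then obtain c where c: "h x = ennreal c" "0 \<le> c" by (cases "h x") auto
      obtain N0 where "c \<le> real N0" using real_arch_simple by blast
      have "u N x = 0" if "N \<ge> N0" for N
      proof -
        have "h x \<le> of_nat N"
          using c \<open>c \<le> real N0\<close> that by (simp add: ennreal_of_nat_eq_real_of_nat)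
        then show ?thesis using c by (simp add: u_def min_absorb1)
      qed
      then show ?case by (intro tendsto_eventually) (auto simp: eventually_sequentially)
    qed
  qed (use fin in auto)
  then have "(\<lambda>N. \<integral>\<^sup>+x. u N x \<partial>M) \<longlonglongrightarrow> 0" by simp
  then have "\<forall>\<^sub>F N in sequentially. (\<integral>\<^sup>+x. u N x \<partial>M) < ennreal (e / 2)"
    using \<open>e > 0\<close> by (intro order_tendstoD(2)) auto
  then obtain N where N: "(\<integral>\<^sup>+x. u N x \<partial>M) < ennreal (e / 2)"
    by (auto simp: eventually_sequentially)
  \<comment> \<open>\<open>N + 1\<close> instead of \<open>N\<close> avoids a division by 0.\<close>
  define d where "d = e / (2 * (real N + 1))"
  have "d > 0" using \<open>e > 0\<close> by (simp add: d_def)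
  moreover have "(\<integral>\<^sup>+x. indicator B x * h x \<partial>M) \<le> ennreal e"
    if [measurable]: "B \<in> sets M" and B: "emeasure M B < ennreal d" for B
  proof -
    have le: "h x \<le> of_nat N + u N x" for x
    proof -
      have "h x = min (h x) (of_nat N) + u N x"
        unfolding u_def by (rule add_diff_inverse_ennreal[symmetric]) simp
      also have "\<dots> \<le> of_nat N + u N x" by (intro add_right_mono) simp
      finally show ?thesis .
    qed
    have "(\<integral>\<^sup>+x. indicator B x * h x \<partial>M) \<le> (\<integral>\<^sup>+x. of_nat N * indicator B x + u N x \<partial>M)"
      using le by (intro nn_integral_mono) (auto split: split_indicator)
    also have "\<dots> = of_nat N * emeasure M B + (\<integral>\<^sup>+x. u N x \<partial>M)"
      by (simp add: nn_integral_add nn_integral_cmult_indicator)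
    also have "\<dots> \<le> ennreal (real N) * ennreal d + ennreal (e / 2)"
      using B N by (intro add_mono mult_mono) (auto simp: ennreal_of_nat_eq_real_of_nat)
    also have "\<dots> = ennreal (real N * d + e / 2)"
      using \<open>d > 0\<close> \<open>e > 0\<close> by (simp add: ennreal_mult')
    also have "\<dots> \<le> ennreal e"
    proof (rule ennreal_leI)
      have "real N * d \<le> (real N + 1) * d" using \<open>d > 0\<close> by simp
      also have "\<dots> = e / 2" by (simp add: d_def divide_simps)
      finally show "real N * d + e / 2 \<le> e" by simp
    qed
    finally show ?thesis .
  qed
  ultimately show ?thesis by blast
qed

text \<open>Dominated convergence for the indicators of the bad sets, with the indicator of
  \<open>K\<close> as majorant.\<close>

lemma AE_convergence_imp_in_measure:
  fixes d :: "nat \<Rightarrow> 'a \<Rightarrow> 'b::{banach, second_countable_topology}"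
  assumes K [measurable]: "K \<in> sets M" and Kfin: "emeasure M K < \<infinity>"
    and [measurable]: "\<And>k. d k \<in> borel_measurable M" "p \<in> borel_measurable M"
    and lim: "AE x in M. (\<lambda>k. d k x) \<longlonglongrightarrow> p x" and "e > 0"
  shows "(\<lambda>k. emeasure M {x \<in> space M. x \<in> K \<and> e < norm (d k x - p x)}) \<longlonglongrightarrow> 0"
proof -
  define B where "B k = {x \<in> space M. x \<in> K \<and> e < norm (d k x - p x)}" for k
  have [measurable]: "B k \<in> sets M" for k unfolding B_def by measurable
  have "(\<lambda>k. \<integral>\<^sup>+x. indicator (B k) x \<partial>M) \<longlonglongrightarrow> (\<integral>\<^sup>+x. 0 \<partial>M)"
  proof (rule nn_integral_dominated_convergence[where w="indicator K"])
    show "AE x in M. indicator (B k) x \<le> (indicator K x :: ennreal)" for k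
      by (auto simp: B_def split: split_indicator)
    show "AE x in M. (\<lambda>k. indicator (B k) x :: ennreal) \<longlonglongrightarrow> 0"
      using lim
    proof eventually_elim
      case (elim x)
      then have "(\<lambda>k. norm (d k x - p x)) \<longlonglongrightarrow> 0"
        by (simp add: LIM_zero_iff tendsto_norm_zero_iff)
      then have "\<forall>\<^sub>F k in sequentially. norm (d k x - p x) < e"
        using \<open>e > 0\<close> by (rule order_tendstoD)
      then show ?case
        by (intro tendsto_eventually) (auto elim!: eventually_mono simp: B_def)
    qed
  qed (use Kfin in auto)
  then show ?thesis by (simp add: B_def[symmetric])
qed

text \<open>Outside a set of small measure the difference is at most \<open>e\<close>. On that set
  equi-integrability bounds the integral of \<open>d k\<close> by \<open>e\<close>, and Fatou's
  lemma passes the same bound to \<open>p\<close>. With \<open>c\<close> the measure of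
  \<open>K\<close> the total is \<open>e * (c + 2)\<close>.\<close>

lemma vitali_convergence:
  fixes d :: "nat \<Rightarrow> 'a \<Rightarrow> 'b::{banach, second_countable_topology}"
  assumes K [measurable]: "K \<in> sets M" and Kfin: "emeasure M K < \<infinity>"
    and d: "\<And>k. integrable M (d k)" "\<And>k x. x \<notin> K \<Longrightarrow> d k x = 0"
    and p [measurable]: "p \<in> borel_measurable M" and p0: "\<And>x. x \<notin> K \<Longrightarrow> p x = 0"
    and lim: "AE x in M. (\<lambda>k. d k x) \<longlonglongrightarrow> p x"
    and equi: "\<And>e. e > 0 \<Longrightarrow> \<exists>\<delta>>0. \<forall>k. \<forall>B\<in>sets M. B \<subseteq> K \<longrightarrow> emeasure M B < ennreal \<delta> \<longrightarrow>
        (\<integral>\<^sup>+x. indicator B x * ennreal (norm (d k x)) \<partial>M) \<le> ennreal e"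
  shows "integrable M p" and "(\<lambda>k. \<integral>\<^sup>+x. ennreal (norm (d k x - p x)) \<partial>M) \<longlonglongrightarrow> 0"
proof -
  note [measurable] = borel_measurable_integrable[OF d(1)]
  obtain c where c: "emeasure M K = ennreal c" "0 \<le> c"
    using Kfin by (cases "emeasure M K") auto
  have key: "\<forall>\<^sub>F k in sequentially. (\<integral>\<^sup>+x. ennreal (norm (d k x - p x)) \<partial>M) \<le> ennreal (e * (c + 2))"
    if "e > 0" for e
  proof -
    obtain \<delta> where \<delta>: "\<delta> > 0" "\<And>k B. B \<in> sets M \<Longrightarrow> B \<subseteq> K \<Longrightarrow> emeasure M B < ennreal \<delta> \<Longrightarrow>
        (\<integral>\<^sup>+x. indicator B x * ennreal (norm (d k x)) \<partial>M) \<le> ennreal e"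
      using equi[OF \<open>e > 0\<close>] by blast
    have pB: "(\<integral>\<^sup>+x. indicator B x * ennreal (norm (p x)) \<partial>M) \<le> ennreal e"
      if [measurable]: "B \<in> sets M" and B: "B \<subseteq> K" "emeasure M B < ennreal \<delta>" for B
    proof -
      have "AE x in M. indicator B x * ennreal (norm (p x)) = liminf (\<lambda>k. indicator B x * ennreal (norm (d k x)))"
        using lim
      proof eventually_elim
        case (elim x)
        have "(\<lambda>k. indicator B x * ennreal (norm (d k x))) \<longlonglongrightarrow> indicator B x * ennreal (norm (p x))"
          using elim by (cases "x \<in> B") (auto intro!: tendsto_ennrealI tendsto_norm)
        then show ?case by (simp add: lim_imp_Liminf)
      qed
      then have "(\<integral>\<^sup>+x. indicator B x * ennreal (norm (p x)) \<partial>M) =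
          (\<integral>\<^sup>+x. liminf (\<lambda>k. indicator B x * ennreal (norm (d k x))) \<partial>M)"
        by (rule nn_integral_cong_AE)
      also have "\<dots> \<le> liminf (\<lambda>k. \<integral>\<^sup>+x. indicator B x * ennreal (norm (d k x)) \<partial>M)"
        by (rule nn_integral_liminf) measurable
      also have "\<dots> \<le> limsup (\<lambda>k. \<integral>\<^sup>+x. indicator B x * ennreal (norm (d k x)) \<partial>M)"
        by (rule Liminf_le_Limsup) simp
      also have "\<dots> \<le> ennreal e"
        by (rule Limsup_bounded) (use \<delta>(2) B in auto)
      finally show ?thesis .
    qed
    define B where "B k = {x \<in> space M. x \<in> K \<and> e < norm (d k x - p x)}" for k
    have [measurable]: "B k \<in> sets M" for k unfolding B_def by measurable
    have "(\<lambda>k. emeasure M (B k)) \<longlonglongrightarrow> 0"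
      unfolding B_def by (rule AE_convergence_imp_in_measure[OF K Kfin _ p lim \<open>e > 0\<close>]) measurable
    then have "\<forall>\<^sub>F k in sequentially. emeasure M (B k) < ennreal \<delta>"
      using \<delta>(1) by (intro order_tendstoD(2)) auto
    then show ?thesis
    proof eventually_elim
      case (elim k)
      have BK: "B k \<subseteq> K" by (auto simp: B_def)
      have "(\<integral>\<^sup>+x. ennreal (norm (d k x - p x)) \<partial>M) \<le>
          (\<integral>\<^sup>+x. ennreal e * indicator K x + (indicator (B k) x * ennreal (norm (d k x)) + indicator (B k) x * ennreal (norm (p x))) \<partial>M)"
      proof (rule nn_integral_mono)
        fix x assume "x \<in> space M"
        show "ennreal (norm (d k x - p x)) \<le> ennreal e * indicator K x + (indicator (B k) x * ennreal (norm (d k x)) + indicator (B k) x * ennreal (norm (p x)))"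
        proof (cases "x \<in> K")
          case True
          show ?thesis
          proof (cases "x \<in> B k")
            case True
            have "ennreal (norm (d k x - p x)) \<le> ennreal (norm (d k x) + norm (p x))"
              by (intro ennreal_leI norm_triangle_ineq4)
            also have "\<dots> = ennreal (norm (d k x)) + ennreal (norm (p x))" by simp
            finally show ?thesis using True by (simp add: add_increasing)
          next
            case False
            then have "norm (d k x - p x) \<le> e" using \<open>x \<in> K\<close> \<open>x \<in> space M\<close> by (simp add: B_def)
            then show ?thesis using True False by (simp add: ennreal_leI)
          qed
        qed (simp add: d(2) p0)
      qed
      also have "\<dots> = ennreal e * emeasure M K +
          ((\<integral>\<^sup>+x. indicator (B k) x * ennreal (norm (d k x)) \<partial>M) + (\<integral>\<^sup>+x. indicator (B k) x * ennreal (norm (p x)) \<partial>M))"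
        by (simp add: nn_integral_add nn_integral_cmult_indicator)
      also have "\<dots> \<le> ennreal e * ennreal c + (ennreal e + ennreal e)"
        unfolding c(1) by (intro add_mono order_refl \<delta>(2) pB elim BK) auto
      also have "\<dots> = ennreal (e * (c + 2))"
      proof -
        have "e * (c + 2) = e * c + (e + e)" by (simp add: algebra_simps)
        then show ?thesis using \<open>e > 0\<close> c(2) by (simp only: ennreal_plus ennreal_mult add_nonneg_nonneg mult_nonneg_nonneg less_imp_le)
      qed
      finally show ?case .
    qed
  qed
  show "(\<lambda>k. \<integral>\<^sup>+x. ennreal (norm (d k x - p x)) \<partial>M) \<longlonglongrightarrow> 0"
  proof (rule order_tendstoI)
    fix a :: ennreal assume "0 < a"
    then obtain b where b: "0 < b" "b < a" using dense by blast
    then obtain b' where b': "b = ennreal b'" "b' > 0" by (cases b) auto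
    have "\<forall>\<^sub>F k in sequentially. (\<integral>\<^sup>+x. ennreal (norm (d k x - p x)) \<partial>M) \<le> ennreal ((b' / (c + 2)) * (c + 2))"
      using b' c(2) by (intro key) auto
    then show "\<forall>\<^sub>F k in sequentially. (\<integral>\<^sup>+x. ennreal (norm (d k x - p x)) \<partial>M) < a"
      using b b' c(2) by (auto elim!: eventually_mono)
  qed auto
  obtain k where k: "(\<integral>\<^sup>+x. ennreal (norm (d k x - p x)) \<partial>M) \<le> ennreal (1 * (c + 2))"
    using key[of 1] by (auto simp: eventually_sequentially)
  have "integrable M (\<lambda>x. d k x - p x)"
    using k by (intro integrableI_bounded) (auto simp: le_less_trans)
  from Bochner_Integration.integrable_diff[OF d(1)[of k] this] show "integrable M p" by simp
qed

section \<open>Classical partial derivatives as weak derivatives\<close>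

lemma has_all_partials_has_vector_derivative:
  assumes "has_all_partials f x"
  shows "((\<lambda>t. f (x + t *\<^sub>R axis i 1)) has_vector_derivative partial_dir f i x) (at 0)"
  using assms unfolding has_all_partials_def partial_dir_def by (simp add: vector_derivative_works)



lemma has_vector_derivative_along_axis:
  assumes "has_all_partials f (x + s *\<^sub>R axis i 1)"
  shows "((\<lambda>t. f (x + t *\<^sub>R axis i 1)) has_vector_derivative partial_dir f i (x + s *\<^sub>R axis i 1)) (at s)"
proof -
  have 1: "((\<lambda>t. f ((x + s *\<^sub>R axis i 1) + t *\<^sub>R axis i 1)) has_vector_derivative partial_dir f i (x + s *\<^sub>R axis i 1)) (at (s - s))"
    using has_all_partials_has_vector_derivative[OF assms] by simp
  have 2: "((\<lambda>t. t - s) has_vector_derivative 1) (at s)"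
    by (auto intro!: derivative_eq_intros)
  show ?thesis
    using vector_diff_chain_at[OF 2 1] by (simp add: o_def algebra_simps)
qed

text \<open>\<open>smooth_fun\<close> provides iterated partial derivatives and no total derivative.
  Compact support bounds them, and the mean value theorem on each axis line gives the Lipschitz
  constant that dominates the difference quotients of a test function.\<close>

lemma test_fun_facts:
  assumes "test_fun D \<phi>"
  obtains K C where "compact K" "K \<subseteq> D" "\<And>x. x \<notin> K \<Longrightarrow> \<phi> x = 0" "\<And>x. x \<notin> K \<Longrightarrow> partial_dir \<phi> i x = 0"
    "continuous_on UNIV \<phi>" "continuous_on UNIV (partial_dir \<phi> i)" "\<And>x. \<bar>\<phi> x\<bar> \<le> C" "\<And>x. \<bar>partial_dir \<phi> i x\<bar> \<le> C"
    "\<And>x t. \<bar>\<phi> (x + t *\<^sub>R axis i 1) - \<phi> x\<bar> \<le> C * \<bar>t\<bar>"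
    "\<And>x. ((\<lambda>t. \<phi> (x + t *\<^sub>R axis i 1)) has_vector_derivative partial_dir \<phi> i x) (at 0)"
proof -
  obtain K where K: "compact K" "K \<subseteq> D" "\<And>x. x \<notin> K \<Longrightarrow> \<phi> x = 0" and sm: "smooth_fun \<phi>"
    using assms unfolding test_fun_def by blast
  have sm': "continuous_on UNIV (foldr (\<lambda>i g. partial_dir g i) is \<phi>)" "has_all_partials (foldr (\<lambda>i g. partial_dir g i) is \<phi>) x" for "is" x
    using sm unfolding smooth_fun_def by blast+
  have c: "continuous_on UNIV \<phi>" "continuous_on UNIV (partial_dir \<phi> i)"
    using sm'(1)[of "[]"] sm'(1)[of "[i]"] by simp_all
  have hp: "has_all_partials \<phi> x" for x using sm'(2)[of "[]"] by simp
  have p0: "partial_dir \<phi> i x = 0" if "x \<notin> K" for x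
    using that K(3) compact_imp_closed[OF K(1)] by (intro smooth_gen_partial_outside[of K]) auto
  have bnd: "\<exists>B. \<forall>x. \<bar>h x\<bar> \<le> B" if "continuous_on UNIV h" "\<And>x. x \<notin> K \<Longrightarrow> h x = 0" for h :: "real^'a \<Rightarrow> real"
  proof -
    have "compact (h ` K)" using that(1) K(1) by (meson compact_continuous_image continuous_on_subset subset_UNIV)
    then obtain B where "\<And>y. y \<in> h ` K \<Longrightarrow> norm y \<le> B" using compact_imp_bounded bounded_iff by metis
    then have "\<bar>h x\<bar> \<le> max B 0" for x using that(2)[of x] by (cases "x \<in> K") (auto intro: max.coboundedI1)
    then show ?thesis by blast
  qed
  obtain B1 where B1: "\<And>x. \<bar>\<phi> x\<bar> \<le> B1" using bnd[OF c(1) K(3)] by blast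
  obtain B2 where B2: "\<And>x. \<bar>partial_dir \<phi> i x\<bar> \<le> B2" using bnd[OF c(2) p0] by blast
  have lip: "\<bar>\<phi> (x + t *\<^sub>R axis i 1) - \<phi> x\<bar> \<le> B2 * \<bar>t\<bar>" for x t
  proof -
    have "((\<lambda>t. \<phi> (x + t *\<^sub>R axis i 1)) has_field_derivative partial_dir \<phi> i (x + s *\<^sub>R axis i 1)) (at s within UNIV)" for s
      using has_vector_derivative_along_axis[OF hp] by (simp add: has_real_derivative_iff_has_vector_derivative)
    from field_differentiable_bound[OF convex_UNIV this, of B2 t 0] B2
    show ?thesis by simp
  qed
  show thesis
  proof (rule that[of K "max B1 B2"])
    show "\<bar>\<phi> (x + t *\<^sub>R axis i 1) - \<phi> x\<bar> \<le> max B1 B2 * \<bar>t\<bar>" for x t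
      using lip[of x t] by (meson abs_ge_zero max.cobounded2 mult_right_mono order_trans)
    show "((\<lambda>t. \<phi> (x + t *\<^sub>R axis i 1)) has_vector_derivative partial_dir \<phi> i x) (at 0)" for x
      by (rule has_all_partials_has_vector_derivative[OF hp])
  qed (use K p0 c B1 B2 in \<open>auto simp: le_max_iff_disj\<close>)
qed

lemma has_vector_derivative_0_quotient:
  fixes h :: "real \<Rightarrow> 'b::real_normed_vector"
  assumes "(h has_vector_derivative p) (at 0)" "t \<longlonglongrightarrow> 0" "\<And>k. t k \<noteq> 0"
  shows "(\<lambda>k. (1 / t k) *\<^sub>R (h (t k) - h 0)) \<longlonglongrightarrow> p"
proof -
  have "((\<lambda>s. (1 / s) *\<^sub>R (h s - h 0)) \<longlongrightarrow> p) (at 0)"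
  proof (rule LIM_zero_cancel, rule tendsto_norm_zero_cancel)
    have "((\<lambda>s. norm (h s - h 0 - s *\<^sub>R p) / \<bar>s\<bar>) \<longlongrightarrow> 0) (at 0)"
      using assms(1) unfolding has_vector_derivative_def has_derivative_at by simp
    then show "((\<lambda>s. norm ((1 / s) *\<^sub>R (h s - h 0) - p)) \<longlongrightarrow> 0) (at 0)"
    proof (rule Lim_transform_eventually)
      show "\<forall>\<^sub>F s in at 0. norm (h s - h 0 - s *\<^sub>R p) / \<bar>s\<bar> = norm ((1 / s) *\<^sub>R (h s - h 0) - p)"
        unfolding eventually_at_filter
      proof (rule always_eventually, intro allI impI)
        fix s :: real assume "s \<noteq> 0"
        then have "(1 / s) *\<^sub>R (h s - h 0) - p = (1 / s) *\<^sub>R (h s - h 0 - s *\<^sub>R p)"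
          by (simp add: scaleR_diff_right)
        then show "norm (h s - h 0 - s *\<^sub>R p) / \<bar>s\<bar> = norm ((1 / s) *\<^sub>R (h s - h 0) - p)"
          by (simp only: norm_scaleR) (simp add: divide_inverse mult.commute)
      qed
    qed
  qed
  then show ?thesis
    by (rule filterlim_compose) (use assms in \<open>auto simp: filterlim_at\<close>)
qed

text \<open>Vitali's theorem for difference quotients cut off to \<open>K\<close>: almost everywhere
  convergence comes from the classical derivative, equi-integrability is the hypothesis.\<close>

lemma difference_quotient_L1_limit:
  fixes u :: "real^'n \<Rightarrow> real^'m"
  assumes D: "open D" and u: "continuous_on D u" and K: "compact K" "K \<subseteq> D"
    and diff: "AE x in lebesgue. x \<in> D \<longrightarrow> ((\<lambda>t. u (x + t *\<^sub>R axis i 1)) has_vector_derivative p x) (at 0)"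
    and \<rho>: "\<rho> > 0" "\<And>x t. x \<in> K \<Longrightarrow> \<bar>t\<bar> < \<rho> \<Longrightarrow> x + t *\<^sub>R axis i 1 \<in> D"
    and equi: "\<And>e. e > 0 \<Longrightarrow> \<exists>\<delta>>0. \<forall>B\<in>sets borel. B \<subseteq> K \<longrightarrow> emeasure lborel B < ennreal \<delta> \<longrightarrow>
       (\<forall>t. t \<noteq> 0 \<longrightarrow> \<bar>t\<bar> < \<rho> \<longrightarrow>
        (\<integral>\<^sup>+x. indicator B x * ennreal (norm ((1 / t) *\<^sub>R (u (x + t *\<^sub>R axis i 1) - u x))) \<partial>lborel) \<le> ennreal e)"
    and t: "t \<longlonglongrightarrow> 0" "\<And>k. t k \<noteq> 0" "\<And>k. \<bar>t k\<bar> < \<rho>"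
  obtains p' where "integrable lborel p'" "AE x in lebesgue. p' x = indicator K x *\<^sub>R p x"
    "\<And>k. integrable lborel (\<lambda>x. indicator K x *\<^sub>R ((1 / t k) *\<^sub>R (u (x + t k *\<^sub>R axis i 1) - u x)))"
    "(\<lambda>k. \<integral>\<^sup>+x. ennreal (norm (indicator K x *\<^sub>R ((1 / t k) *\<^sub>R (u (x + t k *\<^sub>R axis i 1) - u x)) - p' x)) \<partial>lborel) \<longlonglongrightarrow> 0"
proof -
  define d where "d k x = indicator K x *\<^sub>R ((1 / t k) *\<^sub>R (u (x + t k *\<^sub>R axis i 1) - u x))" for k x
  have Kb: "K \<in> sets borel" using K(1) by (simp add: borel_compact)
  have d: "integrable lborel (d k)" for k
    unfolding d_def
  proof (rule borel_integrable_compact[OF K(1)])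
    have "continuous_on K (\<lambda>x. u (x + t k *\<^sub>R axis i 1))"
      by (rule continuous_on_compose2[OF u]) (use \<rho>(2) t(3) in \<open>auto intro!: continuous_intros\<close>)
    then show "continuous_on K (\<lambda>x. (1 / t k) *\<^sub>R (u (x + t k *\<^sub>R axis i 1) - u x))"
      using continuous_on_subset[OF u K(2)] by (intro continuous_intros)
  qed
  \<comment> \<open>Measurability of \<open>p\<close> is not given. The limit of a sequence of Borel
    functions provides a Borel representative, with a default value wherever the sequence
    diverges.\<close>
  define p' where "p' x = lim (\<lambda>k. d k x)" for x
  have [measurable]: "d k \<in> borel_measurable lborel" for k using d by auto
  have p': "p' \<in> borel_measurable lborel"
    unfolding p'_def by (rule borel_measurable_lim_metric) measurable
  have AE1: "AE x in lebesgue. (\<lambda>k. d k x) \<longlonglongrightarrow> p' x \<and> p' x = indicator K x *\<^sub>R p x"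
    using diff
  proof eventually_elim
    case (elim x)
    have "(\<lambda>k. d k x) \<longlonglongrightarrow> indicator K x *\<^sub>R p x"
    proof (cases "x \<in> K")
      case True
      then have "((\<lambda>t. u (x + t *\<^sub>R axis i 1)) has_vector_derivative p x) (at 0)"
        using elim K(2) by auto
      from has_vector_derivative_0_quotient[OF this t(1,2)] True show ?thesis
        by (simp add: d_def)
    qed (simp add: d_def)
    then show ?case by (simp add: p'_def limI)
  qed
  have AE2: "AE x in lborel. (\<lambda>k. d k x) \<longlonglongrightarrow> p' x"
    using AE1 unfolding AE_completion_iff by eventually_elim blast
  have fin: "emeasure lborel K < \<infinity>" using compact_imp_bounded[OF K(1)] by (rule emeasure_bounded_finite)
  have d0: "x \<notin> K \<Longrightarrow> d k x = 0" for x k by (simp add: d_def)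
  have p'0: "x \<notin> K \<Longrightarrow> p' x = 0" for x by (simp add: p'_def d0 limI)
  have equi': "\<exists>\<delta>>0. \<forall>k. \<forall>B\<in>sets lborel. B \<subseteq> K \<longrightarrow> emeasure lborel B < ennreal \<delta> \<longrightarrow>
        (\<integral>\<^sup>+x. indicator B x * ennreal (norm (d k x)) \<partial>lborel) \<le> ennreal e" if "e > 0" for e
  proof -
    obtain \<delta> where \<delta>: "\<delta> > 0" "\<And>B s. B \<in> sets borel \<Longrightarrow> B \<subseteq> K \<Longrightarrow> emeasure lborel B < ennreal \<delta> \<Longrightarrow>
       s \<noteq> 0 \<Longrightarrow> \<bar>s\<bar> < \<rho> \<Longrightarrow>
        (\<integral>\<^sup>+x. indicator B x * ennreal (norm ((1 / s) *\<^sub>R (u (x + s *\<^sub>R axis i 1) - u x))) \<partial>lborel) \<le> ennreal e"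
      using equi[OF \<open>e > 0\<close>] by blast
    show ?thesis
    proof (intro exI[of _ \<delta>] conjI allI ballI impI \<delta>(1))
      fix k B assume B: "B \<in> sets lborel" "B \<subseteq> K" "emeasure lborel B < ennreal \<delta>"
      have "(\<integral>\<^sup>+x. indicator B x * ennreal (norm (d k x)) \<partial>lborel) =
          (\<integral>\<^sup>+x. indicator B x * ennreal (norm ((1 / t k) *\<^sub>R (u (x + t k *\<^sub>R axis i 1) - u x))) \<partial>lborel)"
        using B(2) by (intro nn_integral_cong) (auto simp: d_def split: split_indicator)
      also have "\<dots> \<le> ennreal e" using B by (intro \<delta>(2) t) auto
      finally show "(\<integral>\<^sup>+x. indicator B x * ennreal (norm (d k x)) \<partial>lborel) \<le> ennreal e" .
    qed
  qed
  have "K \<in> sets lborel" using Kb by simp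
  note vit = vitali_convergence[OF this fin d d0 p' p'0 AE2 equi']
  have vit2: "(\<lambda>k. \<integral>\<^sup>+x. ennreal (norm (d k x - p' x)) \<partial>lborel) \<longlonglongrightarrow> 0"
    by (rule vit(2))
  show thesis
  proof (rule that[of p'])
    show "AE x in lebesgue. p' x = indicator K x *\<^sub>R p x" using AE1 by eventually_elim blast
    show "integrable lborel p'" by (rule vit(1))
    show "integrable lborel (\<lambda>x. indicator K x *\<^sub>R ((1 / t k) *\<^sub>R (u (x + t k *\<^sub>R axis i 1) - u x)))" for k
      using d[of k] by (simp only: d_def[abs_def])
    show "(\<lambda>k. \<integral>\<^sup>+x. ennreal (norm (indicator K x *\<^sub>R ((1 / t k) *\<^sub>R (u (x + t k *\<^sub>R axis i 1) - u x)) - p' x)) \<partial>lborel) \<longlonglongrightarrow> 0"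
      using vit2 by (simp only: d_def)
  qed
qed


text \<open>Discrete integration by parts: translating the integral moves the difference quotient in
  direction \<open>i\<close> from \<open>u\<close> to the test function, with the opposite sign. As
  the step tends to 0, one side converges by Vitali's theorem and the other by dominated
  convergence.\<close>

lemma classical_partial_weak_partial:
  fixes u :: "real^'n \<Rightarrow> real^'m"
  assumes D: "open D" and u: "continuous_on D u"
    and diff: "AE x in lebesgue. x \<in> D \<longrightarrow> ((\<lambda>t. u (x + t *\<^sub>R axis i 1)) has_vector_derivative p x) (at 0)"
    and equi: "\<And>K. compact K \<Longrightarrow> K \<subseteq> D \<Longrightarrow> \<exists>\<rho>>0. (\<forall>x\<in>K. \<forall>t. \<bar>t\<bar> < \<rho> \<longrightarrow> x + t *\<^sub>R axis i 1 \<in> D) \<and>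
       (\<forall>e>0. \<exists>\<delta>>0. \<forall>B\<in>sets borel. B \<subseteq> K \<longrightarrow> emeasure lborel B < ennreal \<delta> \<longrightarrow>
       (\<forall>t. t \<noteq> 0 \<longrightarrow> \<bar>t\<bar> < \<rho> \<longrightarrow>
        (\<integral>\<^sup>+x. indicator B x * ennreal (norm ((1 / t) *\<^sub>R (u (x + t *\<^sub>R axis i 1) - u x))) \<partial>lborel) \<le> ennreal e))"
  shows "weak_partial D u i p"
  unfolding weak_partial_def
proof (intro conjI allI impI)
  let ?e = "axis i 1 :: real^'n"
  have lim: "\<exists>p' t. t \<longlonglongrightarrow> 0 \<and> (\<forall>k. t k \<noteq> 0) \<and> integrable lborel p' \<and> (AE x in lebesgue. p' x = indicator K x *\<^sub>R p x) \<and>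
    (\<forall>k. integrable lborel (\<lambda>x. indicator K x *\<^sub>R ((1 / t k) *\<^sub>R (u (x + t k *\<^sub>R ?e) - u x)))) \<and>
    (\<lambda>k. \<integral>\<^sup>+x. ennreal (norm (indicator K x *\<^sub>R ((1 / t k) *\<^sub>R (u (x + t k *\<^sub>R ?e) - u x)) - p' x)) \<partial>lborel) \<longlonglongrightarrow> 0"
    if K: "compact K" "K \<subseteq> D" for K
  proof -
    obtain \<rho> where \<rho>: "\<rho> > 0" "\<And>x t. x \<in> K \<Longrightarrow> \<bar>t\<bar> < \<rho> \<Longrightarrow> x + t *\<^sub>R ?e \<in> D"
      and eq: "\<And>e. e > 0 \<Longrightarrow> \<exists>\<delta>>0. \<forall>B\<in>sets borel. B \<subseteq> K \<longrightarrow> emeasure lborel B < ennreal \<delta> \<longrightarrow>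
       (\<forall>t. t \<noteq> 0 \<longrightarrow> \<bar>t\<bar> < \<rho> \<longrightarrow>
        (\<integral>\<^sup>+x. indicator B x * ennreal (norm ((1 / t) *\<^sub>R (u (x + t *\<^sub>R ?e) - u x))) \<partial>lborel) \<le> ennreal e)"
      using equi[OF K] by blast
    \<comment> \<open>The index is shifted by two because already the first step must be strictly
      below \<open>\<rho>\<close>.\<close>
    define t where "t k = \<rho> * (1 / real (Suc (Suc k)))" for k
    have "(\<lambda>k. 1 / real (Suc k)) \<longlonglongrightarrow> 0"
      using LIMSEQ_inverse_real_of_nat by (simp add: inverse_eq_divide)
    then have "(\<lambda>k. 1 / real (Suc (Suc k))) \<longlonglongrightarrow> 0"
      by (rule LIMSEQ_Suc)
    then have "(\<lambda>k. \<rho> * (1 / real (Suc (Suc k)))) \<longlonglongrightarrow> \<rho> * 0"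
      by (intro tendsto_intros)
    then have t0: "t \<longlonglongrightarrow> 0" by (simp add: t_def[abs_def])
    have t1: "t k \<noteq> 0" "\<bar>t k\<bar> < \<rho>" for k
      using \<rho>(1) by (auto simp: t_def abs_mult field_simps intro: add_pos_nonneg)
    obtain p' where "integrable lborel p'" "AE x in lebesgue. p' x = indicator K x *\<^sub>R p x"
      "\<And>k. integrable lborel (\<lambda>x. indicator K x *\<^sub>R ((1 / t k) *\<^sub>R (u (x + t k *\<^sub>R ?e) - u x)))"
      "(\<lambda>k. \<integral>\<^sup>+x. ennreal (norm (indicator K x *\<^sub>R ((1 / t k) *\<^sub>R (u (x + t k *\<^sub>R ?e) - u x)) - p' x)) \<partial>lborel) \<longlonglongrightarrow> 0"
      by (rule difference_quotient_L1_limit[OF D u K diff \<rho> eq t0 t1]) blast+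
    with t0 t1(1) show ?thesis by blast
  qed
  show "loc_integrable D p"
    unfolding loc_integrable_def
  proof (intro allI impI, elim conjE)
    fix K :: "(real^'n) set" assume K: "compact K" "K \<subseteq> D"
    obtain p' where p': "integrable lborel p'" "AE x in lebesgue. p' x = indicator K x *\<^sub>R p x"
      using lim[OF K] by blast
    have 1: "integrable lebesgue p'" using p'(1) by (simp add: integrable_completion)
    have "integrable lebesgue (\<lambda>x. indicator K x *\<^sub>R p x)"
    proof (rule integrable_cong_AE_imp[OF 1 _ p'(2)])
      show "(\<lambda>x. indicator K x *\<^sub>R p x) \<in> borel_measurable lebesgue"
        by (rule borel_measurable_AE[OF _ p'(2)]) (use 1 in auto)
    qed
    then show "p absolutely_integrable_on K" by (simp add: set_integrable_def)
  qed
  fix \<phi> assume "test_fun D \<phi>"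
  then obtain K C where K: "compact K" "K \<subseteq> D" and \<phi>0: "\<And>x. x \<notin> K \<Longrightarrow> \<phi> x = 0" "\<And>x. x \<notin> K \<Longrightarrow> partial_dir \<phi> i x = 0"
    and cont: "continuous_on UNIV \<phi>" "continuous_on UNIV (partial_dir \<phi> i)"
    and C: "\<And>x. \<bar>\<phi> x\<bar> \<le> C" "\<And>x. \<bar>partial_dir \<phi> i x\<bar> \<le> C"
    and lip: "\<And>x t. \<bar>\<phi> (x + t *\<^sub>R ?e) - \<phi> x\<bar> \<le> C * \<bar>t\<bar>"
    and der: "\<And>x. ((\<lambda>t. \<phi> (x + t *\<^sub>R ?e)) has_vector_derivative partial_dir \<phi> i x) (at 0)"
    by (rule test_fun_facts[of D \<phi> i]) blast
  have [measurable]: "\<phi> \<in> borel_measurable borel" "partial_dir \<phi> i \<in> borel_measurable borel"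
    using cont by (auto intro: borel_measurable_continuous_onI)
  obtain r V U K' where rV: "r > 0" "open V" "K \<subseteq> V" and U: "U \<subseteq> K'" "compact K'" "K' \<subseteq> D"
    and VU: "\<And>x v. x \<in> V \<Longrightarrow> norm v < r \<Longrightarrow> x + v \<in> U"
    using compact_nested_neighbourhoods[OF K(1) D K(2)] by metis
  have KK': "x + v \<in> K'" if "x \<in> K" "norm v < r" for x v
    using VU[of x v] that rV(3) U(1) by auto
  define w where "w x = indicator K' x *\<^sub>R u x" for x
  have w: "integrable lborel w"
    unfolding w_def using U(2) continuous_on_subset[OF u U(3)] by (rule borel_integrable_compact)
  note [measurable] = borel_measurable_integrable[OF w]
  obtain p' t where t: "t \<longlonglongrightarrow> 0" "\<And>k. t k \<noteq> 0" and p': "integrable lborel p'" "AE x in lebesgue. p' x = indicator K x *\<^sub>R p x"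
    and dint: "\<And>k. integrable lborel (\<lambda>x. indicator K x *\<^sub>R ((1 / t k) *\<^sub>R (u (x + t k *\<^sub>R ?e) - u x)))"
    and dlim: "(\<lambda>k. \<integral>\<^sup>+x. ennreal (norm (indicator K x *\<^sub>R ((1 / t k) *\<^sub>R (u (x + t k *\<^sub>R ?e) - u x)) - p' x)) \<partial>lborel) \<longlonglongrightarrow> 0"
    using lim[OF K] by blast
  define d where "d k x = indicator K x *\<^sub>R ((1 / t k) *\<^sub>R (u (x + t k *\<^sub>R ?e) - u x))" for k x
  have d: "integrable lborel (d k)" for k
    using dint[of k] by (simp only: d_def[abs_def])
  have dlim': "(\<lambda>k. \<integral>\<^sup>+x. ennreal (norm (d k x - p' x)) \<partial>lborel) \<longlonglongrightarrow> 0"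
    using dlim by (simp only: d_def)
  have \<phi>d: "integrable lborel (\<lambda>x. \<phi> x *\<^sub>R d k x)" for k
    by (rule integrable_scaleR_bounded[OF d _ C(1)]) auto
  have \<phi>p: "integrable lborel (\<lambda>x. \<phi> x *\<^sub>R p' x)"
    by (rule integrable_scaleR_bounded[OF p'(1) _ C(1)]) auto
  have C0: "0 \<le> C" using C(1)[of 0] by linarith
  have lim1: "(\<lambda>k. LINT x|lborel. \<phi> x *\<^sub>R d k x) \<longlonglongrightarrow> (LINT x|lborel. \<phi> x *\<^sub>R p' x)"
  proof (rule LIM_zero_cancel, rule tendsto_norm_zero_cancel)
    have le: "ennreal (norm ((LINT x|lborel. \<phi> x *\<^sub>R d k x) - (LINT x|lborel. \<phi> x *\<^sub>R p' x))) \<le>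
       ennreal C * (\<integral>\<^sup>+x. ennreal (norm (d k x - p' x)) \<partial>lborel)" for k
    proof -
      have e1: "(LINT x|lborel. \<phi> x *\<^sub>R d k x) - (LINT x|lborel. \<phi> x *\<^sub>R p' x) = (LINT x|lborel. \<phi> x *\<^sub>R (d k x - p' x))"
        using \<phi>d \<phi>p by (simp add: scaleR_diff_right)
      have i1: "integrable lborel (\<lambda>x. \<phi> x *\<^sub>R (d k x - p' x))"
        using \<phi>d \<phi>p by (simp add: scaleR_diff_right)
      have "ennreal (norm ((LINT x|lborel. \<phi> x *\<^sub>R d k x) - (LINT x|lborel. \<phi> x *\<^sub>R p' x))) \<le>
          (\<integral>\<^sup>+x. ennreal (norm (\<phi> x *\<^sub>R (d k x - p' x))) \<partial>lborel)"
        unfolding e1 by (rule integral_norm_bound_ennreal[OF i1])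
      also have "\<dots> \<le> (\<integral>\<^sup>+x. ennreal C * ennreal (norm (d k x - p' x)) \<partial>lborel)"
        using C(1) C0 by (intro nn_integral_mono) (simp add: ennreal_mult'[symmetric] ennreal_leI mult_right_mono)
      also have "\<dots> = ennreal C * (\<integral>\<^sup>+x. ennreal (norm (d k x - p' x)) \<partial>lborel)"
        using d[of k] p'(1) by (intro nn_integral_cmult) auto
      finally show ?thesis .
    qed
    have "(\<lambda>k. ennreal C * (\<integral>\<^sup>+x. ennreal (norm (d k x - p' x)) \<partial>lborel)) \<longlonglongrightarrow> ennreal C * 0"
      by (intro ennreal_tendsto_cmult dlim') simp
    then have L: "(\<lambda>k. ennreal C * (\<integral>\<^sup>+x. ennreal (norm (d k x - p' x)) \<partial>lborel)) \<longlonglongrightarrow> 0" by simp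
    have "(\<lambda>k. ennreal (norm ((LINT x|lborel. \<phi> x *\<^sub>R d k x) - (LINT x|lborel. \<phi> x *\<^sub>R p' x)))) \<longlonglongrightarrow> 0"
      by (rule tendsto_sandwich[OF _ _ tendsto_const L]) (use le in auto)
    then have "(\<lambda>k. ennreal (norm ((LINT x|lborel. \<phi> x *\<^sub>R d k x) - (LINT x|lborel. \<phi> x *\<^sub>R p' x)))) \<longlonglongrightarrow> ennreal 0"
      by simp
    then show "(\<lambda>k. norm ((LINT x|lborel. \<phi> x *\<^sub>R d k x) - (LINT x|lborel. \<phi> x *\<^sub>R p' x))) \<longlonglongrightarrow> 0"
      by (subst (asm) tendsto_ennreal_iff) auto
  qed
  have lim2: "(\<lambda>k. LINT x|lborel. (1 / t k * (\<phi> (x - t k *\<^sub>R ?e) - \<phi> x)) *\<^sub>R w x) \<longlonglongrightarrow>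
      (LINT x|lborel. (- partial_dir \<phi> i x) *\<^sub>R w x)"
  proof (rule integral_dominated_convergence[where w="\<lambda>x. C * norm (w x)"])
    show "integrable lborel (\<lambda>x. C * norm (w x))" using w by simp
    show "AE x in lborel. (\<lambda>k. (1 / t k * (\<phi> (x - t k *\<^sub>R ?e) - \<phi> x)) *\<^sub>R w x) \<longlonglongrightarrow> (- partial_dir \<phi> i x) *\<^sub>R w x"
    proof (rule AE_I2)
      fix x
      \<comment> \<open>The test function has been moved backwards, so its quotient is taken along
        \<open>- t k\<close>.\<close>
      have "(\<lambda>k. - t k) \<longlonglongrightarrow> 0" using tendsto_minus[OF t(1)] by simp
      from has_vector_derivative_0_quotient[OF der[of x] this] t(2)
      have "(\<lambda>k. - (1 / t k * (\<phi> (x - t k *\<^sub>R ?e) - \<phi> x))) \<longlonglongrightarrow> partial_dir \<phi> i x" by simp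
      from tendsto_minus[OF this]
      have "(\<lambda>k. 1 / t k * (\<phi> (x - t k *\<^sub>R ?e) - \<phi> x)) \<longlonglongrightarrow> - partial_dir \<phi> i x" by simp
      then show "(\<lambda>k. (1 / t k * (\<phi> (x - t k *\<^sub>R ?e) - \<phi> x)) *\<^sub>R w x) \<longlonglongrightarrow> (- partial_dir \<phi> i x) *\<^sub>R w x"
        by (intro tendsto_intros)
    qed
    show "AE x in lborel. norm ((1 / t k * (\<phi> (x - t k *\<^sub>R ?e) - \<phi> x)) *\<^sub>R w x) \<le> C * norm (w x)" for k
    proof (rule AE_I2)
      fix x
      have "\<bar>1 / t k * (\<phi> (x - t k *\<^sub>R ?e) - \<phi> x)\<bar> \<le> C"
        using lip[of x "- t k"] t(2)[of k] by (simp add: abs_mult field_simps)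
      then show "norm ((1 / t k * (\<phi> (x - t k *\<^sub>R ?e) - \<phi> x)) *\<^sub>R w x) \<le> C * norm (w x)"
        unfolding norm_scaleR by (rule mult_right_mono) simp
    qed
  qed measurable
  \<comment> \<open>Once \<open>\<bar>t k\<bar> < r\<close>, the shifted points of \<open>K\<close>
    stay in \<open>K'\<close>, where \<open>w\<close> agrees with \<open>u\<close>.\<close>
  have "\<forall>\<^sub>F k in sequentially. \<bar>t k\<bar> < r"
    using t(1) rV(1) by (auto simp: tendsto_iff)
  then have ev: "\<forall>\<^sub>F k in sequentially. (LINT x|lborel. \<phi> x *\<^sub>R d k x) =
      (LINT x|lborel. (1 / t k * (\<phi> (x - t k *\<^sub>R ?e) - \<phi> x)) *\<^sub>R w x)"
  proof eventually_elim
    case (elim k)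
    have "\<phi> x *\<^sub>R d k x = (1 / t k) *\<^sub>R (\<phi> x *\<^sub>R w (x + t k *\<^sub>R ?e) - \<phi> x *\<^sub>R w x)" for x
    proof (cases "x \<in> K")
      case True
      then have "x + t k *\<^sub>R ?e \<in> K'" "x \<in> K'"
        using KK'[OF True, of "t k *\<^sub>R ?e"] KK'[OF True, of 0] elim rV(1) by auto
      then show ?thesis using True by (simp add: d_def w_def scaleR_diff_right mult.commute)
    qed (simp add: \<phi>0)
    moreover have i1: "integrable lborel (\<lambda>x. \<phi> x *\<^sub>R w (x + t k *\<^sub>R ?e))"
      using w by (intro integrable_scaleR_bounded[OF _ _ C(1)]) (auto simp: integrable_lborel_translate)
    moreover have i2: "integrable lborel (\<lambda>x. \<phi> x *\<^sub>R w x)"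
      by (intro integrable_scaleR_bounded[OF w _ C(1)]) auto
    moreover have i3: "integrable lborel (\<lambda>x. \<phi> (x - t k *\<^sub>R ?e) *\<^sub>R w x)"
      by (intro integrable_scaleR_bounded[OF w _ C(1)]) auto
    moreover have "(LINT x|lborel. \<phi> x *\<^sub>R w (x + t k *\<^sub>R ?e)) = (LINT x|lborel. \<phi> (x - t k *\<^sub>R ?e) *\<^sub>R w x)"
      using integral_lborel_translate[of "\<lambda>x. \<phi> (x - t k *\<^sub>R ?e) *\<^sub>R w x" "t k *\<^sub>R ?e"] by simp
    ultimately have "(LINT x|lborel. \<phi> x *\<^sub>R d k x) = (1 / t k) *\<^sub>R ((LINT x|lborel. \<phi> (x - t k *\<^sub>R ?e) *\<^sub>R w x) - (LINT x|lborel. \<phi> x *\<^sub>R w x))"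
      by simp
    also have "\<dots> = (LINT x|lborel. (1 / t k) *\<^sub>R (\<phi> (x - t k *\<^sub>R ?e) *\<^sub>R w x - \<phi> x *\<^sub>R w x))"
      using i2 i3 by simp
    finally show ?case by (simp add: scaleR_diff_left[symmetric])
  qed
  have "(\<lambda>k. LINT x|lborel. \<phi> x *\<^sub>R d k x) \<longlonglongrightarrow> (LINT x|lborel. (- partial_dir \<phi> i x) *\<^sub>R w x)"
    using lim2 by (rule Lim_transform_eventually) (use ev in \<open>auto elim: eventually_mono\<close>)
  with lim1 have eq: "(LINT x|lborel. \<phi> x *\<^sub>R p' x) = - (LINT x|lborel. partial_dir \<phi> i x *\<^sub>R w x)"
    by (simp add: LIMSEQ_unique)
  have iw: "integrable lborel (\<lambda>x. partial_dir \<phi> i x *\<^sub>R w x)"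
    by (intro integrable_scaleR_bounded[OF w _ C(2)]) auto
  have Ksub: "K \<subseteq> K'" using KK'[of _ 0] rV(1) by auto
  have "integral D (\<lambda>x. partial_dir \<phi> i x *\<^sub>R u x) = integral UNIV (\<lambda>x. partial_dir \<phi> i x *\<^sub>R w x)"
    using K(2) Ksub by (intro integral_eq_of_support[of K]) (auto simp: \<phi>0 w_def)
  also have "\<dots> = (LINT x|lborel. partial_dir \<phi> i x *\<^sub>R w x)"
    by (rule integral_lborel[OF iw])
  also have "\<dots> = - (LINT x|lborel. \<phi> x *\<^sub>R p' x)" by (simp add: eq)
  also have "(LINT x|lborel. \<phi> x *\<^sub>R p' x) = integral UNIV (\<lambda>x. \<phi> x *\<^sub>R p' x)"
    by (rule integral_lborel[OF \<phi>p, symmetric])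
  also have "\<dots> = integral UNIV (\<lambda>x. \<phi> x *\<^sub>R p x)"
  proof (rule integral_spike)
    show "negligible {x. \<not> p' x = indicator K x *\<^sub>R p x}"
      using p'(2) by (simp only: AE_lebesgue_iff_negligible)
    fix x assume "x \<in> UNIV - {x. \<not> p' x = indicator K x *\<^sub>R p x}"
    then show "\<phi> x *\<^sub>R p x = \<phi> x *\<^sub>R p' x"
      by (cases "x \<in> K") (auto simp: \<phi>0)
  qed
  also have "\<dots> = integral D (\<lambda>x. \<phi> x *\<^sub>R p x)"
    using K(2) by (intro integral_eq_of_support[symmetric, of K]) (auto simp: \<phi>0)
  finally show "integral D (\<lambda>x. partial_dir \<phi> i x *\<^sub>R u x) = - integral D (\<lambda>x. \<phi> x *\<^sub>R p x)" .
qed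

text \<open>Both candidates have the same integrals against bumps, so the fundamental lemma applies
  to their difference.\<close>

lemma weak_partial_unique:
  fixes g p :: "real^'n \<Rightarrow> real^'m"
  assumes D: "open D" and g: "weak_partial D f i g" and p: "weak_partial D f i p"
  shows "AE x in lebesgue. x \<in> D \<longrightarrow> g x = p x"
proof -
  have int: "h absolutely_integrable_on cbox a b" if "weak_partial D f i h" "cbox a b \<subseteq> D" for h a b
    using that by (simp add: weak_partial_def loc_integrable_def)
  have bint: "(\<lambda>x. bump a b m x *\<^sub>R h x) integrable_on cbox a b" if "weak_partial D f i h" "cbox a b \<subseteq> D" for h a b m
  proof -
    have "(\<lambda>x. bump a b m x *\<^sub>R h x) absolutely_integrable_on cbox a b"
      by (rule absolutely_integrable_on_bounded_scaleR[OF int[OF that]])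
         (use bump_bounds[of a b m] in \<open>auto intro!: continuous_imp_measurable_on_sets_lebesgue smooth_gen_continuous
           smooth_gen_bump boundedI[where B=1]\<close>)
    then show ?thesis by (rule set_lebesgue_integral_eq_integral(1))
  qed
  have "AE x in lebesgue. x \<in> D \<longrightarrow> g x - p x = 0"
  proof (rule AE_zero_of_zero_bump_integrals[OF D])
    fix a b m assume ab: "cbox a b \<subseteq> D"
    show "(\<lambda>x. g x - p x) absolutely_integrable_on cbox a b"
      using int[OF g ab] int[OF p ab] by (rule set_integral_diff(1))
    have eq: "integral D (\<lambda>x. bump a b m x *\<^sub>R h x) = integral (cbox a b) (\<lambda>x. bump a b m x *\<^sub>R h x)" for h :: "real^'n \<Rightarrow> real^'m"
    proof -
      have out: "bump a b m x = 0" if "x \<notin> cbox a b" for x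
        using that box_subset_cbox bump_outside by blast
      have "integral D (\<lambda>x. bump a b m x *\<^sub>R h x) = integral UNIV (\<lambda>x. bump a b m x *\<^sub>R h x)"
        using ab by (intro integral_eq_of_support[of "cbox a b"]) (auto simp: out)
      also have "\<dots> = integral (cbox a b) (\<lambda>x. bump a b m x *\<^sub>R h x)"
        by (intro integral_eq_of_support[symmetric, of "cbox a b"]) (auto simp: out)
      finally show ?thesis .
    qed
    have "integral D (\<lambda>x. bump a b m x *\<^sub>R g x) = integral D (\<lambda>x. bump a b m x *\<^sub>R p x)"
      using g p test_fun_bump[OF ab, of m] by (simp add: weak_partial_def)
    then show "integral (cbox a b) (\<lambda>x. bump a b m x *\<^sub>R (g x - p x)) = 0"
      unfolding eq scaleR_diff_right using bint[OF g ab] bint[OF p ab]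
      by (subst Henstock_Kurzweil_Integration.integral_diff) auto
  qed
  then show ?thesis by simp
qed

section \<open>Equi-integrable gradients and limits of maps\<close>

definition equi_int :: "(real^'n) set \<Rightarrow> ('j \<Rightarrow> real^'n \<Rightarrow> 'b::real_normed_vector) \<Rightarrow> bool" where
  "equi_int K h \<longleftrightarrow> (\<forall>e>0. \<exists>\<delta>>0. \<forall>j. \<forall>B\<in>sets lebesgue. B \<subseteq> K \<longrightarrow> emeasure lebesgue B < ennreal \<delta> \<longrightarrow>
     (\<integral>\<^sup>+x. indicator B x * ennreal (norm (h j x)) \<partial>lebesgue) \<le> ennreal e)"

text \<open>Absolute continuity of the integral, phrased for a constant family so that single
  functions and sequences fall under one notion.\<close>

lemma equi_int_single:
  assumes "h absolutely_integrable_on K"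
  shows "equi_int K (\<lambda>j. h)"
  unfolding equi_int_def
proof (intro allI impI)
  fix e :: real assume "e > 0"
  have int: "integrable lebesgue (\<lambda>x. indicator K x *\<^sub>R h x)"
    using assms by (simp add: set_integrable_def)
  have "\<exists>d>0. \<forall>B\<in>sets lebesgue. emeasure lebesgue B < ennreal d \<longrightarrow>
      (\<integral>\<^sup>+x. indicator B x * ennreal (norm (indicator K x *\<^sub>R h x)) \<partial>lebesgue) \<le> ennreal e"
  proof (rule nn_integral_absolute_continuity[OF _ _ \<open>e > 0\<close>])
    note [measurable] = borel_measurable_integrable[OF int]
    show "(\<lambda>x. ennreal (norm (indicator K x *\<^sub>R h x))) \<in> borel_measurable lebesgue" by measurable
    show "(\<integral>\<^sup>+x. ennreal (norm (indicator K x *\<^sub>R h x)) \<partial>lebesgue) < \<infinity>"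
      using int by (simp only: integrable_iff_bounded)
  qed
  then obtain d where d: "d > 0" "\<And>B. B \<in> sets lebesgue \<Longrightarrow> emeasure lebesgue B < ennreal d \<Longrightarrow>
      (\<integral>\<^sup>+x. indicator B x * ennreal (norm (indicator K x *\<^sub>R h x)) \<partial>lebesgue) \<le> ennreal e" by blast
  have "(\<integral>\<^sup>+x. indicator B x * ennreal (norm (h x)) \<partial>lebesgue) \<le> ennreal e"
    if "B \<in> sets lebesgue" "B \<subseteq> K" "emeasure lebesgue B < ennreal d" for B
  proof -
    have "(\<integral>\<^sup>+x. indicator B x * ennreal (norm (h x)) \<partial>lebesgue) =
        (\<integral>\<^sup>+x. indicator B x * ennreal (norm (indicator K x *\<^sub>R h x)) \<partial>lebesgue)"
      using that(2) by (intro nn_integral_cong) (auto split: split_indicator)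
    then show ?thesis using d(2) that by simp
  qed
  with d(1) show "\<exists>\<delta>>0. \<forall>j. \<forall>B\<in>sets lebesgue. B \<subseteq> K \<longrightarrow> emeasure lebesgue B < ennreal \<delta> \<longrightarrow>
     (\<integral>\<^sup>+x. indicator B x * ennreal (norm (h x)) \<partial>lebesgue) \<le> ennreal e"
    by blast
qed

text \<open>The integral over \<open>B\<close> of an increment of \<open>f\<close> is at most
  \<open>\<bar>t\<bar>\<close> times an average of integrals of \<open>norm (g i x)\<close> over
  translates of \<open>B\<close>, which have the same measure as \<open>B\<close>. Difference
  quotients therefore inherit the modulus of \<open>g i\<close>, uniformly in
  \<open>t\<close>.\<close>

lemma difference_quotient_bound:
  fixes f :: "real^'n \<Rightarrow> real^'m"
  assumes f: "continuous_on D f" and weak: "\<And>i. weak_partial D f i (g i)"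
    and V: "open V" and U: "U \<subseteq> K'" "compact K'" "K' \<subseteq> D"
    and VU: "\<And>x v. x \<in> V \<Longrightarrow> norm v < r \<Longrightarrow> x + v \<in> U"
    and small: "\<And>B. B \<in> sets lebesgue \<Longrightarrow> B \<subseteq> K' \<Longrightarrow> emeasure lebesgue B < ennreal \<delta> \<Longrightarrow>
      (\<integral>\<^sup>+x. indicator B x * ennreal (norm (g i x)) \<partial>lebesgue) \<le> ennreal e"
    and B: "B \<in> sets borel" "B \<subseteq> V" "emeasure lborel B < ennreal \<delta>" and t: "t \<noteq> 0" "\<bar>t\<bar> < r"
  shows "(\<integral>\<^sup>+x. indicator B x * ennreal (norm ((1 / t) *\<^sub>R (f (x + t *\<^sub>R axis i 1) - f x))) \<partial>lborel) \<le> ennreal e"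
proof -
  let ?v = "t *\<^sub>R axis i 1 :: real^'n"
  have nv: "norm ?v < r" using t by simp
  note [measurable] = B(1)
  obtain f' G where f': "integrable lborel f'" and G: "integrable lborel G"
    and eq: "\<And>x. x \<in> K' \<Longrightarrow> f' x = f x" and AEG: "AE x in lebesgue. x \<in> K' \<longrightarrow> G x = grad g x"
    and star: "\<And>v. norm v < r \<Longrightarrow> AE x in lborel. x \<in> V \<longrightarrow>
      integrable lborel (\<lambda>s. indicator {0..1} s *\<^sub>R G (x + s *\<^sub>R v)) \<and>
      f' (x + v) - f' x = (LINT s|lborel. indicator {0..1} s *\<^sub>R G (x + s *\<^sub>R v)) *v v"
    by (rule weak_partial_translation[OF f weak V U VU]) blast+
  note [measurable] = borel_measurable_integrable[OF G] borel_measurable_integrable[OF f']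
  have inK': "x \<in> K'" "x + ?v \<in> K'" if "x \<in> B" for x
  proof -
    have "x \<in> V" using that B(2) by auto
    moreover have "norm (0 :: real^'n) < r" using t by simp
    ultimately show "x \<in> K'" using VU[of x 0] U(1) by auto
    show "x + ?v \<in> K'" using VU[OF \<open>x \<in> V\<close> nv] U(1) by auto
  qed
  have inner: "(\<integral>\<^sup>+y. indicator B (y - s *\<^sub>R ?v) * ennreal (norm (G y *v ?v)) \<partial>lborel) \<le> ennreal \<bar>t\<bar> * ennreal e"
    if s: "0 \<le> s" "s \<le> 1" for s
  proof -
    let ?B = "(\<lambda>y. y - s *\<^sub>R ?v) -` B"
    have Bs [measurable]: "?B \<in> sets borel"
      using measurable_sets[of "\<lambda>y. y - s *\<^sub>R ?v" borel borel B] B(1) by simp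
    have sub: "?B \<subseteq> K'"
    proof
      fix y assume "y \<in> ?B"
      then have "y - s *\<^sub>R ?v \<in> V" using B(2) by auto
      moreover have "norm (s *\<^sub>R ?v) < r"
        using nv s mult_left_le_one_le[of "\<bar>t\<bar>" s] by (simp add: abs_mult)
      ultimately have "(y - s *\<^sub>R ?v) + s *\<^sub>R ?v \<in> U" by (rule VU)
      then show "y \<in> K'" using U(1) by auto
    qed
    have "emeasure lborel ?B = (\<integral>\<^sup>+y. indicator B (- (s *\<^sub>R ?v) + y) \<partial>lborel)"
    proof -
      have ind: "indicator B (- (s *\<^sub>R ?v) + y) = (indicator ?B y :: ennreal)" for y
        by (simp add: indicator_def)
      show ?thesis unfolding ind by (rule nn_integral_indicator[symmetric]) (use Bs in simp)
    qed
    also have "\<dots> = (\<integral>\<^sup>+y. indicator B y \<partial>lborel)"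
      by (rule nn_integral_lborel_translate) measurable
    finally have em: "emeasure lborel ?B = emeasure lborel B" by simp
    have "(\<integral>\<^sup>+y. indicator B (y - s *\<^sub>R ?v) * ennreal (norm (G y *v ?v)) \<partial>lborel) =
        (\<integral>\<^sup>+y. indicator B (y - s *\<^sub>R ?v) * ennreal (norm (G y *v ?v)) \<partial>lebesgue)"
      by (rule nn_integral_completion[symmetric])
    also have "\<dots> = (\<integral>\<^sup>+y. ennreal \<bar>t\<bar> * (indicator ?B y * ennreal (norm (G y *v axis i 1))) \<partial>lebesgue)"
      by (intro nn_integral_cong)
         (auto simp: matrix_vector_mult_scaleR ennreal_mult' mult_ac split: split_indicator)
    also have "\<dots> = ennreal \<bar>t\<bar> * (\<integral>\<^sup>+y. indicator ?B y * ennreal (norm (G y *v axis i 1)) \<partial>lebesgue)"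
      unfolding nn_integral_completion by (rule nn_integral_cmult) measurable
    also have "(\<integral>\<^sup>+y. indicator ?B y * ennreal (norm (G y *v axis i 1)) \<partial>lebesgue) =
        (\<integral>\<^sup>+y. indicator ?B y * ennreal (norm (g i y)) \<partial>lebesgue)"
      using AEG
    proof (intro nn_integral_cong_AE, eventually_elim)
      case (elim y)
      then show ?case using sub by (cases "y \<in> ?B") (auto simp: matrix_vector_mult_basis)
    qed
    also have "\<dots> \<le> ennreal e"
      using Bs sub em B(3) by (intro small) auto
    finally show ?thesis by (simp add: mult_left_mono)
  qed
  have "(\<integral>\<^sup>+x. indicator B x * ennreal (norm (f' (x + ?v) - f' x)) \<partial>lborel) \<le>
      (\<integral>\<^sup>+s. indicator {0..1::real} s * (\<integral>\<^sup>+y. indicator B (y - s *\<^sub>R ?v) * ennreal (norm (G y *v ?v)) \<partial>lborel) \<partial>lborel)"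
    by (rule translation_increment_bound[OF f' G star[OF nv] B(1,2)])
  also have "\<dots> \<le> (\<integral>\<^sup>+s. indicator {0..1::real} s * (ennreal \<bar>t\<bar> * ennreal e) \<partial>lborel)"
    using inner by (intro nn_integral_mono) (auto split: split_indicator)
  also have "\<dots> = ennreal \<bar>t\<bar> * ennreal e" by (simp add: nn_integral_multc)
  finally have le: "(\<integral>\<^sup>+x. indicator B x * ennreal (norm (f' (x + ?v) - f' x)) \<partial>lborel) \<le> ennreal \<bar>t\<bar> * ennreal e" .
  have "(\<integral>\<^sup>+x. indicator B x * ennreal (norm ((1 / t) *\<^sub>R (f (x + ?v) - f x))) \<partial>lborel) =
      (\<integral>\<^sup>+x. ennreal (1 / \<bar>t\<bar>) * (indicator B x * ennreal (norm (f' (x + ?v) - f' x))) \<partial>lborel)"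
  proof (rule nn_integral_cong)
    fix x
    have "ennreal (norm ((1 / t) *\<^sub>R w)) = ennreal (1 / \<bar>t\<bar>) * ennreal (norm w)" for w :: "real^'m"
      by (subst ennreal_mult[symmetric]) auto
    then show "indicator B x * ennreal (norm ((1 / t) *\<^sub>R (f (x + ?v) - f x))) =
        ennreal (1 / \<bar>t\<bar>) * (indicator B x * ennreal (norm (f' (x + ?v) - f' x)))"
      using inK'[of x] eq by (cases "x \<in> B") auto
  qed
  also have "\<dots> = ennreal (1 / \<bar>t\<bar>) * (\<integral>\<^sup>+x. indicator B x * ennreal (norm (f' (x + ?v) - f' x)) \<partial>lborel)"
    by (rule nn_integral_cmult) measurable
  also have "\<dots> \<le> ennreal (1 / \<bar>t\<bar>) * (ennreal \<bar>t\<bar> * ennreal e)"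
    by (intro mult_left_mono le) simp
  also have "\<dots> = ennreal e"
    using t(1) by (simp add: mult.assoc[symmetric] ennreal_mult'[symmetric])
  finally show ?thesis .
qed

text \<open>No convergence of derivatives enters. At a fixed \<open>t\<close> the quotients of
  \<open>fs j\<close> converge pointwise to those of \<open>f\<close>, and Fatou's lemma transfers
  their common modulus; with equi-integrable quotients the classical derivatives of \<open>f\<close>
  are weak ones.\<close>

lemma weak_partial_limit:
  fixes f :: "real^'n \<Rightarrow> real^'m" and fs :: "nat \<Rightarrow> real^'n \<Rightarrow> real^'m"
  assumes D: "open D" and fs: "\<And>j. continuous_on D (fs j)" and weak: "\<And>j i. weak_partial D (fs j) i (g j i)"
    and f: "continuous_on D f" and conv: "\<And>x. x \<in> D \<Longrightarrow> (\<lambda>j. fs j x) \<longlonglongrightarrow> f x"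
    and equi: "\<And>K. compact K \<Longrightarrow> K \<subseteq> D \<Longrightarrow> equi_int K (\<lambda>j. g j i)"
    and diff: "AE x in lebesgue. x \<in> D \<longrightarrow> ((\<lambda>t. f (x + t *\<^sub>R axis i 1)) has_vector_derivative p x) (at 0)"
  shows "weak_partial D f i p"
proof (rule classical_partial_weak_partial[OF D f diff])
  fix K assume K: "compact K" "K \<subseteq> D"
  obtain r V U K' where rV: "r > 0" "open V" "K \<subseteq> V" and U: "U \<subseteq> K'" "compact K'" "K' \<subseteq> D"
    and VU: "\<And>x v. x \<in> V \<Longrightarrow> norm v < r \<Longrightarrow> x + v \<in> U"
    using compact_nested_neighbourhoods[OF K(1) D K(2)] by metis
  have inD: "x + t *\<^sub>R axis i 1 \<in> D" if "x \<in> K" "\<bar>t\<bar> < r" for x t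
    using VU[of x "t *\<^sub>R axis i 1"] that rV(3) U by auto
  have quot: "\<exists>\<delta>>0. \<forall>B\<in>sets borel. B \<subseteq> K \<longrightarrow> emeasure lborel B < ennreal \<delta> \<longrightarrow>
       (\<forall>t. t \<noteq> 0 \<longrightarrow> \<bar>t\<bar> < r \<longrightarrow>
        (\<integral>\<^sup>+x. indicator B x * ennreal (norm ((1 / t) *\<^sub>R (f (x + t *\<^sub>R axis i 1) - f x))) \<partial>lborel) \<le> ennreal e)"
    if "e > 0" for e
  proof -
    obtain \<delta> where \<delta>: "\<delta> > 0" "\<And>j B. B \<in> sets lebesgue \<Longrightarrow> B \<subseteq> K' \<Longrightarrow> emeasure lebesgue B < ennreal \<delta> \<Longrightarrow>
      (\<integral>\<^sup>+x. indicator B x * ennreal (norm (g j i x)) \<partial>lebesgue) \<le> ennreal e"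
    proof -
      note equi[OF U(2,3), unfolded equi_int_def, rule_format, OF \<open>e > 0\<close>]
      then show ?thesis using that by blast
    qed
    show ?thesis
    proof (intro exI[of _ \<delta>] conjI ballI impI allI \<delta>(1))
      fix B t assume B: "B \<in> sets borel" "B \<subseteq> K" "emeasure lborel B < ennreal \<delta>" and t: "t \<noteq> 0" "\<bar>t\<bar> < r"
      let ?v = "t *\<^sub>R axis i 1 :: real^'n"
      define w where "w j x = indicator B x * ennreal (norm ((1 / t) *\<^sub>R (fs j (x + ?v) - fs j x)))" for j x
      have wm: "w j \<in> borel_measurable lborel" for j
      proof -
        have "continuous_on K (\<lambda>x. fs j (x + ?v))"
          by (rule continuous_on_compose2[OF fs]) (use inD t(2) in \<open>auto intro!: continuous_intros\<close>)
        then have "continuous_on K (\<lambda>x. (1 / t) *\<^sub>R (fs j (x + ?v) - fs j x))"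
          using continuous_on_subset[OF fs K(2)] by (intro continuous_intros)
        then have "integrable lborel (\<lambda>x. indicator K x *\<^sub>R ((1 / t) *\<^sub>R (fs j (x + ?v) - fs j x)))"
          by (rule borel_integrable_compact[OF K(1)])
        then have [measurable]: "(\<lambda>x. indicator K x *\<^sub>R ((1 / t) *\<^sub>R (fs j (x + ?v) - fs j x))) \<in> borel_measurable lborel"
          by auto
        note [measurable] = B(1)
        have "w j = (\<lambda>x. indicator B x * ennreal (norm (indicator K x *\<^sub>R ((1 / t) *\<^sub>R (fs j (x + ?v) - fs j x)))))"
          using B(2) by (auto simp: w_def fun_eq_iff split: split_indicator)
        then show ?thesis by (simp only:) measurable
      qed
      have "(\<integral>\<^sup>+x. indicator B x * ennreal (norm ((1 / t) *\<^sub>R (f (x + ?v) - f x))) \<partial>lborel) = (\<integral>\<^sup>+x. liminf (\<lambda>j. w j x) \<partial>lborel)"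
      proof (rule nn_integral_cong)
        fix x
        have "(\<lambda>j. w j x) \<longlonglongrightarrow> indicator B x * ennreal (norm ((1 / t) *\<^sub>R (f (x + ?v) - f x)))"
        proof (cases "x \<in> B")
          case True
          then have "x \<in> D" "x + ?v \<in> D" using B(2) K(2) inD[of x t] t by auto
          then show ?thesis unfolding w_def using True t(1)
            by (auto intro!: tendsto_ennrealI tendsto_intros conv)
        qed (simp add: w_def)
        then show "indicator B x * ennreal (norm ((1 / t) *\<^sub>R (f (x + ?v) - f x))) = liminf (\<lambda>j. w j x)"
          by (simp add: lim_imp_Liminf)
      qed
      also have "\<dots> \<le> liminf (\<lambda>j. \<integral>\<^sup>+x. w j x \<partial>lborel)"
        by (rule nn_integral_liminf[OF wm])
      also have "\<dots> \<le> limsup (\<lambda>j. \<integral>\<^sup>+x. w j x \<partial>lborel)"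
        by (rule Liminf_le_Limsup) simp
      also have "\<dots> \<le> ennreal e"
      proof (rule Limsup_bounded, rule always_eventually, rule allI)
        fix j
        have "B \<subseteq> V" using B(2) rV(3) by auto
        then show "(\<integral>\<^sup>+x. w j x \<partial>lborel) \<le> ennreal e"
          unfolding w_def by (intro difference_quotient_bound[OF fs weak rV(2) U VU \<delta>(2) B(1) _ B(3) t])
      qed
      finally show "(\<integral>\<^sup>+x. indicator B x * ennreal (norm ((1 / t) *\<^sub>R (f (x + ?v) - f x))) \<partial>lborel) \<le> ennreal e" .
    qed
  qed
  show "\<exists>\<rho>>0. (\<forall>x\<in>K. \<forall>t. \<bar>t\<bar> < \<rho> \<longrightarrow> x + t *\<^sub>R axis i 1 \<in> D) \<and>
       (\<forall>e>0. \<exists>\<delta>>0. \<forall>B\<in>sets borel. B \<subseteq> K \<longrightarrow> emeasure lborel B < ennreal \<delta> \<longrightarrow>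
       (\<forall>t. t \<noteq> 0 \<longrightarrow> \<bar>t\<bar> < \<rho> \<longrightarrow>
        (\<integral>\<^sup>+x. indicator B x * ennreal (norm ((1 / t) *\<^sub>R (f (x + t *\<^sub>R axis i 1) - f x))) \<partial>lborel) \<le> ennreal e))"
    apply (rule exI[of _ r])
    apply (intro conjI rV(1))
    using inD apply blast
    apply (intro allI impI)
    apply (rule quot)
    apply assumption
    done
qed

text \<open>The link between the classical derivatives in \<open>P_dil\<close> and the weak ones in
  the area inequality. For the constant sequence, \<open>weak_partial_limit\<close> shows that
  classical derivatives are weak derivatives, and these are unique.\<close>

lemma weak_partial_eq_partial_dir:
  fixes f :: "real^'n \<Rightarrow> real^'m"
  assumes D: "open D" and f: "continuous_on D f" and weak: "\<And>i. weak_partial D f i (g i)"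
    and part: "AE x in lebesgue. x \<in> D \<longrightarrow> has_all_partials f x"
  shows "AE x in lebesgue. x \<in> D \<longrightarrow> (\<forall>i. g i x = partial_dir f i x)"
proof -
  have "AE x in lebesgue. x \<in> D \<longrightarrow> g i x = partial_dir f i x" for i
  proof (rule weak_partial_unique[OF D weak])
    show "weak_partial D f i (partial_dir f i)"
    proof (rule weak_partial_limit[where fs="\<lambda>j. f" and g="\<lambda>j. g", OF D f weak f])
      show "equi_int K (\<lambda>j. g i)" if "compact K" "K \<subseteq> D" for K
        using weak[of i] that by (intro equi_int_single) (simp add: weak_partial_def loc_integrable_def)
      show "AE x in lebesgue. x \<in> D \<longrightarrow> ((\<lambda>t. f (x + t *\<^sub>R axis i 1)) has_vector_derivative partial_dir f i x) (at 0)"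
        using part by eventually_elim (simp add: has_all_partials_has_vector_derivative)
    qed simp
  qed
  then have "AE x in lebesgue. \<forall>i. x \<in> D \<longrightarrow> g i x = partial_dir f i x"
    by (intro AE_finite_allI[of UNIV, simplified]) auto
  then show ?thesis by eventually_elim blast
qed

section \<open>The distortion inequality\<close>

text \<open>A linear map sends the unit ball into the ball whose radius is its operator norm;
  volumes are compared. This is why dilatations are at least 1.\<close>

lemma abs_det_le_onorm_power:
  fixes A :: "real^'n^'n"
  shows "\<bar>det A\<bar> \<le> onorm ((*v) A) ^ CARD('n)"
proof (cases "det A = 0")
  case True
  then show ?thesis by (simp add: onorm_pos_le)
next
  case False
  let ?B = "cball 0 1 :: (real^'n) set" and ?N = "onorm ((*v) A)"
  let ?c = "unit_ball_vol (real CARD('n))"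
  have inj: "inj_on ((*v) A) ?B"
    using False by (meson inj_matrix_vector_mult inj_on_subset invertible_det_nz subset_UNIV)
  have der: "((*v) A has_derivative (*v) A) (at x within S)" for x S
    by (simp add: bounded_linear_imp_has_derivative)
  have bdd: "bounded ((*v) A ` ?B)"
    by (rule bounded_linear_image) auto
  have "(\<integral>\<^sup>+x. ennreal \<bar>det A\<bar> * indicator ?B x \<partial>lborel) = emeasure lebesgue ((*v) A ` ?B)"
    by (rule measure_image_has_derivative(2)[OF _ _ der inj bdd]) auto
  then have "ennreal \<bar>det A\<bar> * emeasure lborel ?B = emeasure lebesgue ((*v) A ` ?B)"
    by (simp add: nn_integral_cmult_indicator)
  also have "\<dots> \<le> emeasure lebesgue (cball 0 ?N :: (real^'n) set)"
  proof (rule emeasure_mono)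
    show "(*v) A ` ?B \<subseteq> cball 0 ?N"
    proof
      fix y assume "y \<in> (*v) A ` ?B"
      then obtain x where x: "y = A *v x" "norm x \<le> 1" by auto
      have "norm (A *v x) \<le> ?N * norm x" by (rule onorm) simp
      also have "\<dots> \<le> ?N * 1" using x(2) by (intro mult_left_mono onorm_pos_le) simp_all
      finally show "y \<in> cball 0 ?N" using x by simp
    qed
  qed simp
  also have "\<dots> = emeasure lborel (cball 0 ?N :: (real^'n) set)" by simp
  finally have "ennreal \<bar>det A\<bar> * ennreal (?c * 1 ^ CARD('n)) \<le> ennreal (?c * ?N ^ CARD('n))"
    by (simp only: emeasure_cball onorm_pos_le zero_le_one DIM_cart DIM_real mult_1_right matrix_vector_mul_bounded_linear)
  then have "\<bar>det A\<bar> * ?c \<le> ?c * ?N ^ CARD('n)"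
    by (simp add: ennreal_mult'[symmetric] ennreal_le_iff onorm_pos_le)
  then show ?thesis
    using unit_ball_vol_pos[of "real CARD('n)"] by (simp add: mult.commute)
qed

lemma onorm_matrix_eq_0_iff: "onorm ((*v) A) = 0 \<longleftrightarrow> A = 0" for A :: "real^'n^'m"
proof -
  have "onorm ((*v) A) = 0 \<longleftrightarrow> (\<forall>x. A *v x = 0)" by (rule onorm_eq_0) simp
  also have "\<dots> \<longleftrightarrow> A = 0" by (simp add: matrix_eq)
  finally show ?thesis .
qed

text \<open>The two nested case distinctions are merged: the exponent acts on finite values only,
  and it fixes the value 1.\<close>

lemma P_dil_alt:
  "P_dil f (x :: real^'n) =
    (if has_all_partials f x \<and> det (jac f x) \<noteq> 0
     then ereal ((onorm ((*v) (jac f x)) ^ CARD('n) / \<bar>det (jac f x)\<bar>) powr (1 / (real CARD('n) - 1)))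
     else if has_all_partials f x \<and> jac f x = 0 then 1 else \<infinity>)"
proof (cases "has_all_partials f x \<and> det (jac f x) \<noteq> 0")
  case True
  then show ?thesis by (simp add: P_dil_def K_dil_def)
next
  case False
  have K: "K_dil f x = (if has_all_partials f x \<and> jac f x = 0 then ereal 1 else \<infinity>)"
  proof (cases "has_all_partials f x")
    case True
    with False have "\<not> (det (jac f x) \<noteq> 0)" by blast
    with True show ?thesis
      by (simp only: K_dil_def one_ereal_def if_True if_False simp_thms)
  qed (simp add: K_dil_def)
  have "P_dil f x = (if has_all_partials f x \<and> jac f x = 0 then 1 else \<infinity>)"
    unfolding P_dil_def K by (simp add: one_ereal_def)
  then show ?thesis by (simp only: False if_False)
qed

lemma P_dil_ge_1:
  assumes "CARD('n) \<ge> 2"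
  shows "1 \<le> P_dil f (x :: real^'n)"
proof -
  let ?J = "jac f x" and ?n = "CARD('n)"
  have pos: "1 / (real ?n - 1) \<ge> 0" using assms by simp
  have "1 \<le> (onorm ((*v) ?J) ^ ?n / \<bar>det ?J\<bar>) powr (1 / (real ?n - 1))" if "det ?J \<noteq> 0"
  proof -
    have "1 \<le> onorm ((*v) ?J) ^ ?n / \<bar>det ?J\<bar>"
      using abs_det_le_onorm_power[of ?J] that by simp
    then show ?thesis using pos by (rule ge_one_powr_ge_zero)
  qed
  then show ?thesis unfolding P_dil_alt by (simp add: one_ereal_def)
qed

text \<open>This polynomial form includes the degenerate case: if the determinant is 0, finiteness
  of the dilatation forces the matrix to vanish, and both sides are 0.\<close>

lemma P_dil_leD:
  assumes n: "CARD('n) \<ge> 2" and le: "P_dil f (x :: real^'n) \<le> ereal P"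
  shows "has_all_partials f x" "1 \<le> P"
    "onorm ((*v) (jac f x)) ^ CARD('n) \<le> P ^ (CARD('n) - 1) * \<bar>det (jac f x)\<bar>"
proof -
  let ?J = "jac f x" and ?n = "CARD('n)"
  let ?N = "onorm ((*v) ?J)"
  have "1 \<le> ereal P" using P_dil_ge_1[OF n] le by (rule order_trans)
  then show P1: "1 \<le> P" by (simp add: one_ereal_def)
  have fin: "P_dil f x \<noteq> \<infinity>" using le by auto
  then show "has_all_partials f x" unfolding P_dil_alt by meson
  show "?N ^ ?n \<le> P ^ (?n - 1) * \<bar>det ?J\<bar>"
  proof (cases "det ?J = 0")
    case True
    then have "?J = 0" using fin unfolding P_dil_alt by meson
    then have "?N = 0" by (simp only: onorm_matrix_eq_0_iff)
    then show ?thesis using True by (simp add: zero_power)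
  next
    case False
    define k where "k = ?N ^ ?n / \<bar>det ?J\<bar>"
    have k1: "1 \<le> k" unfolding k_def using abs_det_le_onorm_power[of ?J] False by simp
    have "has_all_partials f x" using fin unfolding P_dil_alt by meson
    then have "P_dil f x = ereal (k powr (1 / (real ?n - 1)))" using False by (simp add: P_dil_alt k_def)
    then have "k powr (1 / (real ?n - 1)) \<le> P" using le by simp
    then have "(k powr (1 / (real ?n - 1))) powr (real ?n - 1) \<le> P powr (real ?n - 1)"
      using n by (intro powr_mono2) auto
    also have "(k powr (1 / (real ?n - 1))) powr (real ?n - 1) = k"
      using n k1 by (simp add: powr_powr)
    also have "P powr (real ?n - 1) = P ^ (?n - 1)"
      using n P1 by (subst powr_realpow[symmetric]) (auto simp: of_nat_diff)
    finally show ?thesis using False by (simp add: k_def divide_le_eq)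
  qed
qed

text \<open>Where the matrix vanishes the dilatation is 1 by convention; that is where
  \<open>1 \<le> q\<close> enters.\<close>

lemma P_dil_leI:
  assumes n: "CARD('n) \<ge> 2" and part: "has_all_partials f (x :: real^'n)" and q: "1 \<le> q"
    and le: "onorm ((*v) (jac f x)) ^ CARD('n) \<le> q ^ (CARD('n) - 1) * \<bar>det (jac f x)\<bar>"
  shows "P_dil f x \<le> ereal q"
proof (cases "det (jac f x) = 0")
  case True
  let ?N = "onorm ((*v) (jac f x))"
  have "?N ^ CARD('n) \<le> 0" using le True by simp
  moreover have "0 \<le> ?N" by (simp add: onorm_pos_le)
  ultimately have "?N = 0" by (metis antisym zero_le_power power_eq_0_iff)
  then have "jac f x = 0" by (simp only: onorm_matrix_eq_0_iff)
  then have "P_dil f x = 1" using part True by (simp add: P_dil_alt)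
  then show ?thesis using q by (simp add: one_ereal_def)
next
  case False
  let ?n = "CARD('n)"
  define k where "k = onorm ((*v) (jac f x)) ^ ?n / \<bar>det (jac f x)\<bar>"
  have k0: "0 \<le> k" unfolding k_def by (simp add: onorm_pos_le)
  have "k \<le> q ^ (?n - 1)" using le False by (simp add: k_def divide_le_eq)
  then have "k powr (1 / (real ?n - 1)) \<le> (q ^ (?n - 1)) powr (1 / (real ?n - 1))"
    using n k0 by (intro powr_mono2) auto
  also have "\<dots> = q"
    using n q by (subst powr_realpow[symmetric]) (auto simp: powr_powr of_nat_diff)
  finally show ?thesis using part False by (simp add: P_dil_alt k_def)
qed

text \<open>The weighted arithmetic-geometric mean inequality for \<open>l * P\<close> and
  \<open>J / l ^ (n - 1)\<close> with weights \<open>(n - 1) / n\<close> and \<open>1 / n\<close>;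
  the powers of \<open>l\<close> cancel in the geometric mean. It is applied to positive arguments,
  so \<open>J = 0\<close> is treated by hand.\<close>

lemma young_power:
  fixes N P J l :: real
  assumes "n \<ge> 1" "0 \<le> N" "0 < P" "0 \<le> J" "0 < l" and le: "N ^ n \<le> P ^ (n - 1) * J"
  shows "N \<le> (real n - 1) / real n * (l * P) + 1 / real n * (J / l ^ (n - 1))"
proof (cases "J = 0")
  case True
  then have "N ^ n \<le> 0" using le by simp
  then have "N = 0" using assms(1,2) by (metis antisym zero_le_power power_eq_0_iff)
  then show ?thesis using assms by simp
next
  case False
  then have J: "J > 0" using assms by simp
  let ?a = "l * P" and ?b = "J / l ^ (n - 1)"
  have ab: "?a > 0" "?b > 0" using assms J by auto
  have "N = (N ^ n) powr (1 / real n)"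
  proof (cases "N = 0")
    case False
    then show ?thesis using assms by (simp add: powr_realpow[symmetric] powr_powr)
  qed (use assms in simp)
  also have "\<dots> \<le> (P ^ (n - 1) * J) powr (1 / real n)"
    using assms by (intro powr_mono2 le) auto
  also have "P ^ (n - 1) * J = ?a ^ (n - 1) * ?b"
    using assms by (simp add: power_mult_distrib)
  also have "(?a ^ (n - 1) * ?b) powr (1 / real n) = ?a powr ((real n - 1) / real n) * ?b powr (1 / real n)"
  proof -
    have "(a ^ (n - 1)) powr (1 / real n) = a powr ((real n - 1) / real n)" if "a > 0" for a :: real
      using that assms(1) by (simp add: powr_realpow[symmetric] powr_powr of_nat_diff)
    from this[OF ab(1)] show ?thesis
      using ab by (subst powr_mult) auto
  qed
  also have "\<dots> \<le> (real n - 1) / real n * ?a + 1 / real n * ?b"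
    using assms(1) ab by (intro Youngs_inequality_0) (auto simp: field_simps)
  finally show ?thesis .
qed

text \<open>The right side is smallest when \<open>l * q\<close> and \<open>J / l ^ (n - 1)\<close>
  agree, that is for \<open>l ^ n = J / q\<close>. For \<open>J = 0\<close> there is no minimiser,
  and \<open>l\<close> tends to 0 instead.\<close>

lemma young_power_converse:
  fixes N q J :: real
  assumes "n \<ge> 2" "0 \<le> N" "0 < q" "0 \<le> J"
    and le: "\<And>l. 0 < l \<Longrightarrow> N \<le> (real n - 1) / real n * (l * q) + 1 / real n * (J / l ^ (n - 1))"
  shows "N ^ n \<le> q ^ (n - 1) * J"
proof (cases "J = 0")
  case True
  have "N \<le> 0 + e" if "e > 0" for e
  proof -
    have "N \<le> (real n - 1) / real n * ((e / q) * q)"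
      using le[of "e / q"] True assms(3) that by simp
    also have "\<dots> \<le> 1 * e" using assms that by (intro mult_mono) auto
    finally show ?thesis by simp
  qed
  then have "N \<le> 0" by (rule field_le_epsilon)
  then show ?thesis using assms True by (simp add: zero_power)
next
  case False
  then have J: "J > 0" using assms by simp
  define l where "l = root n (J / q)"
  have l: "l > 0" "l ^ n = J / q"
    using J assms unfolding l_def by (auto intro!: real_root_pow_pos)
  have "J / l ^ (n - 1) = q * (l ^ n / l ^ (n - 1))" using l(2) assms(3) by simp
  also have "l ^ n / l ^ (n - 1) = l"
    using l(1) assms(1) by (cases n) auto
  finally have "J / l ^ (n - 1) = q * l" .
  then have "N \<le> (real n - 1) / real n * (l * q) + 1 / real n * (l * q)"
    using le[OF l(1)] by (simp add: mult.commute)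
  also have "\<dots> = l * q" using assms(1) by (simp add: field_simps)
  finally have "N ^ n \<le> (l * q) ^ n" using assms by (intro power_mono) auto
  also have "\<dots> = J / q * q ^ n" by (simp add: power_mult_distrib l)
  also have "\<dots> = q ^ (n - 1) * J" using assms by (cases n) auto
  finally show ?thesis .
qed

lemma norm_column_le_onorm: "norm (column i A) \<le> onorm ((*v) A)" for A :: "real^'n^'m"
proof -
  have "norm (A *v axis i 1) \<le> onorm ((*v) A) * norm (axis i 1 :: real^'n)" by (rule onorm) simp
  then show ?thesis by (simp add: matrix_vector_mult_basis)
qed

lemma grad_eq_jac: "(\<And>i. g i x = partial_dir f i x) \<Longrightarrow> grad g x = jac f x"
  by (simp add: grad_def jac_def)

text \<open>The distortion inequality trades the gradient for \<open>P\<close> and the Jacobian, whose integral is a volume.\<close>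

lemma gradient_integral_bound:
  fixes f :: "real^'n \<Rightarrow> real^'n"
  assumes D: "open D" and f: "continuous_on D f" "inj_on f D" and weak: "\<And>i. weak_partial D f i (g i)"
    and P: "P absolutely_integrable_on K"
    and dist: "AE x in lebesgue. x \<in> D \<longrightarrow> 1 \<le> P x \<and>
      onorm ((*v) (grad g x)) ^ CARD('n) \<le> P x ^ (CARD('n) - 1) * \<bar>det (grad g x)\<bar>"
    and K: "compact K" "K \<subseteq> D" and B: "B \<in> sets lebesgue" "B \<subseteq> K" and l: "l > 0"
    and w: "\<And>x. w x \<le> onorm ((*v) (grad g x))"
  shows "(\<integral>\<^sup>+x. indicator B x * ennreal (w x) \<partial>lebesgue) \<le>
    ennreal ((real CARD('n) - 1) / real CARD('n) * l) * (\<integral>\<^sup>+x. indicator B x * ennreal (P x) \<partial>lebesgue) +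
    ennreal (1 / (real CARD('n) * l ^ (CARD('n) - 1))) * emeasure lborel (f ` K)"
proof -
  let ?n = "CARD('n)"
  let ?a = "(real ?n - 1) / real ?n * l" and ?b = "1 / (real ?n * l ^ (?n - 1))"
  have n1: "1 \<le> ?n" by (simp add: Suc_leI)
  have ab: "0 \<le> ?a" "0 \<le> ?b" using l n1 by auto
  have "integrable lebesgue (\<lambda>x. indicator K x *\<^sub>R P x)"
    using P by (simp add: set_integrable_def)
  then have Pm [measurable]: "(\<lambda>x. indicator K x *\<^sub>R P x) \<in> borel_measurable lebesgue" by auto
  have gi: "g i absolutely_integrable_on K" for i
    using weak[of i] K by (simp add: weak_partial_def loc_integrable_def)
  note [measurable] = borel_measurable_integrable[OF integrable_indicator_grad[OF gi]] B(1)
  \<comment> \<open>Measurability of \<open>P\<close> and of the gradient is known only on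
    \<open>K\<close>, so it is argued for their cut-offs, which agree with them on
    \<open>B\<close>.\<close>
  let ?P = "\<lambda>x. indicator K x *\<^sub>R P x" and ?J = "\<lambda>x. \<bar>det (indicator K x *\<^sub>R grad g x)\<bar>"
  have "(\<integral>\<^sup>+x. indicator B x * ennreal (w x) \<partial>lebesgue) \<le>
    (\<integral>\<^sup>+x. ennreal ?a * (indicator B x * ennreal (?P x)) + ennreal ?b * (ennreal (?J x) * indicator B x) \<partial>lebesgue)"
    using dist
  proof (intro nn_integral_mono_AE, eventually_elim)
    case (elim x)
    show ?case
    proof (cases "x \<in> B")
      case True
      then have x: "x \<in> K" "x \<in> D" using B K by auto
      have "w x \<le> (real ?n - 1) / real ?n * (l * P x) + 1 / real ?n * (\<bar>det (grad g x)\<bar> / l ^ (?n - 1))"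
        using elim x l n1 by (intro order_trans[OF w] young_power) (auto simp: onorm_pos_le)
      also have "\<dots> = ?a * P x + ?b * \<bar>det (grad g x)\<bar>" by simp
      finally have "ennreal (w x) \<le> ennreal (?a * P x + ?b * \<bar>det (grad g x)\<bar>)"
        by (rule ennreal_leI)
      also have "\<dots> = ennreal ?a * ennreal (P x) + ennreal ?b * ennreal \<bar>det (grad g x)\<bar>"
      proof -
        have "ennreal (u * c + v * d) = ennreal u * ennreal c + ennreal v * ennreal d"
          if "0 \<le> u" "0 \<le> v" "0 \<le> c" "0 \<le> d" for u v c d
          using that by (simp only: ennreal_plus ennreal_mult mult_nonneg_nonneg)
        then show ?thesis by this (use ab elim x in auto)
      qed
      finally show ?thesis using True x by simp
    qed simp
  qed
  also have "\<dots> = ennreal ?a * (\<integral>\<^sup>+x. indicator B x * ennreal (?P x) \<partial>lebesgue) + ennreal ?b * (\<integral>\<^sup>+x. ennreal (?J x) * indicator B x \<partial>lebesgue)"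
  proof -
    have m: "(\<lambda>x. indicator B x * ennreal (?P x)) \<in> borel_measurable lebesgue"
      "(\<lambda>x. ennreal (?J x) * indicator B x) \<in> borel_measurable lebesgue" by measurable
    have "(\<integral>\<^sup>+x. c1 * h1 x + c2 * h2 x \<partial>lebesgue) = c1 * (\<integral>\<^sup>+x. h1 x \<partial>lebesgue) + c2 * (\<integral>\<^sup>+x. h2 x \<partial>lebesgue)"
      if "h1 \<in> borel_measurable lebesgue" "h2 \<in> borel_measurable lebesgue" for c1 c2 and h1 h2 :: "real^'n \<Rightarrow> ennreal"
      using that by (simp add: nn_integral_add nn_integral_cmult)
    from this[OF m] show ?thesis .
  qed
  also have "\<dots> \<le> ennreal ?a * (\<integral>\<^sup>+x. indicator B x * ennreal (P x) \<partial>lebesgue) + ennreal ?b * emeasure lborel (f ` K)"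
  proof (intro add_mono mult_left_mono)
    have "(\<integral>\<^sup>+x. ennreal (?J x) * indicator B x \<partial>lebesgue) \<le> (\<integral>\<^sup>+x. ennreal \<bar>det (grad g x)\<bar> * indicator K x \<partial>lebesgue)"
    proof (rule nn_integral_mono)
      fix x
      show "ennreal (?J x) * indicator B x \<le> ennreal \<bar>det (grad g x)\<bar> * indicator K x"
        using B(2) by (cases "x \<in> B") auto
    qed
    also have "\<dots> \<le> emeasure lborel (f ` K)"
      by (rule weak_partial_area_inequality[OF D f weak K])
    finally show "(\<integral>\<^sup>+x. ennreal (?J x) * indicator B x \<partial>lebesgue) \<le> emeasure lborel (f ` K)" .
    show "(\<integral>\<^sup>+x. indicator B x * ennreal (?P x) \<partial>lebesgue) \<le> (\<integral>\<^sup>+x. indicator B x * ennreal (P x) \<partial>lebesgue)"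
    proof (rule nn_integral_mono)
      fix x
      show "indicator B x * ennreal (?P x) \<le> indicator B x * ennreal (P x)"
        using B(2) by (cases "x \<in> B") auto
    qed
  qed simp_all
  finally show ?thesis .
qed

text \<open>First \<open>l\<close> is taken so large that the Jacobian term, at most
  \<open>M / l\<close>, is below \<open>e / 2\<close>; this is where the dimension enters, since
  \<open>l ^ (CARD('n) - 1)\<close> has to dominate \<open>l\<close>. With \<open>l\<close> fixed,
  absolute continuity of the integral of \<open>P\<close> makes the other term small on small sets.
  The choice \<open>l = 1\<close> gives the uniform bound on the integrals.\<close>

lemma gradient_equi_int:
  fixes fs :: "nat \<Rightarrow> real^'n \<Rightarrow> real^'n"
  assumes n: "CARD('n) \<ge> 2" and D: "open D" and f: "\<And>j. continuous_on D (fs j)" "\<And>j. inj_on (fs j) D"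
    and weak: "\<And>j i. weak_partial D (fs j) i (g j i)" and P: "P absolutely_integrable_on K"
    and dist: "\<And>j. AE x in lebesgue. x \<in> D \<longrightarrow> 1 \<le> P x \<and>
      onorm ((*v) (grad (g j) x)) ^ CARD('n) \<le> P x ^ (CARD('n) - 1) * \<bar>det (grad (g j) x)\<bar>"
    and K: "compact K" "K \<subseteq> D" and M: "\<And>j. emeasure lborel (fs j ` K) \<le> ennreal M" "M > 0"
  shows "equi_int K (\<lambda>j. g j i)" and "\<exists>C. \<forall>j. (\<integral>\<^sup>+x. indicator K x * ennreal (norm (g j i x)) \<partial>lebesgue) \<le> ennreal C"
proof -
  let ?n = "CARD('n)"
  have Ks: "K \<in> sets lebesgue" using K(1) by (simp add: lmeasurable_compact fmeasurableD)
  have main: "(\<integral>\<^sup>+x. indicator B x * ennreal (norm (g j i x)) \<partial>lebesgue) \<le>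
      ennreal l * (\<integral>\<^sup>+x. indicator B x * ennreal (P x) \<partial>lebesgue) + ennreal (M / l)"
    if B: "B \<in> sets lebesgue" "B \<subseteq> K" and l: "l \<ge> 1" for B l j
  proof -
    have 1: "(\<integral>\<^sup>+x. indicator B x * ennreal (norm (g j i x)) \<partial>lebesgue) \<le>
      ennreal ((real ?n - 1) / real ?n * l) * (\<integral>\<^sup>+x. indicator B x * ennreal (P x) \<partial>lebesgue) +
      ennreal (1 / (real ?n * l ^ (?n - 1))) * emeasure lborel (fs j ` K)"
      using l norm_column_le_onorm[of i "grad (g j) _"]
      by (intro gradient_integral_bound[OF D f weak P dist K B]) auto
    have a: "(real ?n - 1) / real ?n * l \<le> l" using l n by (intro mult_left_le_one_le) auto
    have b: "1 / (real ?n * l ^ (?n - 1)) \<le> 1 / l"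
    proof (rule divide_left_mono)
      have "l ^ 1 \<le> l ^ (?n - 1)" using l n by (intro power_increasing) auto
      also have "\<dots> \<le> real ?n * l ^ (?n - 1)" using l n by simp
      finally show "l \<le> real ?n * l ^ (?n - 1)" by simp
    qed (use l n in auto)
    note 1
    also have "ennreal ((real ?n - 1) / real ?n * l) * (\<integral>\<^sup>+x. indicator B x * ennreal (P x) \<partial>lebesgue) +
      ennreal (1 / (real ?n * l ^ (?n - 1))) * emeasure lborel (fs j ` K) \<le>
      ennreal l * (\<integral>\<^sup>+x. indicator B x * ennreal (P x) \<partial>lebesgue) + ennreal (1 / l) * ennreal M"
      using a b M(1) by (intro add_mono mult_mono ennreal_leI) auto
    also have "ennreal (1 / l) * ennreal M = ennreal (M / l)"
      using l M(2) by (subst ennreal_mult[symmetric]) auto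
    finally show ?thesis .
  qed
  have Pfin: "(\<integral>\<^sup>+x. indicator K x * ennreal (norm (P x)) \<partial>lebesgue) < \<infinity>"
  proof -
    have "integrable lebesgue (\<lambda>x. indicator K x *\<^sub>R P x)" using P by (simp add: set_integrable_def)
    then have "(\<integral>\<^sup>+x. ennreal (norm (indicator K x *\<^sub>R P x)) \<partial>lebesgue) < \<infinity>"
      by (simp only: integrable_iff_bounded)
    also have "(\<integral>\<^sup>+x. ennreal (norm (indicator K x *\<^sub>R P x)) \<partial>lebesgue) = (\<integral>\<^sup>+x. indicator K x * ennreal (norm (P x)) \<partial>lebesgue)"
      by (intro nn_integral_cong) (auto split: split_indicator)
    finally show ?thesis .
  qed
  have Pnorm: "(\<integral>\<^sup>+x. indicator B x * ennreal (P x) \<partial>lebesgue) \<le> (\<integral>\<^sup>+x. indicator B x * ennreal (norm (P x)) \<partial>lebesgue)" for B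
    by (intro nn_integral_mono mult_left_mono ennreal_leI) auto
  show "\<exists>C. \<forall>j. (\<integral>\<^sup>+x. indicator K x * ennreal (norm (g j i x)) \<partial>lebesgue) \<le> ennreal C"
  proof -
    obtain c where c: "(\<integral>\<^sup>+x. indicator K x * ennreal (norm (P x)) \<partial>lebesgue) = ennreal c" "0 \<le> c"
      using Pfin by (cases "\<integral>\<^sup>+x. indicator K x * ennreal (norm (P x)) \<partial>lebesgue") auto
    have "(\<integral>\<^sup>+x. indicator K x * ennreal (norm (g j i x)) \<partial>lebesgue) \<le> ennreal (c + M)" for j
    proof -
      have "(\<integral>\<^sup>+x. indicator K x * ennreal (norm (g j i x)) \<partial>lebesgue) \<le> ennreal 1 * ennreal c + ennreal (M / 1)"
        using Pnorm[of K] c by (intro order_trans[OF main[OF Ks order_refl, of 1]] add_mono mult_left_mono) auto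
      also have "\<dots> = ennreal (c + M)" using c(2) M(2) by simp
      finally show ?thesis .
    qed
    then show ?thesis by blast
  qed
  show "equi_int K (\<lambda>j. g j i)"
    unfolding equi_int_def
  proof (intro allI impI)
    fix e :: real assume "e > 0"
    define l where "l = max 1 (2 * M / e)"
    have l: "l \<ge> 1" "M / l \<le> e / 2"
    proof -
      show "l \<ge> 1" by (simp add: l_def)
      have "2 * M / e \<le> l" by (simp add: l_def)
      then show "M / l \<le> e / 2" using \<open>e > 0\<close> \<open>l \<ge> 1\<close> by (simp add: field_simps)
    qed
    have e0: "0 < e / (2 * l)" using \<open>e > 0\<close> l(1) by simp
    obtain \<delta> where \<delta>: "\<delta> > 0" "\<And>B. B \<in> sets lebesgue \<Longrightarrow> B \<subseteq> K \<Longrightarrow> emeasure lebesgue B < ennreal \<delta> \<Longrightarrow>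
        (\<integral>\<^sup>+x. indicator B x * ennreal (norm (P x)) \<partial>lebesgue) \<le> ennreal (e / (2 * l))"
    proof -
      have "equi_int K (\<lambda>j::nat. P)" by (rule equi_int_single[OF P])
      note this[unfolded equi_int_def, rule_format, OF e0]
      then show ?thesis using that by blast
    qed
    show "\<exists>\<delta>>0. \<forall>j. \<forall>B\<in>sets lebesgue. B \<subseteq> K \<longrightarrow> emeasure lebesgue B < ennreal \<delta> \<longrightarrow>
       (\<integral>\<^sup>+x. indicator B x * ennreal (norm (g j i x)) \<partial>lebesgue) \<le> ennreal e"
    proof (intro exI[of _ \<delta>] conjI allI ballI impI \<delta>(1))
      fix j B assume B: "B \<in> sets lebesgue" "B \<subseteq> K" "emeasure lebesgue B < ennreal \<delta>"
      have "(\<integral>\<^sup>+x. indicator B x * ennreal (norm (g j i x)) \<partial>lebesgue) \<le> ennreal l * ennreal (e / (2 * l)) + ennreal (e / 2)"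
        using l(2) by (intro order_trans[OF main[OF B(1,2) l(1)]] add_mono mult_left_mono order_trans[OF Pnorm \<delta>(2)] B ennreal_leI) auto
      also have "\<dots> = ennreal e"
        using l(1) \<open>e > 0\<close> by (subst ennreal_mult[symmetric]) (auto simp: ennreal_plus[symmetric] simp del: ennreal_plus)
      finally show "(\<integral>\<^sup>+x. indicator B x * ennreal (norm (g j i x)) \<partial>lebesgue) \<le> ennreal e" .
    qed
  qed
qed

text \<open>Uniform convergence controls a tail of the sequence, compactness each of the finitely
  many other images. The common ball bounds the volumes of the images.\<close>

lemma uniformly_bounded_images:
  fixes fs :: "nat \<Rightarrow> 'a::topological_space \<Rightarrow> 'b::real_normed_vector"
  assumes K: "compact K" and cont: "\<And>j. continuous_on K (fs j)" and unif: "uniform_limit K fs f sequentially"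
  shows "\<exists>R>0. \<forall>j. fs j ` K \<subseteq> cball 0 R"
proof -
  have "continuous_on K f"
    by (rule uniform_limit_theorem[OF _ unif]) (auto simp: cont)
  then have "bounded (f ` K)" using K by (simp add: compact_continuous_image compact_imp_bounded)
  then obtain R0 where R0: "\<And>x. x \<in> K \<Longrightarrow> norm (f x) \<le> R0" by (auto simp: bounded_iff)
  have "\<forall>\<^sub>F j in sequentially. \<forall>x\<in>K. dist (fs j x) (f x) < 1"
    using uniform_limitD[OF unif, of 1] by simp
  then obtain N where N: "\<And>j x. j \<ge> N \<Longrightarrow> x \<in> K \<Longrightarrow> dist (fs j x) (f x) < 1"
    by (auto simp: eventually_sequentially)
  have "bounded (\<Union>j\<in>{..<N}. fs j ` K)"
    using K cont by (intro bounded_UN) (auto simp: compact_continuous_image compact_imp_bounded)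
  then obtain R1 where R1: "\<And>j x. j < N \<Longrightarrow> x \<in> K \<Longrightarrow> norm (fs j x) \<le> R1" by (auto simp: bounded_iff)
  have "norm (fs j x) \<le> max 1 (max R1 (R0 + 1))" if "x \<in> K" for j x
  proof (cases "j < N")
    case True
    then show ?thesis using R1[OF True that] by linarith
  next
    case False
    then have "dist (fs j x) (f x) < 1" using N that by simp
    then have "norm (fs j x) \<le> norm (f x) + 1"
      unfolding dist_norm using norm_triangle_sub[of "fs j x" "f x"] by linarith
    then show ?thesis using R0[OF that] by linarith
  qed
  then show ?thesis by (intro exI[of _ "max 1 (max R1 (R0 + 1))"]) auto
qed

section \<open>Weak convergence of the derivatives\<close>

text \<open>Equi-integrability upgrades weak convergence from test functions to their bounded a.e. limits.\<close>

lemma integral_tendsto_0_bounded_limit: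
  fixes u :: "nat \<Rightarrow> 'a \<Rightarrow> 'b::{banach, second_countable_topology}" and w :: "'a \<Rightarrow> real"
  assumes E: "E \<in> sets M" "emeasure M E < \<infinity>"
    and u: "\<And>j. integrable M (u j)" "\<And>j x. x \<notin> E \<Longrightarrow> u j x = 0" "\<And>j. (\<integral>\<^sup>+x. ennreal (norm (u j x)) \<partial>M) \<le> ennreal C" "C \<ge> 0"
    and equi: "\<And>e. e > 0 \<Longrightarrow> \<exists>\<delta>>0. \<forall>j. \<forall>B\<in>sets M. B \<subseteq> E \<longrightarrow> emeasure M B < ennreal \<delta> \<longrightarrow>
        (\<integral>\<^sup>+x. indicator B x * ennreal (norm (u j x)) \<partial>M) \<le> ennreal e"
    and wm: "\<And>m. ws m \<in> borel_measurable M" "w \<in> borel_measurable M"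
    and bnd: "\<And>m x. \<bar>ws m x\<bar> \<le> c" "\<And>x. \<bar>w x\<bar> \<le> c" "c > 0"
    and lim: "AE x in M. (\<lambda>m. ws m x) \<longlonglongrightarrow> w x"
    and zero: "\<And>m. (\<lambda>j. LINT x|M. ws m x *\<^sub>R u j x) \<longlonglongrightarrow> 0"
  shows "(\<lambda>j. LINT x|M. w x *\<^sub>R u j x) \<longlonglongrightarrow> 0"
proof (rule tendstoI)
  fix e :: real assume "e > 0"
  note [measurable] = E(1) wm borel_measurable_integrable[OF u(1)]
  \<comment> \<open>On the good set the weights differ by at most \<open>\<eta>\<close>, which
    contributes at most \<open>e / 4\<close>; \<open>C + 1\<close> allows for \<open>C = 0\<close>.
    On the bad set they differ by at most \<open>2 * c\<close>, and
    \<open>2 * c * (e / (8 * c))\<close> is again \<open>e / 4\<close>.\<close>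
  define \<eta> where "\<eta> = e / (4 * (C + 1))"
  have \<eta>: "\<eta> > 0" "\<eta> * C \<le> e / 4"
    using \<open>e > 0\<close> u(4) by (auto simp: \<eta>_def field_simps)
  have "e / (8 * c) > 0" using \<open>e > 0\<close> bnd(3) by simp
  from equi[OF this] obtain \<delta> where \<delta>: "\<delta> > 0" "\<And>j B. B \<in> sets M \<Longrightarrow> B \<subseteq> E \<Longrightarrow> emeasure M B < ennreal \<delta> \<Longrightarrow>
        (\<integral>\<^sup>+x. indicator B x * ennreal (norm (u j x)) \<partial>M) \<le> ennreal (e / (8 * c))"
    by blast
  let ?A = "\<lambda>m. {x \<in> space M. x \<in> E \<and> \<eta> < norm (ws m x - w x)}"
  have "(\<lambda>m. emeasure M (?A m)) \<longlonglongrightarrow> 0"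
    by (rule AE_convergence_imp_in_measure[OF E wm lim \<eta>(1)])
  then have "\<forall>\<^sub>F m in sequentially. emeasure M (?A m) < ennreal \<delta>"
    using \<delta>(1) by (intro order_tendstoD(2)) auto
  then obtain m where m: "emeasure M (?A m) < ennreal \<delta>" by (auto simp: eventually_sequentially)
  have [measurable]: "?A m \<in> sets M" by measurable
  have int: "integrable M (\<lambda>x. ws m x *\<^sub>R u j x)" "integrable M (\<lambda>x. w x *\<^sub>R u j x)" for j
    using bnd by (auto intro!: integrable_scaleR_bounded[OF u(1), where B=c])
  have close: "norm ((LINT x|M. w x *\<^sub>R u j x) - (LINT x|M. ws m x *\<^sub>R u j x)) \<le> e / 2" for j
  proof -
    have i: "integrable M (\<lambda>x. (w x - ws m x) *\<^sub>R u j x)"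
      using int by (simp add: scaleR_diff_left)
    have "(LINT x|M. w x *\<^sub>R u j x) - (LINT x|M. ws m x *\<^sub>R u j x) = (LINT x|M. (w x - ws m x) *\<^sub>R u j x)"
      using int by (simp add: scaleR_diff_left)
    then have "ennreal (norm ((LINT x|M. w x *\<^sub>R u j x) - (LINT x|M. ws m x *\<^sub>R u j x))) \<le>
        (\<integral>\<^sup>+x. ennreal (norm ((w x - ws m x) *\<^sub>R u j x)) \<partial>M)"
      using integral_norm_bound_ennreal[OF i] by simp
    also have "\<dots> \<le> (\<integral>\<^sup>+x. ennreal \<eta> * ennreal (norm (u j x)) + ennreal (2 * c) * (indicator (?A m) x * ennreal (norm (u j x))) \<partial>M)"
    proof (rule nn_integral_mono)
      fix x assume "x \<in> space M"
      show "ennreal (norm ((w x - ws m x) *\<^sub>R u j x)) \<le>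
          ennreal \<eta> * ennreal (norm (u j x)) + ennreal (2 * c) * (indicator (?A m) x * ennreal (norm (u j x)))"
      proof (cases "x \<in> ?A m")
        case True
        have "\<bar>w x - ws m x\<bar> \<le> 2 * c" using bnd(1)[of m x] bnd(2)[of x] by linarith
        then have "ennreal (norm ((w x - ws m x) *\<^sub>R u j x)) \<le> ennreal (2 * c * norm (u j x))"
          by (intro ennreal_leI) (simp add: mult_right_mono)
        also have "\<dots> = ennreal (2 * c) * ennreal (norm (u j x))" using bnd(3) by (simp add: ennreal_mult)
        finally show ?thesis using True by (simp add: add_increasing)
      next
        case False
        show ?thesis
        proof (cases "x \<in> E")
          case True
          then have "\<bar>w x - ws m x\<bar> \<le> \<eta>" using False \<open>x \<in> space M\<close> by (auto simp: abs_minus_commute)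
          then have "ennreal (norm ((w x - ws m x) *\<^sub>R u j x)) \<le> ennreal (\<eta> * norm (u j x))"
            by (intro ennreal_leI) (simp add: mult_right_mono)
          also have "\<dots> = ennreal \<eta> * ennreal (norm (u j x))" using \<eta> by (simp add: ennreal_mult)
          finally show ?thesis by (simp add: add_increasing2)
        qed (simp add: u(2))
      qed
    qed
    also have "\<dots> = ennreal \<eta> * (\<integral>\<^sup>+x. ennreal (norm (u j x)) \<partial>M) + ennreal (2 * c) * (\<integral>\<^sup>+x. indicator (?A m) x * ennreal (norm (u j x)) \<partial>M)"
    proof -
      have "(\<integral>\<^sup>+x. c1 * h1 x + c2 * h2 x \<partial>M) = c1 * (\<integral>\<^sup>+x. h1 x \<partial>M) + c2 * (\<integral>\<^sup>+x. h2 x \<partial>M)"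
        if "h1 \<in> borel_measurable M" "h2 \<in> borel_measurable M" for c1 c2 and h1 h2 :: "'a \<Rightarrow> ennreal"
        using that by (simp add: nn_integral_add nn_integral_cmult)
      from this[of "\<lambda>x. ennreal (norm (u j x))" "\<lambda>x. indicator (?A m) x * ennreal (norm (u j x))"] show ?thesis
        by measurable
    qed
    also have "\<dots> \<le> ennreal \<eta> * ennreal C + ennreal (2 * c) * ennreal (e / (8 * c))"
      by (intro add_mono mult_left_mono u(3) \<delta>(2) m) auto
    also have "\<dots> = ennreal (\<eta> * C + e / 4)"
    proof -
      have "2 * c * (e / (8 * c)) = e / 4" using bnd(3) by simp
      then show ?thesis using \<eta>(1) u(4) bnd(3) \<open>e > 0\<close>
        by (simp add: ennreal_mult[symmetric] ennreal_plus[symmetric] del: ennreal_plus)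
    qed
    also have "\<dots> \<le> ennreal (e / 2)" using \<eta>(2) by (intro ennreal_leI) simp
    finally show ?thesis using \<open>e > 0\<close> by (subst (asm) ennreal_le_iff) auto
  qed
  have "\<forall>\<^sub>F j in sequentially. norm (LINT x|M. ws m x *\<^sub>R u j x) < e / 2"
    using tendstoD[OF zero[of m], of "e/2"] \<open>e > 0\<close> by simp
  then show "\<forall>\<^sub>F j in sequentially. dist (LINT x|M. w x *\<^sub>R u j x) 0 < e"
  proof eventually_elim
    case (elim j)
    then show ?case
      using close[of j] norm_triangle_sub[of "LINT x|M. w x *\<^sub>R u j x" "LINT x|M. ws m x *\<^sub>R u j x"]
      by (simp add: dist_norm)
  qed
qed

text \<open>Dynkin's theorem leads from boxes to Borel sets: complements use the hypothesis on the
  total integral, and countable disjoint unions use \<open>integral_tendsto_0_bounded_limit\<close>,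
  where equi-integrability makes the tail of the union small uniformly in \<open>j\<close>. Null
  sets then lead to Lebesgue sets, and simple functions to bounded weights.\<close>

lemma bounded_weak_convergence_of_boxes:
  fixes u :: "nat \<Rightarrow> 'a::euclidean_space \<Rightarrow> 'b::{banach, second_countable_topology}"
  assumes E: "E \<in> sets lebesgue" "emeasure lebesgue E < \<infinity>"
    and u: "\<And>j. integrable lebesgue (u j)" "\<And>j x. x \<notin> E \<Longrightarrow> u j x = 0" "\<And>j. (\<integral>\<^sup>+x. ennreal (norm (u j x)) \<partial>lebesgue) \<le> ennreal C" "C \<ge> 0"
    and equi: "\<And>e. e > 0 \<Longrightarrow> \<exists>\<delta>>0. \<forall>j. \<forall>B\<in>sets lebesgue. B \<subseteq> E \<longrightarrow> emeasure lebesgue B < ennreal \<delta> \<longrightarrow>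
        (\<integral>\<^sup>+x. indicator B x * ennreal (norm (u j x)) \<partial>lebesgue) \<le> ennreal e"
    and box: "\<And>c d. (\<lambda>j. LINT x|lebesgue. indicator (box c d) x *\<^sub>R u j x) \<longlonglongrightarrow> 0"
    and total: "(\<lambda>j. LINT x|lebesgue. u j x) \<longlonglongrightarrow> 0"
    and w: "w \<in> borel_measurable lebesgue" "\<And>x. \<bar>w x\<bar> \<le> (c::real)" "c > 0"
  shows "(\<lambda>j. LINT x|lebesgue. w x *\<^sub>R u j x) \<longlonglongrightarrow> 0"
proof -
  note L = integral_tendsto_0_bounded_limit[OF E u equi]
  let ?G = "range (\<lambda>(a, b). box a b :: 'a set)"
  have ind: "integrable lebesgue (\<lambda>x. indicator A x *\<^sub>R u j x)" if "A \<in> sets lebesgue" for A j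
    by (rule integrable_scaleR_bounded[OF u(1), where B=1]) (use that in \<open>auto simp: indicator_def\<close>)
  have borel: "(\<lambda>j. LINT x|lebesgue. indicator A x *\<^sub>R u j x) \<longlonglongrightarrow> 0" if "A \<in> sets borel" for A
  proof -
    have gen: "sets borel = sigma_sets UNIV ?G"
      unfolding borel_eq_box by (rule sets_measure_of) auto
    have "Int_stable ?G"
      by (auto simp: Int_stable_def box_Int_box)
    moreover have "?G \<subseteq> Pow UNIV" by auto
    moreover have "A \<in> sigma_sets UNIV ?G" using that gen by simp
    ultimately show ?thesis
    proof (induction rule: sigma_sets_induct_disjoint)
      case (basic A)
      then show ?case using box by auto
    next
      case empty
      then show ?case by simp
    next
      case (compl A)
      then have A: "A \<in> sets lebesgue" using gen by auto
      have "indicator (UNIV - A) x *\<^sub>R u j x = u j x - indicator A x *\<^sub>R u j x" for x j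
        by (simp add: indicator_def)
      then have "(LINT x|lebesgue. indicator (UNIV - A) x *\<^sub>R u j x) = (LINT x|lebesgue. u j x) - (LINT x|lebesgue. indicator A x *\<^sub>R u j x)" for j
        using u(1) ind[OF A] by simp
      then show ?case using tendsto_diff[OF total compl.IH] by simp
    next
      case (union A)
      have A: "A i \<in> sets lebesgue" for i
      proof -
        have "A i \<in> sets borel" unfolding gen using union(2) by blast
        then show ?thesis by simp
      qed
      show ?case
      proof (rule L[where ws="\<lambda>m. indicator (\<Union>i<m. A i)" and c=1])
        show "AE x in lebesgue. (\<lambda>m. indicator (\<Union>i<m. A i) x :: real) \<longlonglongrightarrow> indicator (\<Union>i. A i) x"
          by (intro AE_I2 LIMSEQ_indicator_UN)
        fix m
        have "indicator (\<Union>i<m. A i) x = (\<Sum>i<m. indicator (A i) x :: real)" for x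
          using union(1) by (intro indicator_UN_disjoint) (auto simp: disjoint_family_on_def)
        then have "(LINT x|lebesgue. indicator (\<Union>i<m. A i) x *\<^sub>R u j x) = (\<Sum>i<m. LINT x|lebesgue. indicator (A i) x *\<^sub>R u j x)" for j
          by (simp only: scaleR_sum_left) (rule Bochner_Integration.integral_sum, rule ind[OF A])
        then show "(\<lambda>j. LINT x|lebesgue. indicator (\<Union>i<m. A i) x *\<^sub>R u j x) \<longlonglongrightarrow> 0"
          using tendsto_sum[of "{..<m}", OF union(3)] by simp
      qed (use A in \<open>auto simp: indicator_def\<close>)
    qed
  qed
  have leb: "(\<lambda>j. LINT x|lebesgue. indicator A x *\<^sub>R u j x) \<longlonglongrightarrow> 0" if A: "A \<in> sets lebesgue" for A
  proof -
    obtain S N N' where S: "A = S \<union> N" "N \<subseteq> N'" "N' \<in> null_sets lborel" "S \<in> sets lborel"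
      by (rule sets_completionE[OF A])
    have "AE x in lebesgue. x \<notin> N'"
      using S(3) by (intro AE_not_in null_sets_completionI)
    then have "AE x in lebesgue. indicator A x *\<^sub>R u j x = indicator S x *\<^sub>R u j x" for j
      by eventually_elim (use S in \<open>auto simp: indicator_def\<close>)
    then have "(LINT x|lebesgue. indicator A x *\<^sub>R u j x) = (LINT x|lebesgue. indicator S x *\<^sub>R u j x)" for j
      using ind[OF A] ind[of S] S(4) by (intro integral_cong_AE) auto
    then show ?thesis using borel[of S] S(4) by simp
  qed
  \<comment> \<open>The simple functions are bounded by \<open>2 * \<bar>w x\<bar>\<close>, whence
    the constant \<open>2 * c\<close> below.\<close>
  obtain F where F: "\<And>i. simple_function lebesgue (F i)" "\<And>x. (\<lambda>i. F i x) \<longlonglongrightarrow> w x" "\<And>i x. dist (F i x) 0 \<le> 2 * dist (w x) 0"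
    using borel_measurable_implies_sequence_metric[OF w(1), of 0] by auto
  show ?thesis
  proof (rule L[where ws=F and c="2 * c"])
    show "F i \<in> borel_measurable lebesgue" for i
      using F(1) by (rule borel_measurable_simple_function)
    show "\<bar>F i x\<bar> \<le> 2 * c" for i x
      using F(3)[of i x] w(2)[of x] by simp
    show "\<bar>w x\<bar> \<le> 2 * c" for x using w(2)[of x] w(3) by simp
    fix i
    let ?R = "F i ` space lebesgue"
    have fin: "finite ?R" using F(1) by (rule simple_functionD)
    have pre: "F i -` {y} \<in> sets lebesgue" for y
      using simple_functionD(2)[OF F(1), of i "{y}"] by simp
    have "F i x *\<^sub>R u j x = (\<Sum>y\<in>?R. y *\<^sub>R (indicator (F i -` {y}) x *\<^sub>R u j x))" for x j
    proof -
      have "(\<Sum>y\<in>?R. y *\<^sub>R (indicator (F i -` {y}) x *\<^sub>R u j x)) = (\<Sum>y\<in>?R. if y = F i x then F i x *\<^sub>R u j x else 0)"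
        by (intro sum.cong) (auto simp: indicator_def)
      then show ?thesis using fin by (simp add: sum.delta)
    qed
    then have "(LINT x|lebesgue. F i x *\<^sub>R u j x) = (\<Sum>y\<in>?R. y *\<^sub>R (LINT x|lebesgue. indicator (F i -` {y}) x *\<^sub>R u j x))" for j
      using ind[OF pre] by (simp del: scaleR_scaleR)
    moreover have "(\<lambda>j. \<Sum>y\<in>?R. y *\<^sub>R (LINT x|lebesgue. indicator (F i -` {y}) x *\<^sub>R u j x)) \<longlonglongrightarrow> (\<Sum>y\<in>?R. y *\<^sub>R 0)"
      by (intro tendsto_sum tendsto_scaleR tendsto_const leb pre)
    ultimately show "(\<lambda>j. LINT x|lebesgue. F i x *\<^sub>R u j x) \<longlonglongrightarrow> 0" by simp
  qed (use w F in auto)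
qed


text \<open>The derivative is moved onto the bump; what remains are the maps themselves, which
  converge uniformly on its compact support.\<close>

lemma weak_partial_test_convergence:
  fixes f :: "real^'n \<Rightarrow> real^'m" and fs :: "nat \<Rightarrow> real^'n \<Rightarrow> real^'m"
  assumes fs: "\<And>j. continuous_on D (fs j)" and weak: "\<And>j. weak_partial D (fs j) i (g j)" and G: "weak_partial D f i G"
    and box: "cbox a b \<subseteq> D" and unif: "uniform_limit (cbox a b) fs f sequentially"
  shows "(\<lambda>j. integral D (\<lambda>x. bump a b m x *\<^sub>R g j x)) \<longlonglongrightarrow> integral D (\<lambda>x. bump a b m x *\<^sub>R G x)"
proof -
  let ?K = "cbox a b" and ?p = "partial_dir (bump a b m) i"
  have p0: "?p x = 0" if "x \<notin> ?K" for x
  proof (rule smooth_gen_partial_outside[of ?K])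
    show "bump a b m y = 0" if "y \<notin> ?K" for y
      using that box_subset_cbox bump_outside by blast
  qed (use that in auto)
  obtain B where B: "\<And>x. \<bar>?p x\<bar> \<le> B"
    using smooth_gen_bounded[OF smooth_gen_partial(1)[OF smooth_gen_bump]] by blast
  have cont: "continuous_on ?K (fs j)" for j using fs continuous_on_subset box by blast
  obtain R where R: "R > 0" "\<And>j. fs j ` ?K \<subseteq> cball 0 R"
    using uniformly_bounded_images[OF compact_cbox cont unif] by blast
  have eq: "integral D (\<lambda>x. ?p x *\<^sub>R h x) = integral ?K (\<lambda>x. ?p x *\<^sub>R h x)" for h :: "real^'n \<Rightarrow> real^'m"
  proof -
    have "integral D (\<lambda>x. ?p x *\<^sub>R h x) = integral UNIV (\<lambda>x. ?p x *\<^sub>R h x)"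
      using box by (intro integral_eq_of_support[of ?K]) (auto simp: p0)
    also have "\<dots> = integral ?K (\<lambda>x. ?p x *\<^sub>R h x)"
      by (intro integral_eq_of_support[symmetric, of ?K]) (auto simp: p0)
    finally show ?thesis .
  qed
  have tf: "test_fun D (bump a b m)" by (rule test_fun_bump[OF box])
  have "(\<lambda>j. integral ?K (\<lambda>x. ?p x *\<^sub>R fs j x)) \<longlonglongrightarrow> integral ?K (\<lambda>x. ?p x *\<^sub>R f x)"
  proof (rule dominated_convergence(2)[where h="\<lambda>x. B * R"])
    show "(\<lambda>x. ?p x *\<^sub>R fs j x) integrable_on ?K" for j
      by (intro integrable_continuous continuous_intros cont smooth_gen_continuous smooth_gen_partial(1) smooth_gen_bump)
    show "norm (?p x *\<^sub>R fs j x) \<le> B * R" if "x \<in> ?K" for j x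
    proof -
      have "norm (fs j x) \<le> R" using R(2)[of j] that by auto
      then show ?thesis using B[of x] by (simp add: mult_mono')
    qed
    show "(\<lambda>j. ?p x *\<^sub>R fs j x) \<longlonglongrightarrow> ?p x *\<^sub>R f x" if "x \<in> ?K" for x
      by (intro tendsto_intros tendsto_uniform_limitI[OF unif that])
  qed (rule integrable_const)
  then have "(\<lambda>j. - integral D (\<lambda>x. ?p x *\<^sub>R fs j x)) \<longlonglongrightarrow> - integral D (\<lambda>x. ?p x *\<^sub>R f x)"
    unfolding eq by (rule tendsto_minus)
  then show ?thesis
    using weak G tf by (simp add: weak_partial_def)
qed

text \<open>Bumps are admissible test functions and tend to indicators of boxes inside
  \<open>cbox a b\<close>. Equi-integrability carries the convergence over from bumps to such boxes,
  and from there to all bounded weights.\<close>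

lemma weak_partial_box_convergence:
  fixes f :: "real^'n \<Rightarrow> real^'m" and fs :: "nat \<Rightarrow> real^'n \<Rightarrow> real^'m" and w :: "real^'n \<Rightarrow> real"
  assumes fs: "\<And>j. continuous_on D (fs j)" and weak: "\<And>j. weak_partial D (fs j) i (g j)" and G: "weak_partial D f i G"
    and box: "cbox a b \<subseteq> D" and unif: "\<And>K. compact K \<Longrightarrow> K \<subseteq> D \<Longrightarrow> uniform_limit K fs f sequentially"
    and equi: "equi_int (cbox a b) g" and C: "\<And>j. (\<integral>\<^sup>+x. indicator (cbox a b) x * ennreal (norm (g j x)) \<partial>lebesgue) \<le> ennreal C"
    and w: "w \<in> borel_measurable lebesgue" "\<And>x. \<bar>w x\<bar> \<le> c" "c > 0"
  shows "(\<lambda>j. LINT x|lebesgue. w x *\<^sub>R (indicator (cbox a b) x *\<^sub>R (g j x - G x))) \<longlonglongrightarrow> 0"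
proof -
  let ?E = "cbox a b"
  define u where "u j x = indicator ?E x *\<^sub>R (g j x - G x)" for j x
  have int: "h absolutely_integrable_on K" if "weak_partial D f' i h" "compact K" "K \<subseteq> D" for h f' K
    using that by (simp add: weak_partial_def loc_integrable_def)
  have gG: "g j absolutely_integrable_on ?E" "G absolutely_integrable_on ?E" for j
    using int[OF weak compact_cbox box] int[OF G compact_cbox box] by auto
  have igG: "integrable lebesgue (\<lambda>x. indicator ?E x *\<^sub>R g j x)" "integrable lebesgue (\<lambda>x. indicator ?E x *\<^sub>R G x)" for j
    using gG by (auto simp: set_integrable_def)
  have u: "integrable lebesgue (u j)" for j
    unfolding u_def scaleR_diff_right using igG by (rule Bochner_Integration.integrable_diff)
  have u0: "u j x = 0" if "x \<notin> ?E" for j x using that by (simp add: u_def)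
  have split: "(\<integral>\<^sup>+x. indicator B x * ennreal (norm (u j x)) \<partial>lebesgue) \<le>
      (\<integral>\<^sup>+x. indicator B x * ennreal (norm (g j x)) \<partial>lebesgue) + (\<integral>\<^sup>+x. indicator B x * ennreal (norm (G x)) \<partial>lebesgue)"
    if B: "B \<in> sets lebesgue" "B \<subseteq> ?E" for B j
  proof -
    note [measurable] = B(1) borel_measurable_integrable[OF igG(1)] borel_measurable_integrable[OF igG(2)]
    have "(\<integral>\<^sup>+x. indicator B x * ennreal (norm (u j x)) \<partial>lebesgue) \<le>
       (\<integral>\<^sup>+x. indicator B x * ennreal (norm (indicator ?E x *\<^sub>R g j x)) + indicator B x * ennreal (norm (indicator ?E x *\<^sub>R G x)) \<partial>lebesgue)"
    proof (rule nn_integral_mono)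
      fix x
      have "ennreal (norm (g j x - G x)) \<le> ennreal (norm (g j x) + norm (G x))"
        by (intro ennreal_leI norm_triangle_ineq4)
      also have "\<dots> = ennreal (norm (g j x)) + ennreal (norm (G x))" by simp
      finally show "indicator B x * ennreal (norm (u j x)) \<le>
         indicator B x * ennreal (norm (indicator ?E x *\<^sub>R g j x)) + indicator B x * ennreal (norm (indicator ?E x *\<^sub>R G x))"
        using B(2) by (cases "x \<in> B") (auto simp: u_def)
    qed
    also have "\<dots> = (\<integral>\<^sup>+x. indicator B x * ennreal (norm (indicator ?E x *\<^sub>R g j x)) \<partial>lebesgue) + (\<integral>\<^sup>+x. indicator B x * ennreal (norm (indicator ?E x *\<^sub>R G x)) \<partial>lebesgue)"
      by (rule nn_integral_add) measurable
    finally have le: "(\<integral>\<^sup>+x. indicator B x * ennreal (norm (u j x)) \<partial>lebesgue) \<le>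
      (\<integral>\<^sup>+x. indicator B x * ennreal (norm (indicator ?E x *\<^sub>R g j x)) \<partial>lebesgue) + (\<integral>\<^sup>+x. indicator B x * ennreal (norm (indicator ?E x *\<^sub>R G x)) \<partial>lebesgue)" .
    have "(\<integral>\<^sup>+x. indicator B x * ennreal (norm (indicator ?E x *\<^sub>R h x)) \<partial>lebesgue) = (\<integral>\<^sup>+x. indicator B x * ennreal (norm (h x)) \<partial>lebesgue)"
      for h :: "real^'n \<Rightarrow> real^'m"
      using B(2) by (intro nn_integral_cong) (auto split: split_indicator)
    with le show ?thesis by (simp only:)
  qed
  have "(\<integral>\<^sup>+x. ennreal (norm (indicator ?E x *\<^sub>R G x)) \<partial>lebesgue) < \<infinity>"
    using igG(2) by (simp only: integrable_iff_bounded)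
  then obtain C' where C': "(\<integral>\<^sup>+x. ennreal (norm (indicator ?E x *\<^sub>R G x)) \<partial>lebesgue) = ennreal C'" "C' \<ge> 0"
    by (cases "\<integral>\<^sup>+x. ennreal (norm (indicator ?E x *\<^sub>R G x)) \<partial>lebesgue") auto
  have C'': "(\<integral>\<^sup>+x. indicator ?E x * ennreal (norm (G x)) \<partial>lebesgue) = ennreal C'"
    unfolding C'(1)[symmetric] by (intro nn_integral_cong) (auto split: split_indicator)
  have ubound: "(\<integral>\<^sup>+x. ennreal (norm (u j x)) \<partial>lebesgue) \<le> ennreal (max C 0 + C')" for j
  proof -
    have "(\<integral>\<^sup>+x. ennreal (norm (u j x)) \<partial>lebesgue) = (\<integral>\<^sup>+x. indicator ?E x * ennreal (norm (u j x)) \<partial>lebesgue)"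
      by (intro nn_integral_cong) (auto simp: u_def split: split_indicator)
    also have "\<dots> \<le> ennreal C + ennreal C'"
      using order_trans[OF split[of ?E j] add_mono[OF C[of j] eq_refl[OF C'']]] by simp
    also have "\<dots> \<le> ennreal (max C 0) + ennreal C'" by (intro add_right_mono ennreal_leI) simp
    also have "\<dots> = ennreal (max C 0 + C')" using C'(2) by simp
    finally show ?thesis .
  qed
  have uequi: "\<exists>\<delta>>0. \<forall>j. \<forall>B\<in>sets lebesgue. B \<subseteq> ?E \<longrightarrow> emeasure lebesgue B < ennreal \<delta> \<longrightarrow>
        (\<integral>\<^sup>+x. indicator B x * ennreal (norm (u j x)) \<partial>lebesgue) \<le> ennreal e" if "e > 0" for e
  proof -
    have e2: "0 < e / 2" using that by simp
    have eG: "equi_int ?E (\<lambda>j::nat. G)" by (rule equi_int_single[OF gG(2)])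
    obtain d1 where d1: "d1 > 0" "\<forall>j. \<forall>B\<in>sets lebesgue. B \<subseteq> ?E \<longrightarrow> emeasure lebesgue B < ennreal d1 \<longrightarrow>
        (\<integral>\<^sup>+x. indicator B x * ennreal (norm (g j x)) \<partial>lebesgue) \<le> ennreal (e / 2)"
      using equi[unfolded equi_int_def, rule_format, OF e2] by auto
    obtain d2 where d2: "d2 > 0" "\<forall>j::nat. \<forall>B\<in>sets lebesgue. B \<subseteq> ?E \<longrightarrow> emeasure lebesgue B < ennreal d2 \<longrightarrow>
        (\<integral>\<^sup>+x. indicator B x * ennreal (norm (G x)) \<partial>lebesgue) \<le> ennreal (e / 2)"
      using eG[unfolded equi_int_def, rule_format, OF e2] by auto
    show ?thesis
    proof (intro exI[of _ "min d1 d2"] conjI allI ballI impI)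
      fix j B assume B: "B \<in> sets lebesgue" "B \<subseteq> ?E" "emeasure lebesgue B < ennreal (min d1 d2)"
      have "emeasure lebesgue B < ennreal d1" "emeasure lebesgue B < ennreal d2"
        using less_le_trans[OF B(3) ennreal_leI[of "min d1 d2" d1]] less_le_trans[OF B(3) ennreal_leI[of "min d1 d2" d2]]
        by simp_all
      then have "(\<integral>\<^sup>+x. indicator B x * ennreal (norm (g j x)) \<partial>lebesgue) \<le> ennreal (e / 2)"
        "(\<integral>\<^sup>+x. indicator B x * ennreal (norm (G x)) \<partial>lebesgue) \<le> ennreal (e / 2)"
        using d1(2) d2(2) B(1,2) by blast+
      then have "(\<integral>\<^sup>+x. indicator B x * ennreal (norm (u j x)) \<partial>lebesgue) \<le> ennreal (e / 2) + ennreal (e / 2)"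
        by (intro order_trans[OF split[OF B(1,2)]] add_mono)
      also have "\<dots> = ennreal e" using that by (simp flip: ennreal_plus)
      finally show "(\<integral>\<^sup>+x. indicator B x * ennreal (norm (u j x)) \<partial>lebesgue) \<le> ennreal e" .
    qed (use d1 d2 in auto)
  qed
  have Em: "?E \<in> sets lebesgue" "emeasure lebesgue ?E < \<infinity>"
    by (auto simp: emeasure_lborel_cbox_eq)
  have cbox: "(\<lambda>j. LINT x|lebesgue. indicator (box p q) x *\<^sub>R u j x) \<longlonglongrightarrow> 0" if pq: "cbox p q \<subseteq> ?E" for p q
  proof (rule integral_tendsto_0_bounded_limit[OF Em u u0 ubound _ uequi, where ws="bump p q" and c=1])
    show "AE x in lebesgue. (\<lambda>m. bump p q m x) \<longlonglongrightarrow> indicator (box p q) x"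
      by (intro AE_I2 bump_tendsto_indicator)
    show bm: "bump p q m \<in> borel_measurable lebesgue" for m
      using smooth_gen_borel[OF smooth_gen_bump[of p q m]] by (intro measurable_completion) simp
    show "\<bar>bump p q m x\<bar> \<le> 1" for m x using bump_bounds[of p q m x] by simp
    fix m
    have pqD: "cbox p q \<subseteq> D" using pq box by auto
    have out: "bump p q m x = 0" if "x \<notin> cbox p q" for x
      using that box_subset_cbox bump_outside by blast
    have bint: "(\<lambda>x. bump p q m x *\<^sub>R h x) integrable_on D" if "h absolutely_integrable_on ?E" for h :: "real^'n \<Rightarrow> real^'m"
    proof -
      have "integrable lebesgue (\<lambda>x. indicator ?E x *\<^sub>R h x)" using that by (simp add: set_integrable_def)
      then have "integrable lebesgue (\<lambda>x. bump p q m x *\<^sub>R (indicator ?E x *\<^sub>R h x))"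
        by (rule integrable_scaleR_bounded[where B=1]) (use bump_bounds[of p q m] bm in auto)
      then have "(\<lambda>x. bump p q m x *\<^sub>R (indicator ?E x *\<^sub>R h x)) integrable_on UNIV"
        by (rule integrable_on_lebesgue)
      moreover have "(\<lambda>x. if x \<in> D then bump p q m x *\<^sub>R h x else 0) = (\<lambda>x. bump p q m x *\<^sub>R (indicator ?E x *\<^sub>R h x))"
      proof
        fix x
        show "(if x \<in> D then bump p q m x *\<^sub>R h x else 0) = bump p q m x *\<^sub>R (indicator ?E x *\<^sub>R h x)"
          using out[of x] pq box by (cases "x \<in> cbox p q") auto
      qed
      ultimately show ?thesis by (simp add: integrable_restrict_UNIV[symmetric, of _ D])
    qed
    have "(LINT x|lebesgue. bump p q m x *\<^sub>R u j x) = integral D (\<lambda>x. bump p q m x *\<^sub>R g j x) - integral D (\<lambda>x. bump p q m x *\<^sub>R G x)" for j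
    proof -
      have "integrable lebesgue (\<lambda>x. bump p q m x *\<^sub>R u j x)"
        using bump_bounds[of p q m] bm by (intro integrable_scaleR_bounded[OF u, where B=1]) auto
      then have "(LINT x|lebesgue. bump p q m x *\<^sub>R u j x) = integral UNIV (\<lambda>x. bump p q m x *\<^sub>R u j x)"
        by (rule integral_lebesgue[symmetric])
      also have "\<dots> = integral D (\<lambda>x. bump p q m x *\<^sub>R (g j x - G x))"
        using pq pqD by (intro integral_eq_of_support[symmetric, of "cbox p q"]) (auto simp: out u_def)
      also have "\<dots> = integral D (\<lambda>x. bump p q m x *\<^sub>R g j x) - integral D (\<lambda>x. bump p q m x *\<^sub>R G x)"
        unfolding scaleR_diff_right using bint gG by (intro Henstock_Kurzweil_Integration.integral_diff) auto
      finally show ?thesis .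
    qed
    moreover have "(\<lambda>j. integral D (\<lambda>x. bump p q m x *\<^sub>R g j x) - integral D (\<lambda>x. bump p q m x *\<^sub>R G x)) \<longlonglongrightarrow> 0"
      using weak_partial_test_convergence[OF fs weak G pqD unif[OF compact_cbox pqD], of m] by (simp add: LIM_zero)
    ultimately show "(\<lambda>j. LINT x|lebesgue. bump p q m x *\<^sub>R u j x) \<longlonglongrightarrow> 0" by simp
    show "indicator (box p q) \<in> borel_measurable lebesgue"
      by (rule borel_measurable_indicator) simp
    show "\<bar>indicator (box p q) x\<bar> \<le> (1::real)" for x by (simp add: indicator_def)
  qed (use C'(2) in auto)
  have AEbox: "AE x in lebesgue. x \<in> ?E \<longrightarrow> x \<in> box a b"
    unfolding AE_lebesgue_iff_negligible
    by (rule negligible_subset[OF negligible_frontier_interval[of a b]]) (auto simp: frontier_def)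
  have um: "u j \<in> borel_measurable lebesgue" for j using u by auto
  have bum: "(\<lambda>x. indicator (box p q) x *\<^sub>R u j x) \<in> borel_measurable lebesgue" for p q j
    by (intro borel_measurable_scaleR borel_measurable_indicator um) simp
  \<comment> \<open>An arbitrary box is intersected with \<open>box a b\<close>; the boundary of
    \<open>cbox a b\<close> is a null set.\<close>
  have box': "(\<lambda>j. LINT x|lebesgue. indicator (box p q) x *\<^sub>R u j x) \<longlonglongrightarrow> 0" for p q
  proof -
    have "\<exists>p' q'. box p q \<inter> box a b = box p' q'"
      by (intro exI) (rule box_Int_box)
    then obtain p' q' where pq': "box p q \<inter> box a b = box p' q'" by (elim exE)
    have "AE x in lebesgue. indicator (box p q) x *\<^sub>R u j x = indicator (box p' q') x *\<^sub>R u j x" for j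
      using AEbox by eventually_elim (use pq' in \<open>auto simp: indicator_def u_def\<close>)
    then have eq: "(LINT x|lebesgue. indicator (box p q) x *\<^sub>R u j x) = (LINT x|lebesgue. indicator (box p' q') x *\<^sub>R u j x)" for j
      by (intro integral_cong_AE bum)
    \<comment> \<open>If the open box is empty, the closed box with the same corners may still be
      non-empty and leave \<open>?E\<close>; hence the case distinction.\<close>
    show ?thesis
    proof (cases "box p' q' = {}")
      case False
      have "box p' q' \<subseteq> ?E" using pq' box_subset_cbox[of a b] by auto
      then have "closure (box p' q') \<subseteq> ?E" by (intro closure_minimal) auto
      then have "cbox p' q' \<subseteq> ?E" using False by (simp add: closure_box)
      then show ?thesis unfolding eq by (rule cbox)
    qed (simp add: eq)
  qed
  have total: "(\<lambda>j. LINT x|lebesgue. u j x) \<longlonglongrightarrow> 0"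
  proof -
    have "AE x in lebesgue. u j x = indicator (box a b) x *\<^sub>R u j x" for j
      using AEbox by eventually_elim (auto simp: indicator_def u_def)
    then have "(LINT x|lebesgue. u j x) = (LINT x|lebesgue. indicator (box a b) x *\<^sub>R u j x)" for j
      by (intro integral_cong_AE bum um)
    then show ?thesis using box'[of a b] by simp
  qed
  have "(\<lambda>j. LINT x|lebesgue. w x *\<^sub>R u j x) \<longlonglongrightarrow> 0"
    by (rule bounded_weak_convergence_of_boxes[OF Em u u0 ubound _ uequi box' total w]) (use C'(2) in auto)
  then show ?thesis by (simp only: u_def)
qed


text \<open>A compact set is covered by finitely many boxes contained in \<open>D\<close>.
  Convergence on boxes passes to measurable subsets and to disjoint unions, hence to
  \<open>K\<close>; a vector-valued \<open>h\<close> is then treated one component at a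
  time.\<close>

lemma weak_partial_weak_conv:
  fixes f :: "real^'n \<Rightarrow> real^'m" and fs :: "nat \<Rightarrow> real^'n \<Rightarrow> real^'m"
  assumes D: "open D" and fs: "\<And>j. continuous_on D (fs j)" and weak: "\<And>j. weak_partial D (fs j) i (g j)" and G: "weak_partial D f i G"
    and unif: "\<And>K. compact K \<Longrightarrow> K \<subseteq> D \<Longrightarrow> uniform_limit K fs f sequentially"
    and equi: "\<And>K. compact K \<Longrightarrow> K \<subseteq> D \<Longrightarrow> equi_int K g"
    and bnd: "\<And>K. compact K \<Longrightarrow> K \<subseteq> D \<Longrightarrow> \<exists>C. \<forall>j. (\<integral>\<^sup>+x. indicator K x * ennreal (norm (g j x)) \<partial>lebesgue) \<le> ennreal C"
  shows "weak_conv_L1loc D g G"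
  unfolding weak_conv_L1loc_def
proof (intro allI impI, elim conjE)
  fix K and h :: "real^'n \<Rightarrow> real^'m"
  assume K: "compact K" "K \<subseteq> D" and h: "h measurable_on K" "bounded (h ` K)"
  define u where "u j x = g j x - G x" for j x
  \<comment> \<open>Quantifying over all bounded weights makes the property pass to measurable
    subsets: the indicator of the subset is absorbed into the weight.\<close>
  define good where "good S \<longleftrightarrow> S \<in> sets lebesgue \<and> (\<forall>w\<in>borel_measurable lebesgue. \<forall>c>0. (\<forall>x. \<bar>w x\<bar> \<le> c) \<longrightarrow>
     (\<forall>j. integrable lebesgue (\<lambda>x. w x *\<^sub>R (indicator S x *\<^sub>R u j x))) \<and>
     (\<lambda>j. LINT x|lebesgue. w x *\<^sub>R (indicator S x *\<^sub>R u j x)) \<longlonglongrightarrow> 0)" for S :: "(real^'n) set"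
  have gG: "g j absolutely_integrable_on S" "G absolutely_integrable_on S" if "compact S" "S \<subseteq> D" for j S
    using weak[of j] G that by (auto simp: weak_partial_def loc_integrable_def)
  have good_cbox: "good (cbox a b)" if ab: "cbox a b \<subseteq> D" for a b
    unfolding good_def
  proof (intro conjI ballI allI impI)
    fix w :: "real^'n \<Rightarrow> real" and c :: real assume w: "w \<in> borel_measurable lebesgue" "c > 0" "\<forall>x. \<bar>w x\<bar> \<le> c"
    have "integrable lebesgue (\<lambda>x. indicator (cbox a b) x *\<^sub>R u j x)" for j
      unfolding u_def scaleR_diff_right using gG[OF compact_cbox ab]
      by (intro Bochner_Integration.integrable_diff) (auto simp: set_integrable_def)
    then show "integrable lebesgue (\<lambda>x. w x *\<^sub>R (indicator (cbox a b) x *\<^sub>R u j x))" for j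
      by (rule integrable_scaleR_bounded[where B=c]) (use w in auto)
    obtain C where C: "\<And>j. (\<integral>\<^sup>+x. indicator (cbox a b) x * ennreal (norm (g j x)) \<partial>lebesgue) \<le> ennreal C"
      using bnd[OF compact_cbox ab] by blast
    show "(\<lambda>j. LINT x|lebesgue. w x *\<^sub>R (indicator (cbox a b) x *\<^sub>R u j x)) \<longlonglongrightarrow> 0"
      unfolding u_def
      by (rule weak_partial_box_convergence[OF fs weak G ab unif equi[OF compact_cbox ab] C w(1) _ w(2)])
         (use w(3) in auto)
  qed simp
  have goodD: "integrable lebesgue (\<lambda>x. w x *\<^sub>R (indicator S x *\<^sub>R u j x))"
      "(\<lambda>j. LINT x|lebesgue. w x *\<^sub>R (indicator S x *\<^sub>R u j x)) \<longlonglongrightarrow> 0"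
    if "good S" "w \<in> borel_measurable lebesgue" "c > 0" "\<forall>x. \<bar>w x\<bar> \<le> c" for S w and c :: real and j
  proof -
    note * = conjunct2[OF that(1)[unfolded good_def], THEN bspec, OF that(2), THEN spec, THEN mp, OF that(3), THEN mp, OF that(4)]
    show "integrable lebesgue (\<lambda>x. w x *\<^sub>R (indicator S x *\<^sub>R u j x))"
      by (rule conjunct1[OF *, THEN spec])
    show "(\<lambda>j. LINT x|lebesgue. w x *\<^sub>R (indicator S x *\<^sub>R u j x)) \<longlonglongrightarrow> 0"
      by (rule conjunct2[OF *])
  qed
  have good_mono: "good B" if "good A" "B \<subseteq> A" "B \<in> sets lebesgue" for A B
    unfolding good_def
  proof (intro conjI ballI allI impI that(3))
    fix w :: "real^'n \<Rightarrow> real" and c :: real assume w: "w \<in> borel_measurable lebesgue" "c > 0" "\<forall>x. \<bar>w x\<bar> \<le> c"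
    have eq: "w x *\<^sub>R (indicator B x *\<^sub>R u j x) = (indicator B x * w x) *\<^sub>R (indicator A x *\<^sub>R u j x)" for x j
      using that(2) by (auto simp: indicator_def)
    have m: "(\<lambda>x. indicator B x * w x) \<in> borel_measurable lebesgue"
      using w(1) that(3) by simp
    have b: "\<forall>x. \<bar>indicator B x * w x\<bar> \<le> c"
      using w(2,3) by (auto simp: indicator_def)
    show "integrable lebesgue (\<lambda>x. w x *\<^sub>R (indicator B x *\<^sub>R u j x))" for j
      unfolding eq by (rule goodD(1)[OF that(1) m w(2) b])
    show "(\<lambda>j. LINT x|lebesgue. w x *\<^sub>R (indicator B x *\<^sub>R u j x)) \<longlonglongrightarrow> 0"
      unfolding eq by (rule goodD(2)[OF that(1) m w(2) b])
  qed
  have good_disj: "good (A \<union> B)" if "good A" "good B" "A \<inter> B = {}" for A B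
    unfolding good_def
  proof (intro conjI ballI allI impI)
    show "A \<union> B \<in> sets lebesgue" using that by (auto simp: good_def)
    fix w :: "real^'n \<Rightarrow> real" and c :: real assume w: "w \<in> borel_measurable lebesgue" "c > 0" "\<forall>x. \<bar>w x\<bar> \<le> c"
    have eq: "w x *\<^sub>R (indicator (A \<union> B) x *\<^sub>R u j x) = w x *\<^sub>R (indicator A x *\<^sub>R u j x) + w x *\<^sub>R (indicator B x *\<^sub>R u j x)" for x j
      using that(3) by (auto simp: indicator_def)
    note a = goodD[OF that(1) w] and b = goodD[OF that(2) w]
    show "integrable lebesgue (\<lambda>x. w x *\<^sub>R (indicator (A \<union> B) x *\<^sub>R u j x))" for j
      unfolding eq by (intro Bochner_Integration.integrable_add a(1) b(1))
    have "(LINT x|lebesgue. w x *\<^sub>R (indicator (A \<union> B) x *\<^sub>R u j x)) =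
        (LINT x|lebesgue. w x *\<^sub>R (indicator A x *\<^sub>R u j x)) + (LINT x|lebesgue. w x *\<^sub>R (indicator B x *\<^sub>R u j x))" for j
      unfolding eq by (intro Bochner_Integration.integral_add a(1) b(1))
    then show "(\<lambda>j. LINT x|lebesgue. w x *\<^sub>R (indicator (A \<union> B) x *\<^sub>R u j x)) \<longlonglongrightarrow> 0"
      using tendsto_add[OF a(2) b(2)] by simp
  qed
  have good_UN: "good (\<Union>\<F>)" if "finite \<F>" "\<And>S. S \<in> \<F> \<Longrightarrow> good S" for \<F>
    using that
  proof (induction \<F> rule: finite_induct)
    case empty
    then show ?case by (simp add: good_def)
  next
    case (insert S \<F>)
    have S: "good S" and F: "good (\<Union>\<F>)" using insert by auto
    have "good (\<Union>\<F> - S)"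
      by (rule good_mono[OF F]) (use S F in \<open>auto simp: good_def\<close>)
    from good_disj[OF S this] have "good (S \<union> (\<Union>\<F> - S))" by blast
    then show ?case by simp
  qed
  have Ks: "K \<in> sets lebesgue" using K(1) by (simp add: lmeasurable_compact fmeasurableD)
  have goodK: "good K"
  proof -
    have "\<forall>x\<in>K. \<exists>a b. x \<in> box a b \<and> cbox a b \<subseteq> D"
      using D K(2) by (meson open_contains_cbox subsetD)
    then obtain a b where ab: "\<And>x. x \<in> K \<Longrightarrow> x \<in> box (a x) (b x)" "\<And>x. x \<in> K \<Longrightarrow> cbox (a x) (b x) \<subseteq> D"
      by metis
    have cover: "K \<subseteq> (\<Union>x\<in>K. box (a x) (b x))" using ab(1) by blast
    obtain X where X: "X \<subseteq> K" "finite X" "K \<subseteq> (\<Union>x\<in>X. box (a x) (b x))"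
      by (rule compactE_image[OF K(1) open_box cover])
    have "good (\<Union>((\<lambda>x. cbox (a x) (b x)) ` X))"
      using X ab(2) good_cbox by (intro good_UN) auto
    moreover have "K \<subseteq> \<Union>((\<lambda>x. cbox (a x) (b x)) ` X)"
      using X(3) box_subset_cbox by blast
    ultimately show ?thesis using Ks by (rule good_mono)
  qed
  have hm: "h \<in> borel_measurable (lebesgue_on K)"
    using h(1) Ks by (simp add: measurable_on_iff_borel_measurable)
  obtain c where c: "c > 0" "\<And>x. x \<in> K \<Longrightarrow> norm (h x) \<le> c"
    using h(2) by (auto simp: bounded_pos)
  define w where "w k x = indicator K x * h x $ k" for k x
  have wm: "w k \<in> borel_measurable lebesgue" for k
  proof -
    have "(\<lambda>x. h x $ k) \<in> borel_measurable (lebesgue_on K)"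
      by (rule measurable_compose[OF hm borel_measurable_continuous_onI]) (intro continuous_intros)
    then have "(\<lambda>x. indicator K x *\<^sub>R (h x $ k)) \<in> borel_measurable lebesgue"
      using Ks by (subst borel_measurable_restrict_space_iff[symmetric]) auto
    then show ?thesis by (simp add: w_def[abs_def])
  qed
  have wb: "\<forall>x. \<bar>w k x\<bar> \<le> c" for k
    using c component_le_norm_cart[of "h _" k] by (auto simp: w_def indicator_def intro: order_trans)
  note goodw = goodD[OF goodK wm c(1) wb]
  \<comment> \<open>Only scalar weights are available. The \<open>k\<close>-th component of
    \<open>h\<close> weights the vector \<open>u j\<close>, and the \<open>k\<close>-th components
    of the results are summed to recover the inner product.\<close>
  have uh: "integral K (\<lambda>x. u j x \<bullet> h x) = (\<Sum>k\<in>UNIV. (LINT x|lebesgue. w k x *\<^sub>R (indicator K x *\<^sub>R u j x)) $ k)"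
    "(\<lambda>x. u j x \<bullet> h x) absolutely_integrable_on K" for j
  proof -
    have eq: "indicator K x *\<^sub>R (u j x \<bullet> h x) = (\<Sum>k\<in>UNIV. (w k x *\<^sub>R (indicator K x *\<^sub>R u j x)) $ k)" for x
      by (auto simp: w_def inner_vec_def indicator_def mult.commute)
    have i: "integrable lebesgue (\<lambda>x. (w k x *\<^sub>R (indicator K x *\<^sub>R u j x)) $ k)" for k
      by (intro integrable_bounded_linear[OF bounded_linear_vec_nth] goodw(1))
    have l: "(LINT x|lebesgue. (w k x *\<^sub>R (indicator K x *\<^sub>R u j x)) $ k) = (LINT x|lebesgue. w k x *\<^sub>R (indicator K x *\<^sub>R u j x)) $ k" for k
      by (intro integral_bounded_linear[OF bounded_linear_vec_nth] goodw(1))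
    show ai: "(\<lambda>x. u j x \<bullet> h x) absolutely_integrable_on K"
      unfolding set_integrable_def eq using i by (rule Bochner_Integration.integrable_sum)
    have "integral K (\<lambda>x. u j x \<bullet> h x) = (LINT x|lebesgue. indicator K x *\<^sub>R (u j x \<bullet> h x))"
      using set_lebesgue_integral_eq_integral(2)[OF ai] by (simp add: set_lebesgue_integral_def)
    also have "\<dots> = (\<Sum>k\<in>UNIV. LINT x|lebesgue. (w k x *\<^sub>R (indicator K x *\<^sub>R u j x)) $ k)"
      unfolding eq using i by (rule Bochner_Integration.integral_sum)
    finally show "integral K (\<lambda>x. u j x \<bullet> h x) = (\<Sum>k\<in>UNIV. (LINT x|lebesgue. w k x *\<^sub>R (indicator K x *\<^sub>R u j x)) $ k)"
      by (simp only: l)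
  qed
  have Gh: "(\<lambda>x. G x \<bullet> h x) absolutely_integrable_on K"
    using absolutely_integrable_bounded_measurable_product[of "\<lambda>x y. y \<bullet> x", OF _ hm Ks h(2) gG(2)[OF K]]
    by (simp add: bilinear_def linear_iff inner_simps)
  have "integral K (\<lambda>x. g j x \<bullet> h x) = integral K (\<lambda>x. G x \<bullet> h x) + integral K (\<lambda>x. u j x \<bullet> h x)" for j
  proof -
    have "integral K (\<lambda>x. G x \<bullet> h x + u j x \<bullet> h x) = integral K (\<lambda>x. G x \<bullet> h x) + integral K (\<lambda>x. u j x \<bullet> h x)"
      using Gh uh(2) by (intro Henstock_Kurzweil_Integration.integral_add set_lebesgue_integral_eq_integral(1))
    then show ?thesis by (simp add: u_def inner_diff_left)
  qed
  moreover have "(\<lambda>j. integral K (\<lambda>x. u j x \<bullet> h x)) \<longlonglongrightarrow> 0"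
  proof -
    have "(\<lambda>j. \<Sum>k\<in>UNIV. (LINT x|lebesgue. w k x *\<^sub>R (indicator K x *\<^sub>R u j x)) $ k) \<longlonglongrightarrow> (\<Sum>k\<in>(UNIV::'m set). (0::real^'m) $ k)"
      by (intro tendsto_sum tendsto_vec_nth goodw(2))
    then show ?thesis by (simp add: uh(1))
  qed
  ultimately show "(\<lambda>j. integral K (\<lambda>x. g j x \<bullet> h x)) \<longlonglongrightarrow> integral K (\<lambda>x. G x \<bullet> h x)"
    by (simp add: tendsto_add[OF tendsto_const, of _ 0, simplified])
qed

section \<open>Semicontinuity of the dilatation\<close>

lemma continuous_on_onorm_matrix: "continuous_on UNIV (\<lambda>A::real^'n^'m. onorm ((*v) A))"
proof -
  have le: "onorm ((*v) A) \<le> onorm ((*v) B) + norm (A - B)" for A B :: "real^'n^'m"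
  proof (rule onorm_bound)
    fix x :: "real^'n"
    have "norm (A *v x) \<le> norm (B *v x) + norm ((A - B) *v x)"
      using norm_triangle_ineq[of "B *v x" "(A - B) *v x"] by (simp add: matrix_vector_mult_diff_rdistrib)
    also have "\<dots> \<le> onorm ((*v) B) * norm x + norm (A - B) * norm x"
      by (intro add_mono onorm norm_matrix_vector_mult_le) simp
    finally show "norm (A *v x) \<le> (onorm ((*v) B) + norm (A - B)) * norm x"
      by (simp add: distrib_right)
  qed (simp add: onorm_pos_le)
  have "dist (onorm ((*v) A)) (onorm ((*v) B)) \<le> dist A B" for A B :: "real^'n^'m"
    using le[of A B] le[of B A] by (simp add: dist_norm norm_minus_commute abs_le_iff)
  then have "1-lipschitz_on UNIV (\<lambda>A::real^'n^'m. onorm ((*v) A))"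
    by (intro lipschitz_onI) auto
  then show ?thesis by (rule lipschitz_on_continuous_on)
qed

text \<open>A real-valued measurable substitute for \<open>P_dil\<close> as a function of the
  matrix. The value 1 at nonzero singular matrices, where the dilatation is infinite, is a default:
  comparisons are made only where the dilatation is finite.\<close>

definition matrix_dil :: "real^'n^'n \<Rightarrow> real" where
  "matrix_dil A = (if det A = 0 then 1
     else (onorm ((*v) A) ^ CARD('n) / \<bar>det A\<bar>) powr (1 / (real CARD('n) - 1)))"

lemma borel_measurable_matrix_dil [measurable (raw)]:
  assumes "A \<in> borel_measurable M"
  shows "(\<lambda>x. matrix_dil (A x)) \<in> borel_measurable M"
proof -
  have [measurable]: "(\<lambda>x. onorm ((*v) (A x))) \<in> borel_measurable M"
    using measurable_compose[OF assms borel_measurable_continuous_onI[OF continuous_on_onorm_matrix]] .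
  note [measurable] = assms
  show ?thesis unfolding matrix_dil_def by measurable
qed

lemma P_dil_eq_matrix_dil:
  assumes "CARD('n) \<ge> 2" "P_dil f (x :: real^'n) \<le> ereal c"
  shows "P_dil f x = ereal (matrix_dil (jac f x))"
proof -
  have "row i (0 :: real^'n^'n) = 0" for i by (simp add: row_def vec_eq_iff)
  then have "det (0 :: real^'n^'n) = 0" by (rule det_zero_row)
  moreover have "P_dil f x \<noteq> \<infinity>" using assms(2) by auto
  ultimately show ?thesis by (auto simp: P_dil_alt matrix_dil_def one_ereal_def split: if_splits)
qed

text \<open>The image of the unit cube has volume \<open>\<bar>det L\<bar>\<close>; the singular
  case is separate because substitution needs injectivity. Outer regularity gives an open superset
  with little extra volume, and compactness a margin \<open>t\<close>, so that any map within
  \<open>t\<close> of \<open>L\<close> still sends the cube into \<open>U\<close>.\<close>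

lemma linear_cube_neighbourhood:
  fixes L :: "real^'n^'n"
  assumes e: "e > 0"
  obtains U t where "open U" "t > 0" "emeasure lebesgue U \<le> ennreal (\<bar>det L\<bar> + e)"
    "\<And>y z. y \<in> cube 1 \<Longrightarrow> norm z \<le> t \<Longrightarrow> L *v y + z \<in> U"
proof -
  let ?C = "(*v) L ` cube 1"
  have C: "compact ?C"
    by (intro compact_continuous_image linear_continuous_on) auto
  have eC: "emeasure lebesgue ?C = ennreal \<bar>det L\<bar>"
  proof (cases "det L = 0")
    case True
    then have "\<not> inj ((*v) L)" using det_nz_iff_inj[of "(*v) L"] by simp
    then have "negligible ?C" by (intro negligible_linear_singular_image) auto
    then have "emeasure lebesgue ?C = 0" by (simp add: negligible_iff_null_sets null_setsD1)
    then show ?thesis using True by simp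
  next
    case False
    then have inj: "inj ((*v) L)" using det_nz_iff_inj[of "(*v) L"] by simp
    have "(\<integral>\<^sup>+x. ennreal \<bar>det L\<bar> * indicator (cube 1 :: (real^'n) set) x \<partial>lborel) = emeasure lebesgue ?C"
      by (rule measure_image_has_derivative(2)[where A="\<lambda>_. L"])
         (use inj C in \<open>auto intro!: bounded_linear_imp_has_derivative intro: inj_on_subset compact_imp_bounded\<close>)
    then show ?thesis
      using emeasure_cube[of 1 "0::real^'n"] by (simp add: nn_integral_cmult)
  qed
  have Cs: "?C \<in> sets lebesgue" using C by (simp add: lmeasurable_compact fmeasurableD)
  obtain U where U: "open U" "?C \<subseteq> U" "U - ?C \<in> lmeasurable" "emeasure lebesgue (U - ?C) < ennreal e"
    by (rule sets_lebesgue_outer_open[OF Cs e])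
  obtain t where t: "t > 0" "(\<Union>x\<in>?C. cball x t) \<subseteq> U"
    by (rule compact_subset_open_imp_cball_epsilon_subset[OF C U(1,2)])
  show thesis
  proof (rule that[OF U(1) t(1)])
    have "emeasure lebesgue U = emeasure lebesgue ?C + emeasure lebesgue (U - ?C)"
      using plus_emeasure[OF Cs fmeasurableD[OF U(3)]] U(2) by (simp add: Un_absorb1)
    also have "\<dots> \<le> ennreal \<bar>det L\<bar> + ennreal e"
      using U(4) eC by (intro add_mono) auto
    finally show "emeasure lebesgue U \<le> ennreal (\<bar>det L\<bar> + e)"
      using e by simp
    fix y z :: "real^'n" assume "y \<in> cube 1" "norm z \<le> t"
    then show "L *v y + z \<in> U"
      using t(2) by (force simp: dist_norm)
  qed
qed

text \<open>The order of the limits matters. The error term has no overall factor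
  \<open>\<eta>\<close>, so \<open>e\<close> tends to 0 at fixed \<open>\<eta>\<close>; only then is
  \<open>\<eta>\<close> divided out and sent to 0.\<close>

lemma increment_limit:
  fixes N a b q d :: real
  assumes "\<And>e \<eta>. 0 < e \<Longrightarrow> 0 < \<eta> \<Longrightarrow>
    \<eta> * N - 2 * e * (1 + 2 * \<eta>) \<le> \<eta> * (1 + 2 * \<eta>) ^ n * (a * (q + e) + b * (d + e))"
  shows "N \<le> a * q + b * d"
proof -
  have 1: "\<eta> * N \<le> \<eta> * (1 + 2 * \<eta>) ^ n * (a * q + b * d)" if "\<eta> > 0" for \<eta>
  proof -
    have "((\<lambda>e. \<eta> * N - 2 * e * (1 + 2 * \<eta>)) \<longlongrightarrow> \<eta> * N - 2 * 0 * (1 + 2 * \<eta>)) (at_right 0)"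
      by (intro tendsto_intros)
    moreover have "((\<lambda>e. \<eta> * (1 + 2 * \<eta>) ^ n * (a * (q + e) + b * (d + e))) \<longlongrightarrow>
        \<eta> * (1 + 2 * \<eta>) ^ n * (a * (q + 0) + b * (d + 0))) (at_right 0)"
      by (intro tendsto_intros)
    moreover have "\<forall>\<^sub>F e in at_right 0. \<eta> * N - 2 * e * (1 + 2 * \<eta>) \<le> \<eta> * (1 + 2 * \<eta>) ^ n * (a * (q + e) + b * (d + e))"
      using assms that by (auto simp: eventually_at_filter)
    ultimately show ?thesis
      using tendsto_le[OF trivial_limit_at_right_real] by force
  qed
  have "N \<le> (1 + 2 * \<eta>) ^ n * (a * q + b * d)" if "\<eta> > 0" for \<eta>
    using 1[OF that] that by (simp add: mult.assoc)
  then have "\<forall>\<^sub>F \<eta> in at_right 0. N \<le> (1 + 2 * \<eta>) ^ n * (a * q + b * d)"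
    by (auto simp: eventually_at_filter)
  moreover have "((\<lambda>\<eta>. (1 + 2 * \<eta>) ^ n * (a * q + b * d)) \<longlongrightarrow> (1 + 2 * 0) ^ n * (a * q + b * d)) (at_right 0)"
    by (intro tendsto_intros)
  ultimately show ?thesis
    using tendsto_lowerbound[OF _ _ trivial_limit_at_right_real] by force
qed

text \<open>Lebesgue points bound the means over corner cubes from above. A Borel representative is
  substituted for \<open>q\<close>, and base points where the two differ are discarded.\<close>

lemma AE_lebesgue_point_real:
  fixes q :: "real^'n \<Rightarrow> real"
  assumes q: "integrable lebesgue q" "\<And>x. 0 \<le> q x"
  shows "AE x in lebesgue. \<forall>e>0. \<exists>d>0. \<forall>r. 0 < r \<and> r < d \<longrightarrow>
    (\<integral>\<^sup>+y. indicator (cbox x (x + r *\<^sub>R One)) y * ennreal (q y) \<partial>lebesgue) \<le> ennreal ((q x + e) * r ^ CARD('n))"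
proof -
  obtain q' where q'm [measurable]: "q' \<in> borel_measurable lborel" and q': "AE x in lborel. q x = q' x"
    using completion_ex_borel_measurable_real[of q lborel] q(1) by auto
  have q'L: "AE x in lebesgue. q x = q' x" using q' by (rule AE_completion)
  have "integrable lebesgue q'"
    using integrable_cong_AE[OF _ _ q'L] q(1) q'm by (simp add: measurable_completion)
  then have int: "integrable lborel q'" using integrable_completion q'm by blast
  show ?thesis
    using q'L AE_completion[OF AE_lebesgue_point[OF int]]
  proof eventually_elim
    case (elim x)
    show ?case
    proof (intro allI impI)
      fix e :: real assume "e > 0"
      then obtain d where d: "d > 0" "\<And>r. 0 < r \<Longrightarrow> r < d \<Longrightarrow>
        (\<integral>\<^sup>+w. indicator (cube r) w * ennreal (norm (q' (x + w) - q' x)) \<partial>lborel) \<le> ennreal (e * r ^ CARD('n))"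
        using elim(2) by auto
      have "(\<integral>\<^sup>+y. indicator (cbox x (x + r *\<^sub>R One)) y * ennreal (q y) \<partial>lebesgue) \<le> ennreal ((q x + e) * r ^ CARD('n))"
        if r: "0 < r" "r < d" for r
      proof -
        have "(\<integral>\<^sup>+y. indicator (cbox x (x + r *\<^sub>R One)) y * ennreal (q y) \<partial>lebesgue) =
          (\<integral>\<^sup>+y. indicator (cbox x (x + r *\<^sub>R One)) y * ennreal (q' y) \<partial>lebesgue)"
          by (intro nn_integral_cong_AE eventually_mono[OF q'L]) simp
        also have "\<dots> = (\<integral>\<^sup>+y. indicator (cbox x (x + r *\<^sub>R One)) y * ennreal (q' y) \<partial>lborel)"
          by (rule nn_integral_completion)
        also have "\<dots> = (\<integral>\<^sup>+w. indicator (cbox x (x + r *\<^sub>R One)) (x + w) * ennreal (q' (x + w)) \<partial>lborel)"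
          by (rule nn_integral_lborel_translate[symmetric]) measurable
        also have "\<dots> \<le> (\<integral>\<^sup>+w. ennreal (q x) * indicator (cube r) w + indicator (cube r) w * ennreal (norm (q' (x + w) - q' x)) \<partial>lborel)"
        proof (rule nn_integral_mono)
          fix w :: "real^'n"
          have "ennreal (q' (x + w)) \<le> ennreal (q x + norm (q' (x + w) - q' x))"
            using elim(1) by (intro ennreal_leI) auto
          also have "\<dots> = ennreal (q x) + ennreal (norm (q' (x + w) - q' x))"
            using q(2) by simp
          finally show "indicator (cbox x (x + r *\<^sub>R One)) (x + w) * ennreal (q' (x + w)) \<le>
            ennreal (q x) * indicator (cube r) w + indicator (cube r) w * ennreal (norm (q' (x + w) - q' x))"
            by (auto simp: indicator_def mem_box inner_simps)
        qed
        also have "\<dots> = ennreal (q x) * emeasure lborel (cube r :: (real^'n) set) +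
            (\<integral>\<^sup>+w. indicator (cube r) w * ennreal (norm (q' (x + w) - q' x)) \<partial>lborel)"
          by (subst nn_integral_add) (auto simp: nn_integral_cmult_indicator)
        also have "\<dots> \<le> ennreal (q x) * ennreal (r ^ CARD('n)) + ennreal (e * r ^ CARD('n))"
          using emeasure_cube[of r "0::real^'n"] r d(2)[OF r] by (intro add_mono mult_left_mono) auto
        also have "\<dots> = ennreal ((q x + e) * r ^ CARD('n))"
          using q(2)[of x] r \<open>e > 0\<close> by (simp add: ennreal_mult[symmetric] ennreal_plus[symmetric] distrib_right del: ennreal_plus)
        finally show ?thesis .
      qed
      with d(1) show "\<exists>d>0. \<forall>r. 0 < r \<and> r < d \<longrightarrow>
        (\<integral>\<^sup>+y. indicator (cbox x (x + r *\<^sub>R One)) y * ennreal (q y) \<partial>lebesgue) \<le> ennreal ((q x + e) * r ^ CARD('n))"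
        by blast
    qed
  qed
qed


text \<open>The inner cube \<open>B\<close> is shrunk so that its translates along \<open>v = \<eta> r h\<close> remain in the large cube.\<close>

lemma increment_estimate:
  fixes F :: "real^'n \<Rightarrow> real^'n" and L :: "real^'n^'n"
  assumes D: "open D" and F: "continuous_on D F" "inj_on F D" and weak: "\<And>i. weak_partial D F i (g i)"
    and dist: "AE x in lebesgue. x \<in> D \<longrightarrow> 1 \<le> p x \<and>
      onorm ((*v) (grad g x)) ^ CARD('n) \<le> p x ^ (CARD('n) - 1) * \<bar>det (grad g x)\<bar>"
    and \<rho>: "cball x0 (2 * \<rho>) \<subseteq> D" "real CARD('n) * R < \<rho>"
    and p: "p absolutely_integrable_on (cbox x0 (x0 + R *\<^sub>R One))"
    and \<eta>: "0 < \<eta>" and r: "0 < r" and R: "R = (1 + 2 * \<eta>) * r"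
    and h: "norm h \<le> 1" and l: "l > 0" and pos: "0 \<le> c" "0 \<le> m" "0 \<le> t"
    and close: "\<And>y. y \<in> cbox x0 (x0 + R *\<^sub>R One) \<Longrightarrow> norm (F y - b - L *v (y - x0)) \<le> t * R"
    and pQ: "(\<integral>\<^sup>+x. indicator (cbox x0 (x0 + R *\<^sub>R One)) x * ennreal (p x) \<partial>lebesgue) \<le> ennreal (c * R ^ CARD('n))"
    and FQ: "emeasure lborel (F ` cbox x0 (x0 + R *\<^sub>R One)) \<le> ennreal (m * R ^ CARD('n))"
  shows "\<eta> * norm (L *v h) - 2 * t * (1 + 2 * \<eta>) \<le> \<eta> * (1 + 2 * \<eta>) ^ CARD('n) *
    ((real CARD('n) - 1) / real CARD('n) * l * c + 1 / (real CARD('n) * l ^ (CARD('n) - 1)) * m)"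
proof -
  let ?n = "CARD('n)" and ?Q = "cbox x0 (x0 + R *\<^sub>R One)"
  let ?a = "(real ?n - 1) / real ?n * l" and ?b = "1 / (real ?n * l ^ (?n - 1))"
  have n1: "1 \<le> ?n" by (simp add: Suc_leI)
  have ab: "0 \<le> ?a" "0 \<le> ?b" using l n1 by auto
  have R0: "0 < R" using R \<eta> r by simp
  have \<rho>0: "0 < \<rho>" using \<rho>(2) R0 by (smt (verit) mult_nonneg_nonneg of_nat_0_le_iff)
  have Rn: "R \<le> real ?n * R" using R0 n1 by simp
  define v where "v = (\<eta> * r) *\<^sub>R h"
  have nv: "norm v \<le> \<eta> * r" using h \<eta> r by (simp add: v_def mult_left_le)
  have \<eta>R: "\<eta> * r \<le> R" using R \<eta> r by (simp add: algebra_simps)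
  define B where "B = cbox (x0 + (\<eta> * r) *\<^sub>R One) (x0 + (\<eta> * r) *\<^sub>R One + r *\<^sub>R (One::real^'n))"
  have BQ: "x + s *\<^sub>R v \<in> ?Q" if x: "x \<in> B" and s: "\<bar>s\<bar> \<le> 1" for x s
  proof -
    have "0 \<le> (x - x0 + s *\<^sub>R v) \<bullet> i \<and> (x - x0 + s *\<^sub>R v) \<bullet> i \<le> R" if i: "i \<in> Basis" for i
    proof -
      have "\<bar>(s *\<^sub>R v) \<bullet> i\<bar> \<le> norm (s *\<^sub>R v)" using i by (rule Basis_le_norm)
      also have "\<dots> \<le> 1 * (\<eta> * r)" using s nv by (simp only: norm_scaleR) (intro mult_mono, auto)
      finally have "\<bar>(s *\<^sub>R v) \<bullet> i\<bar> \<le> \<eta> * r" by simp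
      moreover have "x0 \<bullet> i + \<eta> * r \<le> x \<bullet> i" "x \<bullet> i \<le> x0 \<bullet> i + \<eta> * r + r"
        using x i by (auto simp: B_def mem_box inner_simps)
      ultimately show ?thesis by (simp add: R inner_simps algebra_simps) linarith
    qed
    then show ?thesis by (auto simp: mem_box inner_simps algebra_simps)
  qed
  have Qball: "?Q \<subseteq> ball x0 \<rho>"
  proof
    fix y assume "y \<in> ?Q"
    then have "y - x0 \<in> cube R" by (auto simp: mem_box inner_simps algebra_simps)
    from norm_cube_le[OF this] show "y \<in> ball x0 \<rho>"
      using \<rho>(2) by (simp add: dist_norm norm_minus_commute)
  qed
  have QD: "?Q \<subseteq> D" using Qball \<rho>(1) \<rho>0 by (force simp: subset_iff)
  have Bb [measurable]: "B \<in> sets borel" by (simp add: B_def)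
  have BV: "B \<subseteq> ball x0 \<rho>" using BQ[of _ 0] Qball by auto
  have QK: "?Q \<subseteq> cball x0 (2 * \<rho>)" using Qball \<rho>0 by (force simp: subset_iff)
  have VU: "x + w \<in> ball x0 (2 * \<rho>)" if "x \<in> ball x0 \<rho>" "norm w < \<rho>" for x w
    using that norm_triangle_ineq[of "x - x0" w] by (simp add: dist_norm norm_minus_commute algebra_simps)
  obtain F' G where FG: "integrable lborel F'" "integrable lborel G"
    and F': "\<And>x. x \<in> cball x0 (2 * \<rho>) \<Longrightarrow> F' x = F x"
    and G: "AE x in lebesgue. x \<in> cball x0 (2 * \<rho>) \<longrightarrow> G x = grad g x"
    and star: "\<And>w. norm w < \<rho> \<Longrightarrow> AE x in lborel. x \<in> ball x0 \<rho> \<longrightarrow>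
      integrable lborel (\<lambda>s. indicator {0..1} s *\<^sub>R G (x + s *\<^sub>R w)) \<and>
      F' (x + w) - F' x = (LINT s|lborel. indicator {0..1} s *\<^sub>R G (x + s *\<^sub>R w)) *v w"
    by (rule weak_partial_translation[OF F(1) weak open_ball ball_subset_cball compact_cball \<rho>(1) VU]) blast+
  note [measurable] = borel_measurable_integrable[OF FG(2)]
  have nv\<rho>: "norm v < \<rho>" using nv \<eta>R Rn \<rho>(2) by linarith
  let ?W = "\<integral>\<^sup>+y. indicator ?Q y * ennreal (norm (G y *v h)) \<partial>lborel"
  \<comment> \<open>The increment of the affine approximation along \<open>v\<close> has norm
    \<open>\<eta> * r * norm (L *v h)\<close>, and each endpoint costs an error
    \<open>t * R\<close>. Should the difference be negative, \<open>ennreal\<close> turns it into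
    0.\<close>
  have "ennreal (\<eta> * r * norm (L *v h) - 2 * (t * R)) * emeasure lborel B \<le>
      (\<integral>\<^sup>+x. indicator B x * ennreal (norm (F' (x + v) - F' x)) \<partial>lborel)"
  proof -
    have "indicator B x * ennreal (\<eta> * r * norm (L *v h) - 2 * (t * R)) \<le> indicator B x * ennreal (norm (F' (x + v) - F' x))" for x
    proof (cases "x \<in> B")
      case True
      have Q: "x \<in> ?Q" "x + v \<in> ?Q" using BQ[OF True, of 0] BQ[OF True, of 1] by auto
      define e1 e2 where "e1 = F (x + v) - b - L *v (x + v - x0)" and "e2 = F x - b - L *v (x - x0)"
      have eq: "L *v v = F' (x + v) - F' x - e1 + e2"
        using Q QK F' by (simp add: e1_def e2_def subset_iff matrix_vector_mult_diff_distrib matrix_vector_right_distrib)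
      have "norm (L *v v) \<le> norm (F' (x + v) - F' x) + (t * R + t * R)"
        using close[OF Q(1)] close[OF Q(2)] norm_triangle_ineq[of "F' (x + v) - F' x - e1" e2]
          norm_triangle_ineq4[of "F' (x + v) - F' x" e1]
        unfolding eq e1_def[symmetric] e2_def[symmetric] by linarith
      moreover have "norm (L *v v) = \<eta> * r * norm (L *v h)"
        using \<eta> r by (simp add: v_def matrix_vector_mult_scaleR)
      ultimately have "\<eta> * r * norm (L *v h) - 2 * (t * R) \<le> norm (F' (x + v) - F' x)" by linarith
      then show ?thesis using True by (simp add: ennreal_leI)
    qed simp
    then have "(\<integral>\<^sup>+x. indicator B x * ennreal (\<eta> * r * norm (L *v h) - 2 * (t * R)) \<partial>lborel) \<le>
      (\<integral>\<^sup>+x. indicator B x * ennreal (norm (F' (x + v) - F' x)) \<partial>lborel)" by (rule nn_integral_mono)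
    then show ?thesis by (simp add: nn_integral_multc mult.commute)
  qed
  also have "\<dots> \<le> (\<integral>\<^sup>+s. indicator {0..1::real} s * (\<integral>\<^sup>+y. indicator B (y - s *\<^sub>R v) * ennreal (norm (G y *v v)) \<partial>lborel) \<partial>lborel)"
    by (rule translation_increment_bound[OF FG star[OF nv\<rho>] Bb BV])
  also have "\<dots> \<le> (\<integral>\<^sup>+s. indicator {0..1::real} s * (ennreal (\<eta> * r) * ?W) \<partial>lborel)"
  proof (intro nn_integral_mono)
    fix s :: real
    have "(\<integral>\<^sup>+y. indicator B (y - s *\<^sub>R v) * ennreal (norm (G y *v v)) \<partial>lborel) \<le> ennreal (\<eta> * r) * ?W"
      if s: "s \<in> {0..1}"
    proof -
      have "indicator B (y - s *\<^sub>R v) * ennreal (norm (G y *v v)) \<le> ennreal (\<eta> * r) * (indicator ?Q y * ennreal (norm (G y *v h)))" for y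
      proof (cases "y - s *\<^sub>R v \<in> B")
        case True
        then have "y \<in> ?Q" using BQ[OF True, of s] s by simp
        then show ?thesis using True \<eta> r
          by (simp add: v_def matrix_vector_mult_scaleR ennreal_mult abs_mult)
      qed simp
      then have "(\<integral>\<^sup>+y. indicator B (y - s *\<^sub>R v) * ennreal (norm (G y *v v)) \<partial>lborel) \<le>
        (\<integral>\<^sup>+y. ennreal (\<eta> * r) * (indicator ?Q y * ennreal (norm (G y *v h))) \<partial>lborel)" by (rule nn_integral_mono)
      then show ?thesis by (simp add: nn_integral_cmult)
    qed
    then show "indicator {0..1} s * (\<integral>\<^sup>+y. indicator B (y - s *\<^sub>R v) * ennreal (norm (G y *v v)) \<partial>lborel) \<le>
      indicator {0..1} s * (ennreal (\<eta> * r) * ?W)"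
      by (auto simp: indicator_def)
  qed
  also have "\<dots> = ennreal (\<eta> * r) * ?W"
    by (simp add: nn_integral_multc)
  finally have 1: "ennreal (\<eta> * r * norm (L *v h) - 2 * (t * R)) * emeasure lborel B \<le> ennreal (\<eta> * r) * ?W" .
  have "?W = (\<integral>\<^sup>+y. indicator ?Q y * ennreal (norm (G y *v h)) \<partial>lebesgue)"
    by (rule nn_integral_completion[symmetric])
  also have "\<dots> = (\<integral>\<^sup>+y. indicator ?Q y * ennreal (norm (grad g y *v h)) \<partial>lebesgue)"
    using QK by (intro nn_integral_cong_AE eventually_mono[OF G]) (auto simp: indicator_def)
  also have "\<dots> \<le> ennreal ?a * (\<integral>\<^sup>+x. indicator ?Q x * ennreal (p x) \<partial>lebesgue) + ennreal ?b * emeasure lborel (F ` ?Q)"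
  proof (rule gradient_integral_bound[OF D F weak p dist compact_cbox QD _ _ l])
    fix x
    have "norm (grad g x *v h) \<le> onorm ((*v) (grad g x)) * norm h" by (rule onorm) simp
    also have "\<dots> \<le> onorm ((*v) (grad g x))" using h by (simp add: mult_left_le onorm_pos_le)
    finally show "norm (grad g x *v h) \<le> onorm ((*v) (grad g x))" .
  qed auto
  also have "\<dots> \<le> ennreal ?a * ennreal (c * R ^ ?n) + ennreal ?b * ennreal (m * R ^ ?n)"
    using pQ FQ by (intro add_mono mult_left_mono) auto
  also have "\<dots> = ennreal (?a * (c * R ^ ?n) + ?b * (m * R ^ ?n))"
  proof -
    have cm: "0 \<le> c * R ^ ?n" "0 \<le> m * R ^ ?n" using pos R0 by auto
    show ?thesis
      by (simp only: ennreal_mult[OF ab(1) cm(1), symmetric] ennreal_mult[OF ab(2) cm(2), symmetric]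
        ennreal_plus[OF mult_nonneg_nonneg[OF ab(1) cm(1)] mult_nonneg_nonneg[OF ab(2) cm(2)], symmetric])
  qed
  finally have "ennreal (\<eta> * r) * ?W \<le> ennreal (\<eta> * r) * ennreal (?a * (c * R ^ ?n) + ?b * (m * R ^ ?n))"
    by (rule mult_left_mono) simp
  also have "\<dots> = ennreal (\<eta> * r * (?a * (c * R ^ ?n) + ?b * (m * R ^ ?n)))"
    using \<eta> r by (intro ennreal_mult'[symmetric]) simp
  finally have main: "ennreal (\<eta> * r * norm (L *v h) - 2 * (t * R)) * emeasure lborel B \<le>
    ennreal (\<eta> * r * (?a * (c * R ^ ?n) + ?b * (m * R ^ ?n)))"
    using 1 by (rule order_trans[rotated])
  have eB: "emeasure lborel B = ennreal (r ^ ?n)"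
    using emeasure_cube[of r "x0 + (\<eta> * r) *\<^sub>R One"] r by (simp add: B_def)
  \<comment> \<open>Nonnegativity of the right side makes the real inequality valid even where
    \<open>ennreal\<close> has cut off a negative left side.\<close>
  have "0 \<le> \<eta> * r * (?a * (c * R ^ ?n) + ?b * (m * R ^ ?n))"
    using \<eta> r l n1 pos R0 by (intro mult_nonneg_nonneg add_nonneg_nonneg) auto
  with main have "(\<eta> * r * norm (L *v h) - 2 * (t * R)) * r ^ ?n \<le> \<eta> * r * (?a * (c * R ^ ?n) + ?b * (m * R ^ ?n))"
    using r by (simp add: eB ennreal_mult''[symmetric] ennreal_le_iff)
  \<comment> \<open>\<open>R = (1 + 2 * \<eta>) * r\<close> produces the power of
    \<open>1 + 2 * \<eta>\<close>, and the scale \<open>r\<close> becomes a common factor that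
    cancels at the end.\<close>
  also have "\<dots> = (\<eta> * (1 + 2 * \<eta>) ^ ?n * (?a * c + ?b * m)) * (r * r ^ ?n)"
  proof -
    have alg: "\<eta> * r * (A * (c * (u * w)) + A' * (m * (u * w))) = (\<eta> * u * (A * c + A' * m)) * (r * w)" for A A' u w
      by (simp add: algebra_simps)
    show ?thesis unfolding R power_mult_distrib by (rule alg)
  qed
  also have "(\<eta> * r * norm (L *v h) - 2 * (t * R)) * r ^ ?n =
      (\<eta> * norm (L *v h) - 2 * t * (1 + 2 * \<eta>)) * (r * r ^ ?n)"
    by (simp add: R left_diff_distrib)
  finally show ?thesis by (rule mult_right_le_imp_le) (use r in simp)
qed

text \<open>A blow-up at one point. Differentiability fixes a scale \<open>R\<close> at which
  \<open>f\<close> is close to its affine part, and uniform convergence then an index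
  \<open>j\<close> for which \<open>fs j\<close> is equally close; a single such map carries the
  whole estimate up to \<open>e\<close>. Its image of the cube lies near an affine copy of the
  parallelepiped spanned by \<open>L\<close>, so the volume is at most
  \<open>\<bar>det L\<bar> + e\<close> in units of \<open>R ^ CARD('n)\<close>.\<close>

lemma limit_distortion_at:
  fixes f :: "real^'n \<Rightarrow> real^'n" and L :: "real^'n^'n"
  assumes n: "CARD('n) \<ge> 2" and D: "open D" and fs: "\<And>j. continuous_on D (fs j)" "\<And>j. inj_on (fs j) D"
    and weak: "\<And>j i. weak_partial D (fs j) i (g j i)"
    and dist: "\<And>j. AE x in lebesgue. x \<in> D \<longrightarrow> 1 \<le> p j x \<and>
      onorm ((*v) (grad (g j) x)) ^ CARD('n) \<le> p j x ^ (CARD('n) - 1) * \<bar>det (grad (g j) x)\<bar>"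
    and \<rho>: "\<rho> > 0" "cball x0 (2 * \<rho>) \<subseteq> D" and unif: "uniform_limit (cball x0 (2 * \<rho>)) fs f sequentially"
    and p: "\<And>j. p j absolutely_integrable_on (cball x0 (2 * \<rho>))"
    and der: "(f has_derivative (*v) L) (at x0)" and q: "q > 0"
    and lp: "\<And>e. e > 0 \<Longrightarrow> \<exists>d>0. \<forall>R. 0 < R \<and> R < d \<longrightarrow> (\<forall>\<^sub>F j in sequentially.
      (\<integral>\<^sup>+y. indicator (cbox x0 (x0 + R *\<^sub>R One)) y * ennreal (p j y) \<partial>lebesgue) \<le> ennreal ((q + e) * R ^ CARD('n)))"
  shows "onorm ((*v) L) ^ CARD('n) \<le> q ^ (CARD('n) - 1) * \<bar>det L\<bar>"
proof (rule young_power_converse[OF n _ q])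
  let ?n = "CARD('n)"
  have n1: "1 \<le> real ?n" using n by simp
  fix l :: real assume l: "0 < l"
  let ?a = "(real ?n - 1) / real ?n * l" and ?b = "1 / (real ?n * l ^ (?n - 1))"
  have ab: "0 \<le> ?a" "0 \<le> ?b" using l n1 by auto
  have unit: "norm (L *v h) \<le> ?a * q + ?b * \<bar>det L\<bar>" if h: "norm h \<le> 1" for h
  proof (rule increment_limit[where n="?n"])
    fix e \<eta> :: real assume e: "0 < e" and \<eta>: "0 < \<eta>"
    obtain U t0 where U: "open U" "t0 > 0" "emeasure lebesgue U \<le> ennreal (\<bar>det L\<bar> + e)"
      "\<And>y z. y \<in> cube 1 \<Longrightarrow> norm z \<le> t0 \<Longrightarrow> L *v y + z \<in> U"
      using linear_cube_neighbourhood[OF e, of L] by metis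
    \<comment> \<open>\<open>t0\<close> keeps the rescaled images inside \<open>U\<close>;
      \<open>e\<close> makes the approximation error vanish together with \<open>e\<close>.\<close>
    define t where "t = min t0 e"
    have t: "0 < t" "t \<le> t0" "t \<le> e" using U(2) e by (auto simp: t_def)
    \<comment> \<open>On the cube \<open>norm (y - x0)\<close> is at most \<open>?n * R\<close>, so
      this slope costs \<open>t / 2 * R\<close>. The other half is left to uniform
      convergence.\<close>
    have "t / (2 * real ?n) > 0" using t n1 by simp
    then obtain \<delta> where \<delta>: "\<delta> > 0" "\<And>y. norm (y - x0) < \<delta> \<Longrightarrow> norm (f y - f x0 - L *v (y - x0)) \<le> t / (2 * real ?n) * norm (y - x0)"
      using der unfolding has_derivative_at_alt by meson
    obtain d where d: "d > 0" "\<And>R. 0 < R \<Longrightarrow> R < d \<Longrightarrow> \<forall>\<^sub>F j in sequentially.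
      (\<integral>\<^sup>+y. indicator (cbox x0 (x0 + R *\<^sub>R One)) y * ennreal (p j y) \<partial>lebesgue) \<le> ennreal ((q + e) * R ^ ?n)"
      using lp[OF e] by blast
    define R where "R = min (min \<rho> \<delta> / (2 * real ?n)) (d / 2)"
    have R: "0 < R" "R < d" using \<rho> \<delta> d n1 by (auto simp: R_def)
    have "real ?n * R \<le> real ?n * (min \<rho> \<delta> / (2 * real ?n))" using n1 by (intro mult_left_mono) (auto simp: R_def)
    also have "\<dots> = min \<rho> \<delta> / 2" using n1 by simp
    also have "\<dots> < min \<rho> \<delta>" using \<rho>(1) \<delta>(1) by (simp add: min_def)
    finally have nR: "real ?n * R < \<rho>" "real ?n * R < \<delta>" by auto
    define r where "r = R / (1 + 2 * \<eta>)"
    have r: "0 < r" "R = (1 + 2 * \<eta>) * r" using R \<eta> by (auto simp: r_def)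
    let ?Q = "cbox x0 (x0 + R *\<^sub>R One)"
    have Qn: "norm (y - x0) \<le> real ?n * R" if "y \<in> ?Q" for y
    proof -
      have "y - x0 \<in> cube R" using that by (auto simp: mem_box inner_simps algebra_simps)
      from norm_cube_le[OF this] show ?thesis by simp
    qed
    have QK: "?Q \<subseteq> cball x0 (2 * \<rho>)"
    proof
      fix y assume "y \<in> ?Q"
      from Qn[OF this] show "y \<in> cball x0 (2 * \<rho>)" using nR(1) \<rho>(1) by (simp add: dist_norm norm_minus_commute)
    qed
    have "\<forall>\<^sub>F j in sequentially. \<forall>y\<in>cball x0 (2 * \<rho>). dist (fs j y) (f y) < t / 2 * R"
      using uniform_limitD[OF unif, of "t / 2 * R"] t R by simp
    from eventually_happens'[OF sequentially_bot eventually_conj[OF this d(2)[OF R]]]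
    obtain j where j: "\<And>y. y \<in> cball x0 (2 * \<rho>) \<Longrightarrow> dist (fs j y) (f y) < t / 2 * R"
      "(\<integral>\<^sup>+y. indicator ?Q y * ennreal (p j y) \<partial>lebesgue) \<le> ennreal ((q + e) * R ^ ?n)"
      by blast
    have close: "norm (fs j y - f x0 - L *v (y - x0)) \<le> t * R" if y: "y \<in> ?Q" for y
    proof -
      have "norm (f y - f x0 - L *v (y - x0)) \<le> t / (2 * real ?n) * norm (y - x0)"
        using \<delta>(2) Qn[OF y] nR by simp
      also have "\<dots> \<le> t / (2 * real ?n) * (real ?n * R)"
        using Qn[OF y] t n1 by (intro mult_left_mono) auto
      also have "\<dots> = t / 2 * R" using n1 by simp
      finally have "norm (f y - f x0 - L *v (y - x0)) \<le> t / 2 * R" .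
      moreover have "norm (fs j y - f y) < t / 2 * R" using j(1) y QK by (auto simp: dist_norm)
      moreover have eq: "fs j y - f x0 - L *v (y - x0) = (fs j y - f y) + (f y - f x0 - L *v (y - x0))" by simp
      ultimately show ?thesis unfolding eq
        using norm_triangle_ineq[of "fs j y - f y" "f y - f x0 - L *v (y - x0)"] by linarith
    qed
    have FQ: "emeasure lborel (fs j ` ?Q) \<le> ennreal ((\<bar>det L\<bar> + e) * R ^ ?n)"
    proof -
      have cont: "continuous_on ?Q (fs j)" using fs(1) by (rule continuous_on_subset) (use QK \<rho> in auto)
      have cpt: "compact (fs j ` ?Q)" by (rule compact_continuous_image[OF cont compact_cbox])
      \<comment> \<open>In the coordinates \<open>u\<close> on the unit cube, the translated and
        rescaled map is \<open>L\<close> up to an error of norm at most \<open>t0\<close>, so its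
        values lie in \<open>U\<close>.\<close>
      have sub: "fs j ` ?Q \<subseteq> (\<lambda>w. R *\<^sub>R w + f x0) ` U"
      proof (rule image_subsetI)
        fix y assume y: "y \<in> ?Q"
        define u z where "u = (1 / R) *\<^sub>R (y - x0)" and "z = (1 / R) *\<^sub>R (fs j y - f x0 - L *v (y - x0))"
        have "u \<in> cube 1" using y R(1) by (auto simp: u_def mem_box inner_simps divide_simps)
        moreover have "norm z \<le> t0" using close[OF y] R(1) t(2) by (simp add: z_def divide_simps) (meson mult_right_mono order_trans less_imp_le)
        ultimately have "L *v u + z \<in> U" by (rule U(4))
        moreover have "fs j y = R *\<^sub>R (L *v u + z) + f x0"
          using R(1) by (simp add: u_def z_def scaleR_right_distrib matrix_vector_mult_scaleR)
        ultimately show "fs j y \<in> (\<lambda>w. R *\<^sub>R w + f x0) ` U" by blast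
      qed
      have "open ((\<lambda>w. R *\<^sub>R w + f x0) ` U)"
        using open_affinity[OF U(1), of R "f x0"] R(1) by (simp add: add.commute)
      from borel_open[OF this] have Us: "(\<lambda>w. R *\<^sub>R w + f x0) ` U \<in> sets lebesgue" by auto
      have "emeasure lborel (fs j ` ?Q) = emeasure lebesgue (fs j ` ?Q)"
        using cpt by (simp add: borel_compact)
      also have "\<dots> \<le> emeasure lebesgue ((\<lambda>w. R *\<^sub>R w + f x0) ` U)"
        by (rule emeasure_mono[OF sub Us])
      also have "\<dots> = ennreal (R ^ ?n) * emeasure lebesgue U"
        using emeasure_lebesgue_affine[of R "f x0" U] R(1) by (simp add: ennreal_power)
      also have "\<dots> \<le> ennreal (R ^ ?n) * ennreal (\<bar>det L\<bar> + e)"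
        using U(3) by (rule mult_left_mono) simp
      also have "\<dots> = ennreal ((\<bar>det L\<bar> + e) * R ^ ?n)"
        using R(1) e by (simp add: ennreal_mult[symmetric] mult.commute del: ennreal_plus)
      finally show ?thesis .
    qed
    have pQ: "p j absolutely_integrable_on ?Q"
      by (rule set_integrable_subset[OF p]) (use QK in auto)
    have "\<eta> * norm (L *v h) - 2 * t * (1 + 2 * \<eta>) \<le> \<eta> * (1 + 2 * \<eta>) ^ ?n * (?a * (q + e) + ?b * (\<bar>det L\<bar> + e))"
      by (rule increment_estimate[OF D fs weak dist \<rho>(2) nR(1) pQ \<eta> r(1,2) h l _ _ _ close j(2) FQ])
         (use q e t in auto)
    moreover have "2 * t * (1 + 2 * \<eta>) \<le> 2 * e * (1 + 2 * \<eta>)"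
      using t \<eta> by (intro mult_right_mono) auto
    ultimately show "\<eta> * norm (L *v h) - 2 * e * (1 + 2 * \<eta>) \<le> \<eta> * (1 + 2 * \<eta>) ^ ?n * (?a * (q + e) + ?b * (\<bar>det L\<bar> + e))"
      by linarith
  qed
  have "onorm ((*v) L) \<le> ?a * q + ?b * \<bar>det L\<bar>"
  proof (rule onorm_bound)
    show "0 \<le> ?a * q + ?b * \<bar>det L\<bar>"
      by (intro add_nonneg_nonneg mult_nonneg_nonneg[OF ab(1)] mult_nonneg_nonneg[OF ab(2)]) (use q in simp_all)
    fix x :: "real^'n"
    show "norm (L *v x) \<le> (?a * q + ?b * \<bar>det L\<bar>) * norm x"
    proof (cases "x = 0")
      case False
      then have "norm (L *v ((1 / norm x) *\<^sub>R x)) \<le> ?a * q + ?b * \<bar>det L\<bar>" by (intro unit) simp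
      then show ?thesis using False by (simp add: matrix_vector_mult_scaleR pos_divide_le_eq)
    qed simp
  qed
  then show "onorm ((*v) L) \<le> (real ?n - 1) / real ?n * (l * q) + 1 / real ?n * (\<bar>det L\<bar> / l ^ (?n - 1))"
    by simp
qed (simp_all add: onorm_pos_le)

text \<open>The dilatations are replaced by real functions \<open>p j\<close> of the weak gradients,
  measurable on the ball and almost everywhere between 1 and \<open>P\<close>. Their upper limit
  \<open>q\<close> is integrable, so almost every point is a Lebesgue point of it, and domination by
  \<open>P\<close> permits the reverse Fatou lemma. The blow-up at such a point gives the distortion
  inequality with \<open>q x\<close>.\<close>

lemma P_dil_limsup_local:
  fixes f :: "real^'n \<Rightarrow> real^'n" and fs :: "nat \<Rightarrow> real^'n \<Rightarrow> real^'n"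
  assumes n: "CARD('n) \<ge> 2" and D: "open D" and fs: "\<And>j. continuous_on D (fs j)" "\<And>j. inj_on (fs j) D"
    and weak: "\<And>j i. weak_partial D (fs j) i (g j i)"
    and dil: "\<And>j. AE x in lebesgue. x \<in> D \<longrightarrow> P_dil (fs j) x \<le> ereal (P x) \<and> grad (g j) x = jac (fs j) x"
    and P: "P absolutely_integrable_on (cball a \<rho>)" and \<rho>: "cball a \<rho> \<subseteq> D"
    and unif: "uniform_limit (cball a \<rho>) fs f sequentially"
    and diff: "AE x in lebesgue. x \<in> D \<longrightarrow> f differentiable (at x)"
  shows "AE x in lebesgue. x \<in> ball a \<rho> \<longrightarrow> P_dil f x \<le> limsup (\<lambda>j. P_dil (fs j) x)"
proof -
  let ?n = "CARD('n)"
  define K where "K = cball a \<rho>"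
  have KD: "K \<subseteq> D" and Ks [measurable]: "K \<in> sets lebesgue" using \<rho> by (auto simp: K_def)
  define p where "p j x = matrix_dil (grad (g j) x)" for j x
  have facts: "AE x in lebesgue. x \<in> D \<longrightarrow> P_dil (fs j) x = ereal (p j x) \<and> 1 \<le> p j x \<and> p j x \<le> P x \<and>
      onorm ((*v) (grad (g j) x)) ^ ?n \<le> p j x ^ (?n - 1) * \<bar>det (grad (g j) x)\<bar>" for j
    using dil[of j]
  proof eventually_elim
    case (elim x)
    show ?case
    proof
      assume "x \<in> D"
      with elim have le: "P_dil (fs j) x \<le> ereal (P x)" and gr: "grad (g j) x = jac (fs j) x" by auto
      have eq: "P_dil (fs j) x = ereal (p j x)"
        using P_dil_eq_matrix_dil[OF n le] by (simp add: p_def gr)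
      then have "P_dil (fs j) x \<le> ereal (p j x)" by simp
      from P_dil_leD[OF n this] le eq show "P_dil (fs j) x = ereal (p j x) \<and> 1 \<le> p j x \<and> p j x \<le> P x \<and>
        onorm ((*v) (grad (g j) x)) ^ ?n \<le> p j x ^ (?n - 1) * \<bar>det (grad (g j) x)\<bar>"
        by (simp add: gr)
    qed
  qed
  have all: "AE x in lebesgue. \<forall>j. x \<in> D \<longrightarrow> P_dil (fs j) x = ereal (p j x) \<and> 1 \<le> p j x \<and> p j x \<le> P x"
    unfolding AE_all_countable
  proof
    fix j show "AE x in lebesgue. x \<in> D \<longrightarrow> P_dil (fs j) x = ereal (p j x) \<and> 1 \<le> p j x \<and> p j x \<le> P x"
      using facts[of j] by eventually_elim blast
  qed
  have "g j i absolutely_integrable_on K" for j i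
    using weak[of j i] KD by (simp add: weak_partial_def loc_integrable_def K_def)
  from borel_measurable_integrable[OF integrable_indicator_grad[OF this]]
  have [measurable]: "(\<lambda>x. indicator K x *\<^sub>R grad (g j) x) \<in> borel_measurable lebesgue" for j .
  have "(\<lambda>x. indicator K x * matrix_dil (indicator K x *\<^sub>R grad (g j) x)) \<in> borel_measurable lebesgue" for j
    by measurable
  moreover have "indicator K x * matrix_dil (indicator K x *\<^sub>R grad (g j) x) = indicator K x * p j x" for x j
    by (simp add: p_def indicator_def)
  ultimately have pm [measurable]: "(\<lambda>x. indicator K x * p j x) \<in> borel_measurable lebesgue" for j by simp
  have PK: "integrable lebesgue (\<lambda>x. indicator K x * P x)" using P by (simp add: set_integrable_def K_def)
  have pK: "p j absolutely_integrable_on K" for j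
    unfolding set_integrable_def
  proof (rule Bochner_Integration.integrable_bound[OF PK])
    show "AE x in lebesgue. norm (indicator K x *\<^sub>R p j x) \<le> norm (indicator K x * P x)"
      using facts[of j] by eventually_elim (use KD in \<open>auto simp: indicator_def\<close>)
  qed (use pm in simp)
  define Q where "Q x = limsup (\<lambda>j. ereal (indicator K x * p j x))" for x
  \<comment> \<open>\<open>max 0\<close> makes \<open>q\<close> nonnegative everywhere, also on the
    null set where the bounds on \<open>p j\<close> fail.\<close>
  define q where "q x = indicator K x * max 0 (real_of_ereal (Q x))" for x
  have [measurable]: "Q \<in> borel_measurable lebesgue"
    unfolding Q_def[abs_def] by (intro borel_measurable_limsup) measurable
  have qm [measurable]: "q \<in> borel_measurable lebesgue" unfolding q_def[abs_def] by measurable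
  have q: "ereal (q x) = limsup (\<lambda>j. P_dil (fs j) x) \<and> ereal (q x) = limsup (\<lambda>j. ereal (p j x)) \<and> 1 \<le> q x \<and> q x \<le> P x"
    if x: "x \<in> K" and *: "\<forall>j. x \<in> D \<longrightarrow> P_dil (fs j) x = ereal (p j x) \<and> 1 \<le> p j x \<and> p j x \<le> P x" for x
  proof -
    have xD: "x \<in> D" using x KD by blast
    have Q: "Q x = limsup (\<lambda>j. ereal (p j x))" using x by (simp add: Q_def)
    have "1 \<le> Q x" unfolding Q
      using * xD by (intro le_Limsup) (auto simp: one_ereal_def)
    moreover have "Q x \<le> ereal (P x)" unfolding Q
      using * xD by (intro Limsup_bounded) auto
    ultimately obtain z where z: "Q x = ereal z" "1 \<le> z" "z \<le> P x"
      by (cases "Q x") (auto simp: one_ereal_def)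
    have "q x = z" using x z by (simp add: q_def)
    moreover have "limsup (\<lambda>j. P_dil (fs j) x) = limsup (\<lambda>j. ereal (p j x))" using * xD by simp
    ultimately show ?thesis using z Q by simp
  qed
  have q0: "0 \<le> q x" for x by (simp add: q_def)
  have qint: "integrable lebesgue q"
  proof (rule Bochner_Integration.integrable_bound[OF PK])
    show "AE x in lebesgue. norm (q x) \<le> norm (indicator K x * P x)"
      using all
    proof eventually_elim
      case (elim x)
      show ?case
      proof (cases "x \<in> K")
        case True
        from q[OF True elim] True show ?thesis by simp
      qed (simp add: q_def)
    qed
  qed (rule qm)
  \<comment> \<open>The reverse Fatou lemma bounds the upper limit of the integrals by
    \<open>c\<close>; the gap \<open>c < c'\<close> turns this into a bound for all large
    \<open>j\<close>.\<close>
  have lp: "\<forall>\<^sub>F j in sequentially. (\<integral>\<^sup>+y. indicator S y * ennreal (p j y) \<partial>lebesgue) \<le> ennreal c'"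
    if S [measurable]: "S \<in> sets lebesgue" "S \<subseteq> K" and le: "(\<integral>\<^sup>+y. indicator S y * ennreal (q y) \<partial>lebesgue) \<le> ennreal c" "c < c'" "0 \<le> c" for S c c'
  proof -
    have eqS: "indicator S y * ennreal (u y) = indicator S y * ennreal (indicator K y * u y)" for u :: "real^'n \<Rightarrow> real" and y
      using S(2) by (auto simp: indicator_def)
    have "limsup (\<lambda>j. \<integral>\<^sup>+y. indicator S y * ennreal (p j y) \<partial>lebesgue) \<le>
        (\<integral>\<^sup>+y. limsup (\<lambda>j. indicator S y * ennreal (p j y)) \<partial>lebesgue)"
    proof (rule nn_integral_limsup[where w="\<lambda>y. ennreal (indicator K y * P y)"])
      show "(\<lambda>y. indicator S y * ennreal (p j y)) \<in> borel_measurable lebesgue" for j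
        unfolding eqS[where u="p j"] by measurable
      show "(\<lambda>y. ennreal (indicator K y * P y)) \<in> borel_measurable lebesgue"
        using borel_measurable_integrable[OF PK] by simp
      show "AE y in lebesgue. indicator S y * ennreal (p j y) \<le> ennreal (indicator K y * P y)" for j
        using all
      proof eventually_elim
        case (elim y)
        show ?case
        proof (cases "y \<in> S")
          case True
          then have "y \<in> K" "y \<in> D" using S(2) KD by auto
          then show ?thesis using elim True by (auto intro!: ennreal_leI)
        qed simp
      qed
      have "(\<integral>\<^sup>+y. ennreal (indicator K y * P y) \<partial>lebesgue) \<le> (\<integral>\<^sup>+y. ennreal (norm (indicator K y * P y)) \<partial>lebesgue)"
        by (intro nn_integral_mono ennreal_leI) simp
      also have "\<dots> < \<infinity>" using PK unfolding integrable_iff_bounded by blast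
      finally show "(\<integral>\<^sup>+y. ennreal (indicator K y * P y) \<partial>lebesgue) < \<infinity>" .
    qed
    also have "\<dots> = (\<integral>\<^sup>+y. indicator S y * ennreal (q y) \<partial>lebesgue)"
    proof (rule nn_integral_cong_AE)
      show "AE y in lebesgue. limsup (\<lambda>j. indicator S y * ennreal (p j y)) = indicator S y * ennreal (q y)"
        using all
      proof eventually_elim
        case (elim y)
        show ?case
        proof (cases "y \<in> S")
          case True
          then have "y \<in> K" using S(2) by blast
          from q[OF this elim, THEN conjunct2, THEN conjunct1]
          have lq: "limsup (\<lambda>j. ereal (p j y)) = ereal (q y)" by (rule sym)
          \<comment> \<open>\<open>e2ennreal\<close> is monotone and continuous, hence commutes with
            upper limits.\<close>
          have "limsup (e2ennreal \<circ> (\<lambda>j. ereal (p j y))) = e2ennreal (limsup (\<lambda>j. ereal (p j y)))"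
            unfolding comp_def
            by (rule Limsup_compose_continuous_mono) (auto simp: mono_def e2ennreal_mono continuous_on_e2ennreal)
          then show ?thesis using True lq by (simp add: comp_def)
        qed (simp add: Limsup_const)
      qed
    qed
    also have "\<dots> \<le> ennreal c" by (rule le(1))
    also have "\<dots> < ennreal c'" using le by (simp add: ennreal_lessI)
    finally have "\<forall>\<^sub>F j in sequentially. (\<integral>\<^sup>+y. indicator S y * ennreal (p j y) \<partial>lebesgue) < ennreal c'"
      by (rule Limsup_lessD)
    then show ?thesis by (rule eventually_mono) simp
  qed
  show ?thesis
    using AE_lebesgue_point_real[OF qint q0] all diff
  proof eventually_elim
    case (elim x)
    show ?case
    proof
      assume x: "x \<in> ball a \<rho>"
      then have xK: "x \<in> K" and xD: "x \<in> D" using KD by (auto simp: K_def)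
      note qx = q[OF xK elim(2)]
      \<comment> \<open>Halved because the blow-up takes place in a ball of radius
        \<open>2 * \<rho>'\<close>.\<close>
      define \<rho>' where "\<rho>' = (\<rho> - dist a x) / 2"
      have \<rho>': "\<rho>' > 0" using x by (simp add: \<rho>'_def)
      have sub: "cball x (2 * \<rho>') \<subseteq> K"
      proof
        fix y assume "y \<in> cball x (2 * \<rho>')"
        then show "y \<in> K" using dist_triangle[of a y x] by (simp add: K_def \<rho>'_def)
      qed
      obtain f' where f': "(f has_derivative f') (at x)" using elim(3) xD by (auto simp: differentiable_def)
      have lin: "linear f'" using f' by (simp add: has_derivative_linear)
      have J: "jac f x = matrix f'"
        by (simp add: jac_def matrix_def has_derivative_imp_partial_dir(2)[OF f'])
      have der: "(f has_derivative (*v) (jac f x)) (at x)"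
        unfolding J using f' lin by simp
      have "onorm ((*v) (jac f x)) ^ ?n \<le> q x ^ (?n - 1) * \<bar>det (jac f x)\<bar>"
      proof (rule limit_distortion_at[where \<rho>=\<rho>' and p=p, OF n D fs weak _ \<rho>' _ _ _ der])
        show "AE x in lebesgue. x \<in> D \<longrightarrow> 1 \<le> p j x \<and>
          onorm ((*v) (grad (g j) x)) ^ ?n \<le> p j x ^ (?n - 1) * \<bar>det (grad (g j) x)\<bar>" for j
          using facts[of j] by eventually_elim blast
        show "cball x (2 * \<rho>') \<subseteq> D" using sub KD by blast
        show "uniform_limit (cball x (2 * \<rho>')) fs f sequentially"
          using unif sub[unfolded K_def] by (rule uniform_limit_on_subset)
        show "p j absolutely_integrable_on cball x (2 * \<rho>')" for j
          by (rule set_integrable_subset[OF pK]) (use sub in auto)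
        show "q x > 0" using qx by simp
        fix e :: real assume e: "e > 0"
        \<comment> \<open>Half of \<open>e\<close> is spent on the Lebesgue point, the other half on
          the gap required by \<open>lp\<close>.\<close>
        from elim(1)[THEN spec, THEN mp, OF half_gt_zero[OF e]]
        obtain d where "d > 0" and dr: "\<forall>r. 0 < r \<and> r < d \<longrightarrow>
          (\<integral>\<^sup>+y. indicator (cbox x (x + r *\<^sub>R One)) y * ennreal (q y) \<partial>lebesgue) \<le> ennreal ((q x + e / 2) * r ^ ?n)"
          by blast
        note d = \<open>d > 0\<close> dr[THEN spec, THEN mp, OF conjI]
        show "\<exists>d>0. \<forall>R. 0 < R \<and> R < d \<longrightarrow> (\<forall>\<^sub>F j in sequentially.
          (\<integral>\<^sup>+y. indicator (cbox x (x + R *\<^sub>R One)) y * ennreal (p j y) \<partial>lebesgue) \<le> ennreal ((q x + e) * R ^ ?n))"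
        proof (intro exI[of _ "min d (\<rho>' / real ?n)"] conjI allI impI)
          show "0 < min d (\<rho>' / real ?n)" using d(1) \<rho>' by simp
          fix R assume R: "0 < R \<and> R < min d (\<rho>' / real ?n)"
          then have nR: "real ?n * R < \<rho>'" by (simp add: pos_less_divide_eq mult.commute)
          have "cbox x (x + R *\<^sub>R One) \<subseteq> cball x (2 * \<rho>')"
          proof
            fix y assume "y \<in> cbox x (x + R *\<^sub>R One)"
            then have "y - x \<in> cube R" by (auto simp: mem_box inner_simps algebra_simps)
            from norm_cube_le[OF this] show "y \<in> cball x (2 * \<rho>')"
              using nR \<rho>' by (simp add: dist_norm norm_minus_commute)
          qed
          then have SK: "cbox x (x + R *\<^sub>R One) \<subseteq> K" using sub by blast
          show "\<forall>\<^sub>F j in sequentially.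
            (\<integral>\<^sup>+y. indicator (cbox x (x + R *\<^sub>R One)) y * ennreal (p j y) \<partial>lebesgue) \<le> ennreal ((q x + e) * R ^ ?n)"
          proof (rule lp[OF _ SK d(2)])
            show "0 < R" "R < d" using R by auto
            show "(q x + e / 2) * R ^ ?n < (q x + e) * R ^ ?n"
              using R e by (intro mult_strict_right_mono) auto
            show "0 \<le> (q x + e / 2) * R ^ ?n"
              using R e q0[of x] by (intro mult_nonneg_nonneg) auto
          qed simp
        qed
      qed
      from P_dil_leI[OF n has_derivative_imp_has_all_partials[OF f'] _ this]
        qx[THEN conjunct1] qx[THEN conjunct2, THEN conjunct2, THEN conjunct1]
      show "P_dil f x \<le> limsup (\<lambda>j. P_dil (fs j) x)" by simp
    qed
  qed
qed

section \<open>From local estimates to the whole domain\<close>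

theorem theorem5p1:
  fixes D :: "(real^'n) set"
    and fs :: "nat \<Rightarrow> real^'n \<Rightarrow> real^'n"
    and f :: "real^'n \<Rightarrow> real^'n"
    and P :: "real^'n \<Rightarrow> real"
  assumes n2: "CARD('n) \<ge> 2"
    and dom: "open D" "connected D" "D \<noteq> {}"
    and homeo: "\<And>j. \<exists>g. homeomorphism D (fs j ` D) (fs j) g"
    and sob: "\<And>j. W11_loc D (fs j)"
    and conv: "\<And>K. compact K \<Longrightarrow> K \<subseteq> D \<Longrightarrow> uniform_limit K fs f sequentially"
    and diff: "AE x in lebesgue. x \<in> D \<longrightarrow> f differentiable (at x)"
    and bound: "AE x in lebesgue. x \<in> D \<longrightarrow> (\<forall>j. P_dil (fs j) x \<le> ereal (P x))"
    and Ploc: "loc_integrable D P"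
  shows "(AE x in lebesgue. x \<in> D \<longrightarrow> P_dil f x \<le> limsup (\<lambda>j. P_dil (fs j) x))
       \<and> ((\<exists>g. homeomorphism D (f ` D) f g) \<longrightarrow>
            W11_loc D f \<and>
            (\<forall>g G. (\<forall>j i. weak_partial D (fs j) i (g j i)) \<and> (\<forall>i. weak_partial D f i (G i))
                \<longrightarrow> (\<forall>i. weak_conv_L1loc D (\<lambda>j. g j i) (G i))))"
proof -
  let ?n = "CARD('n)"
  note D = dom(1)
  have cont: "continuous_on D (fs j)" and inj: "inj_on (fs j) D" for j
  proof -
    obtain g where g: "homeomorphism D (fs j ` D) (fs j) g" using homeo by blast
    then show "continuous_on D (fs j)" by (rule homeomorphism_cont1)
    show "inj_on (fs j) D" using homeomorphism_apply1[OF g] by (rule inj_on_inverseI)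
  qed
  \<comment> \<open>Continuity of the limit is inherited from uniform convergence on closed balls
    inside \<open>D\<close>.\<close>
  have fcont: "continuous_on D f"
    unfolding continuous_on_eq_continuous_at[OF D]
  proof
    fix x assume "x \<in> D"
    then obtain e where e: "e > 0" "cball x e \<subseteq> D" using D open_contains_cball by blast
    have "continuous_on (cball x e) f"
      by (rule uniform_limit_theorem[OF _ conv[OF compact_cball e(2)]])
         (auto intro!: always_eventually continuous_on_subset[OF cont e(2)])
    then show "isCont f x" by (rule continuous_on_interior) (use e in auto)
  qed
  have grad_jac: "AE x in lebesgue. x \<in> D \<longrightarrow> grad g x = jac (fs j) x"
    if g: "\<And>i. weak_partial D (fs j) i (g i)" for g j
  proof -
    \<comment> \<open>\<open>P\<close> has finite values, and the dilatation is infinite where a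
      partial derivative is missing.\<close>
    have "AE x in lebesgue. x \<in> D \<longrightarrow> has_all_partials (fs j) x"
      using bound by eventually_elim (use P_dil_leD(1)[OF n2] in blast)
    from weak_partial_eq_partial_dir[OF D cont g this] show ?thesis
      by eventually_elim (use grad_eq_jac in blast)
  qed
  have dil: "AE x in lebesgue. x \<in> D \<longrightarrow> P_dil (fs j) x \<le> ereal (P x) \<and> grad g x = jac (fs j) x"
    if "\<And>i. weak_partial D (fs j) i (g i)" for g j
    using bound grad_jac[OF that] by eventually_elim blast
  have dist: "AE x in lebesgue. x \<in> D \<longrightarrow> 1 \<le> P x \<and>
      onorm ((*v) (grad g x)) ^ ?n \<le> P x ^ (?n - 1) * \<bar>det (grad g x)\<bar>"
    if "\<And>i. weak_partial D (fs j) i (g i)" for g j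
    using dil[OF that] by eventually_elim (use P_dil_leD(2,3)[OF n2] in metis)
  have PK: "P absolutely_integrable_on K" if "compact K" "K \<subseteq> D" for K
    using Ploc that by (simp add: loc_integrable_def)
  have equi: "equi_int K (\<lambda>j. g j i)"
    and bnd: "\<exists>C. \<forall>j. (\<integral>\<^sup>+x. indicator K x * ennreal (norm (g j i x)) \<partial>lebesgue) \<le> ennreal C"
    if g: "\<And>j i. weak_partial D (fs j) i (g j i)" and K: "compact K" "K \<subseteq> D" for g K i
  proof -
    have "\<exists>R>0. \<forall>j. fs j ` K \<subseteq> cball 0 R"
      by (rule uniformly_bounded_images[OF K(1) continuous_on_subset[OF cont K(2)] conv[OF K]])
    then obtain R where R: "\<And>j. fs j ` K \<subseteq> cball 0 R" by blast
    \<comment> \<open>All images of \<open>K\<close> lie in one ball, whose volume bounds theirs;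
      \<open>max 1\<close> supplies the strict positivity that \<open>gradient_equi_int\<close> asks
      for.\<close>
    define M where "M = max 1 (measure lborel (cball (0::real^'n) R))"
    have "emeasure lborel (fs j ` K) \<le> ennreal M" for j
    proof -
      have "emeasure lborel (fs j ` K) \<le> emeasure lborel (cball (0::real^'n) R)"
        using R by (intro emeasure_mono) auto
      also have "\<dots> = ennreal (measure lborel (cball (0::real^'n) R))"
        using emeasure_bounded_finite[of "cball (0::real^'n) R"] by (intro emeasure_eq_ennreal_measure) auto
      also have "\<dots> \<le> ennreal M" by (intro ennreal_leI) (simp add: M_def)
      finally show ?thesis .
    qed
    note * = gradient_equi_int[where i=i, OF n2 D cont inj g PK[OF K] dist[OF g] K this]
    show "equi_int K (\<lambda>j. g j i)" by (rule *(1)) (simp add: M_def)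
    show "\<exists>C. \<forall>j. (\<integral>\<^sup>+x. indicator K x * ennreal (norm (g j i x)) \<partial>lebesgue) \<le> ennreal C"
      by (rule *(2)) (simp add: M_def)
  qed
  have "\<forall>j i. \<exists>g. weak_partial D (fs j) i g" using sob by (simp add: W11_loc_def)
  then obtain g where g: "\<And>j i. weak_partial D (fs j) i (g j i)" by metis
  have "AE x in lebesgue. x \<in> D \<longrightarrow> P_dil f x \<le> limsup (\<lambda>j. P_dil (fs j) x)"
  proof (rule AE_lebesgue_local)
    fix a assume "a \<in> D"
    then obtain e where e: "e > 0" "cball a e \<subseteq> D" using D open_contains_cball by blast
    have "AE x in lebesgue. x \<in> ball a e \<longrightarrow> P_dil f x \<le> limsup (\<lambda>j. P_dil (fs j) x)"
      by (rule P_dil_limsup_local[OF n2 D cont inj g dil[OF g] PK[OF compact_cball e(2)] e(2) conv[OF compact_cball e(2)] diff])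
    then show "\<exists>V. open V \<and> a \<in> V \<and> (AE x in lebesgue. x \<in> V \<longrightarrow> P_dil f x \<le> limsup (\<lambda>j. P_dil (fs j) x))"
      using e(1) by (intro exI[of _ "ball a e"]) simp
  qed
  moreover have "W11_loc D f"
    unfolding W11_loc_def loc_integrable_def
  proof (intro conjI allI impI)
    fix K assume K: "compact K \<and> K \<subseteq> D"
    then have "integrable lborel (\<lambda>x. indicator K x *\<^sub>R f x)"
      using continuous_on_subset[OF fcont] by (intro borel_integrable_compact) auto
    then show "f absolutely_integrable_on K"
      unfolding set_integrable_def by (intro integrable_completion[THEN iffD2]) auto
  next
    fix i
    have pd: "AE x in lebesgue. x \<in> D \<longrightarrow>
        ((\<lambda>t. f (x + t *\<^sub>R axis i 1)) has_vector_derivative partial_dir f i x) (at 0)"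
      using diff
    proof eventually_elim
      case (elim x)
      show ?case
      proof
        assume "x \<in> D"
        with elim obtain f' where f': "(f has_derivative f') (at x)" by (auto simp: differentiable_def)
        show "((\<lambda>t. f (x + t *\<^sub>R axis i 1)) has_vector_derivative partial_dir f i x) (at 0)"
          using has_derivative_imp_partial_dir[OF f', of i] by simp
      qed
    qed
    have lim: "(\<lambda>j. fs j x) \<longlonglongrightarrow> f x" if "x \<in> D" for x
      by (rule tendsto_uniform_limitI[OF conv[of "{x}"]]) (use that in auto)
    have "weak_partial D f i (partial_dir f i)"
      by (rule weak_partial_limit[OF D cont g fcont lim equi[OF g] pd])
    then show "\<exists>g. weak_partial D f i g" by blast
  qed
  \<comment> \<open>The weak derivatives here are arbitrary versions, so equi-integrability and the
    bounds are taken for the given \<open>g\<close>.\<close>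
  moreover have "weak_conv_L1loc D (\<lambda>j. g j i) (G i)"
    if g: "\<And>j i. weak_partial D (fs j) i (g j i)" and G: "\<And>i. weak_partial D f i (G i)" for g G i
    by (rule weak_partial_weak_conv[OF D cont g G conv equi[OF g] bnd[OF g]])
  ultimately show ?thesis by blast
qed

end
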